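(* Let $X$ be a generically smooth quasi-projective scheme of dimension $d$ over a field $k$, $L$ a locally free sheaf of rank one on $X$, and $\mathcal{L}\subset H^0(X,L)$ a sub-vector space. Let $D$ be an effective divisor on $X$, $p=(p_1,\dots,p_s)$ an $s$-tuple of distinct smooth points of $X$, $\phi=(\phi_1,\dots,\phi_s)$ a formal neighborhood of $p$ compatible with $D$, $v=(v_1,\dots,v_s)$ a speed vector of positive integers, $E=(E_1,\dots,E_s)$ an $s$-tuple of finite staircases in $\mathbb{N}^d$, and $X_\phi(E,t,v)$ the associated moving subscheme (the generic member of the family obtained from the monomial subschemes with staircases $E_j$ by the translations $x_1\mapsto x_1-t^{v_j}$). Suppose that there are integers $n_1>\dots>n_r\ge 0$ such that: (1) for every $k$ with $1\le k\le r-1$, $n_k-n_{k+1}\geq \max_j(v_j)$; (2) for every $i$ with $1\le i\le r$, $\mathcal{L}(-(i-1)D-Z_i)=\mathcal{L}(-iD)$, where $t_i=\left(\left[\frac{n_i}{v_1}\right],\dots,\left[\frac{n_i}{v_s}\right]\right)$, $T_i=T(E,t_i)$ and $Z_i=X_\phi(T_i)$. Then $$\lim_{t\to 0}\mathcal{L}(-X_\phi(E,t,v))\subset \mathcal{L}\bigl(-rD-X_\phi(S(E,t_1,\dots,t_r))\bigr).$$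
   Context: **Staircases.** A staircase $E\subset\mathbb{N}^d$ is a subset whose complement $C=\mathbb{N}^d\setminus E$ satisfies $\mathbb{N}^d+C\subset C$. $I^E$ denotes the ideal (of $k[x_1,\dots,x_d]$, $k[[x_1,\dots,x_d]]$, etc.) generated by the monomials $x^e$ with $e\in C$. The height function $h_E:\mathbb{N}^{d-1}\to\mathbb{N}$ of a finite staircase $E$ is determined by $(a_1,\dots,a_d)\in E\iff a_1<h_E(a_2,\dots,a_d)$. **Slices.** For $t\in\mathbb{N}$, $T(E,t)=\{(0,a_2,\dots,a_d) : (t,a_2,\dots,a_d)\in E\}$. For $s$-tuples $E=(E_1,\dots,E_s)$ and $t=(t_1,\dots,t_s)\in\mathbb{N}^s$, $T(E,t)=(T(E_1,t_1),\dots,T(E_s,t_s))$. **Suppression of slices.** $S(E,t)$ is the staircase with height function $h_{S(E,t)}(a)=h_E(a)$ if $t\ge h_E(a)$ and $h_{S(E,t)}(a)=h_E(a)-1$ if $t<h_E(a)$. For $s$-tuples, $S(E,t)=(S(E_1,t_1),\dots,S(E_s,t_s))$; for $t_1,\dots,t_r\in\mathbb{N}^s$, recursively $S(E,t_1,\dots,t_r)=S(S(E,t_1,\dots,t_{r-1}),t_r)$. **Formal neighborhoods.** A formal neighborhood of a smooth point $p_i$ is a morphism $\phi_i:\mathrm{Spec}\,k[[x_1,\dots,x_d]]\to X$ inducing an isomorphism of $\mathrm{Spec}\,k[[x_1,\dots,x_d]]$ with $\mathrm{Spec}\,\widehat{\mathcal{O}_{X,p_i}}$; a formal neighborhood of $p=(p_1,\dots,p_s)$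 is a tuple $\phi=(\phi_1,\dots,\phi_s)$ of such. It is compatible with $D$ if $D$ is defined by $x_1=0$ around each $p_i$. **The subschemes $X_\phi(E,t,v)$ and $X_\phi(E)$.** For each $j$ let $Tr_{v_j}:k[[x_1,\dots,x_d]]\to k[[x_1,\dots,x_d]]\otimes k[[t]]$ be given by $x_1\mapsto x_1\otimes1-1\otimes t^{v_j}$, $x_i\mapsto x_i\otimes 1$ for $i>1$. The ideal generated by $Tr_{v_j}(I^{E_j})$ defines, via $\phi_j$, a family $F_j\subset X\times\mathrm{Spec}\,k[[t]]$ flat over $\mathrm{Spec}\,k[[t]]$; $F=F_1\cup\dots\cup F_s$ is flat and gives a morphism $\mathrm{Spec}\,k[[t]]\to \mathrm{Hilb}(X)$. $X_\phi(E,t,v)$ is the (non closed) point of $\mathrm{Hilb}(X)$, or the corresponding subscheme, that is the image of the generic point; $X_\phi(E)$ is the image of the special point, i.e. the union of the monomial subschemes with ideals $I^{E_j}$ at $p_j$ in the coordinates $\phi_j$. **Linear systems.** For a $0$-dimensional subscheme $Z\subset X$ (possibly defined over an extension field $K$ of $k$), $\mathcal{L}(-Z)$ is the space of sections in $\mathcal{L}$ (resp. $\mathcal{L}\otimes K$) vanishing on $Z$. For $i\geq 0$, $\mathcal{L}(-iD)$ is the space of sections of $\mathcal{L}$ vanishing $i$ times on $D$ (i.e. lying in $H^0(X,L(-iD))$), and $\mathcal{L}(-iD-Z)$ is the space of those sections of $\mathcal L$ lying in $H^0(X,L(-iD))$ which, regarded as sections of $L(-iD)$, vanish on $Z$. **Limit.**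 $\mathcal{L}(-X_\phi(E,t,v))$ corresponds to a morphism $\mathrm{Spec}\,k((t))\to\mathbb{G}$ to a Grassmannian of finite-codimensional subspaces of $\mathcal{L}$; it extends uniquely to $\mathrm{Spec}\,k[[t]]\to\mathbb{G}$, and $\lim_{t\to0}\mathcal{L}(-X_\phi(E,t,v))$ is the subspace of $\mathcal{L}$ given by the image of the closed point. $[x]$ denotes the integer part of a real $x$. *)

theory Defs
  imports
    "HOL-Analysis.Function_Topology"
    "HOL-Computational_Algebra.Formal_Laurent_Series"
    "HOL-Combinatorics.Permutations"
    "HOL-Algebra.QuotRing"
    "HOL-Algebra.Ideal_Product"
    "HOL-Algebra.Module"
begin

section \<open>Polynomials and power series in several variables\<close>

text \<open>The variables are indexed by a finite set \<open>V\<close> of natural numbers. An exponent is a function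
  vanishing outside \<open>V\<close>, so \<open>\<nat>^d\<close> is \<open>expo {1..d}\<close> with first coordinate at index 1.\<close>

definition expo :: "nat set \<Rightarrow> (nat \<Rightarrow> nat) set" where
  "expo V = {a. \<forall>i. i \<notin> V \<longrightarrow> a i = 0}"

type_synonym 'k series = "(nat \<Rightarrow> nat) \<Rightarrow> 'k"

definition pser :: "nat set \<Rightarrow> 'k::field series ring" where
  "pser V =
    \<lparr>carrier = {f. \<forall>a. f a \<noteq> 0 \<longrightarrow> a \<in> expo V},
     mult = (\<lambda>f g c. \<Sum>a\<in>{a. \<forall>i. a i \<le> c i}. f a * g (\<lambda>i. c i - a i)),
     one = (\<lambda>a. if a = (\<lambda>_. 0) then 1 else 0),
     zero = (\<lambda>_. 0),
     add = (\<lambda>f g a. f a + g a)\<rparr>"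

definition poly_ring :: "nat set \<Rightarrow> 'k::field series ring" where
  "poly_ring V = (pser V)\<lparr>carrier := {f \<in> carrier (pser V). finite {a. f a \<noteq> 0}}\<rparr>"

definition cst :: "'k::field \<Rightarrow> 'k series" where
  "cst c = (\<lambda>a. if a = (\<lambda>_. 0) then c else 0)"

definition xmon :: "(nat \<Rightarrow> nat) \<Rightarrow> 'k::field series" where
  "xmon e = (\<lambda>a. if a = e then 1 else 0)"

definition xvar :: "nat \<Rightarrow> 'k::field series" where
  "xvar i = xmon (\<lambda>l. if l = i then 1 else 0)"

definition homog :: "nat set \<Rightarrow> nat \<Rightarrow> 'k::field series set" where
  "homog V m = {f \<in> carrier (poly_ring V). \<forall>a. f a \<noteq> 0 \<longrightarrow> sum a V = m}"

definition pdiff :: "nat \<Rightarrow> 'k::field series \<Rightarrow> 'k series" where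
  "pdiff i f = (\<lambda>a. of_nat (a i + 1) * f (a(i := a i + 1)))"

text \<open>The value at the point \<open>y\<close> of a polynomial, in a ring \<open>R\<close> that is a \<open>k\<close>-algebra through
  \<open>\<kappa>\<close>.\<close>

definition peval ::
  "('a, 'm) ring_scheme \<Rightarrow> ('k::field \<Rightarrow> 'a) \<Rightarrow> nat set \<Rightarrow> (nat \<Rightarrow> 'a) \<Rightarrow> 'k series \<Rightarrow> 'a" where
  "peval R \<kappa> V y f =
    finsum R (\<lambda>a. \<kappa> (f a) \<otimes>\<^bsub>R\<^esub> finprod R (\<lambda>i. y i [^]\<^bsub>R\<^esub> a i) V) {a. f a \<noteq> 0}"

section \<open>Ringed spaces over a field\<close>

text \<open>A sheaf of sets on \<open>T\<close>: sections \<open>S U\<close> and restriction maps \<open>\<rho> U V\<close> for \<open>V \<subseteq> U\<close>.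
  Nothing is required of these functions on sets that are not open.\<close>

definition is_sheaf :: "'p topology \<Rightarrow> ('p set \<Rightarrow> 'c set) \<Rightarrow> ('p set \<Rightarrow> 'p set \<Rightarrow> 'c \<Rightarrow> 'c) \<Rightarrow> bool" where
  "is_sheaf T S \<rho> \<longleftrightarrow>
    (\<forall>U V. openin T U \<and> openin T V \<and> V \<subseteq> U \<longrightarrow> \<rho> U V ` S U \<subseteq> S V) \<and>
    (\<forall>U. openin T U \<longrightarrow> (\<forall>f\<in>S U. \<rho> U U f = f)) \<and>
    (\<forall>U V W. openin T U \<and> openin T V \<and> openin T W \<and> W \<subseteq> V \<and> V \<subseteq> U \<longrightarrow>
      (\<forall>f\<in>S U. \<rho> V W (\<rho> U V f) = \<rho> U W f)) \<and>
    (\<forall>C. (\<forall>V\<in>C. openin T V) \<longrightarrow>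
      (\<forall>f\<in>S (\<Union>C). \<forall>g\<in>S (\<Union>C). (\<forall>V\<in>C. \<rho> (\<Union>C) V f = \<rho> (\<Union>C) V g) \<longrightarrow> f = g)) \<and>
    (\<forall>C s. (\<forall>V\<in>C. openin T V \<and> s V \<in> S V) \<and>
      (\<forall>V\<in>C. \<forall>W\<in>C. \<rho> V (V \<inter> W) (s V) = \<rho> W (V \<inter> W) (s W)) \<longrightarrow>
      (\<exists>f\<in>S (\<Union>C). \<forall>V\<in>C. \<rho> (\<Union>C) V f = s V))"

text \<open>The field \<open>kstr\<close> is the ring homomorphism from \<open>k\<close> to the global functions, i.e. the
  structure morphism to \<open>Spec k\<close>.\<close>

record ('k, 'p, 'f) kspace =
  topo :: "'p topology"
  sheaf :: "'p set \<Rightarrow> 'f ring"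
  res :: "'p set \<Rightarrow> 'p set \<Rightarrow> 'f \<Rightarrow> 'f"
  kstr :: "'k \<Rightarrow> 'f"

abbreviation pts :: "('k, 'p, 'f) kspace \<Rightarrow> 'p set" where
  "pts X \<equiv> topspace (topo X)"

definition ringed_kspace :: "('k::field, 'p, 'f) kspace \<Rightarrow> bool" where
  "ringed_kspace X \<longleftrightarrow>
    (\<forall>U. openin (topo X) U \<longrightarrow> cring (sheaf X U)) \<and>
    (\<forall>U V. openin (topo X) U \<and> openin (topo X) V \<and> V \<subseteq> U \<longrightarrow>
      res X U V \<in> ring_hom (sheaf X U) (sheaf X V)) \<and>
    is_sheaf (topo X) (\<lambda>U. carrier (sheaf X U)) (res X) \<and>
    (\<forall>a. kstr X a \<in> carrier (sheaf X (pts X))) \<and>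
    kstr X 1 = \<one>\<^bsub>sheaf X (pts X)\<^esub> \<and>
    (\<forall>a b. kstr X (a + b) = kstr X a \<oplus>\<^bsub>sheaf X (pts X)\<^esub> kstr X b) \<and>
    (\<forall>a b. kstr X (a * b) = kstr X a \<otimes>\<^bsub>sheaf X (pts X)\<^esub> kstr X b)"

definition open_subspace :: "('k, 'p, 'f) kspace \<Rightarrow> 'p set \<Rightarrow> ('k, 'p, 'f) kspace" where
  "open_subspace X U =
    X\<lparr>topo := subtopology (topo X) U, kstr := (\<lambda>c. res X (pts X) U (kstr X c))\<rparr>"

definition germ :: "('k, 'p, 'f) kspace \<Rightarrow> 'p \<Rightarrow> 'p set \<Rightarrow> 'f \<Rightarrow> ('p set \<times> 'f) set" where
  "germ X x U f =
    {(V, g). openin (topo X) V \<and> x \<in> V \<and> g \<in> carrier (sheaf X V) \<and>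
      (\<exists>W. openin (topo X) W \<and> x \<in> W \<and> W \<subseteq> U \<inter> V \<and> res X U W f = res X V W g)}"

definition stalk :: "('k, 'p, 'f) kspace \<Rightarrow> 'p \<Rightarrow> ('p set \<times> 'f) set ring" where
  "stalk X x =
    \<lparr>carrier = {germ X x U f |U f. openin (topo X) U \<and> x \<in> U \<and> f \<in> carrier (sheaf X U)},
     mult = (\<lambda>A B. \<Union>(U, f)\<in>A. \<Union>(V, g)\<in>B.
       germ X x (U \<inter> V) (res X U (U \<inter> V) f \<otimes>\<^bsub>sheaf X (U \<inter> V)\<^esub> res X V (U \<inter> V) g)),
     one = germ X x (pts X) \<one>\<^bsub>sheaf X (pts X)\<^esub>,
     zero = germ X x (pts X) \<zero>\<^bsub>sheaf X (pts X)\<^esub>,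
     add = (\<lambda>A B. \<Union>(U, f)\<in>A. \<Union>(V, g)\<in>B.
       germ X x (U \<inter> V) (res X U (U \<inter> V) f \<oplus>\<^bsub>sheaf X (U \<inter> V)\<^esub> res X V (U \<inter> V) g))\<rparr>"

definition local_ring :: "('a, 'm) ring_scheme \<Rightarrow> bool" where
  "local_ring R \<longleftrightarrow> cring R \<and> (\<exists>!M. maximalideal M R)"

text \<open>A morphism \<open>X \<rightarrow> Y\<close> is a pair of a map on points and, for each open \<open>V\<close> of \<open>Y\<close>, a map
  from the functions on \<open>V\<close> to those on its preimage.\<close>

type_synonym ('p, 'f, 'q, 'g) smap = "('p \<Rightarrow> 'q) \<times> ('q set \<Rightarrow> 'g \<Rightarrow> 'f)"

definition preim :: "('k, 'p, 'f) kspace \<Rightarrow> ('p, 'f, 'q, 'g) smap \<Rightarrow> 'q set \<Rightarrow> 'p set" where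
  "preim X h V = {x \<in> pts X. fst h x \<in> V}"

definition ringed_morphism ::
  "('k, 'p, 'f) kspace \<Rightarrow> ('k, 'q, 'g) kspace \<Rightarrow> ('p, 'f, 'q, 'g) smap \<Rightarrow> bool" where
  "ringed_morphism X Y h \<longleftrightarrow>
    continuous_map (topo X) (topo Y) (fst h) \<and>
    (\<forall>V. openin (topo Y) V \<longrightarrow> snd h V \<in> ring_hom (sheaf Y V) (sheaf X (preim X h V))) \<and>
    (\<forall>V W. openin (topo Y) V \<and> openin (topo Y) W \<and> W \<subseteq> V \<longrightarrow>
      (\<forall>g\<in>carrier (sheaf Y V).
        snd h W (res Y V W g) = res X (preim X h V) (preim X h W) (snd h V g))) \<and>
    (\<forall>c. snd h (pts Y) (kstr Y c) = kstr X c)"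

definition morphism ::
  "('k, 'p, 'f) kspace \<Rightarrow> ('k, 'q, 'g) kspace \<Rightarrow> ('p, 'f, 'q, 'g) smap \<Rightarrow> bool" where
  "morphism X Y h \<longleftrightarrow>
    ringed_morphism X Y h \<and>
    (\<forall>x\<in>pts X. \<forall>V. openin (topo Y) V \<and> fst h x \<in> V \<longrightarrow>
      (\<forall>g\<in>carrier (sheaf Y V).
        germ X x (preim X h V) (snd h V g) \<in> Units (stalk X x) \<longrightarrow>
        germ Y (fst h x) V g \<in> Units (stalk Y (fst h x))))"

definition isomorphism ::
  "('k, 'p, 'f) kspace \<Rightarrow> ('k, 'q, 'g) kspace \<Rightarrow> ('p, 'f, 'q, 'g) smap \<Rightarrow> bool" where
  "isomorphism X Y h \<longleftrightarrow>
    ringed_morphism X Y h \<and>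
    homeomorphic_map (topo X) (topo Y) (fst h) \<and>
    (\<forall>V. openin (topo Y) V \<longrightarrow>
      bij_betw (snd h V) (carrier (sheaf Y V)) (carrier (sheaf X (preim X h V))))"

section \<open>Spec and Proj\<close>

text \<open>\<open>N\<close> is the set of pairs (numerator, denominator) that are allowed: all pairs for Spec,
  pairs of homogeneous elements of the same degree for Proj. \<open>frac R N P a s\<close> is the class of
  \<open>a/s\<close> in the localization at the prime \<open>P\<close> (in its degree 0 part for Proj).\<close>

definition frac :: "('a, 'm) ring_scheme \<Rightarrow> ('a \<times> 'a) set \<Rightarrow> 'a set \<Rightarrow> 'a \<Rightarrow> 'a \<Rightarrow> ('a \<times> 'a) set" where
  "frac R N P a s =
    {(b, t). (b, t) \<in> N \<and> t \<notin> P \<and>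
      (\<exists>u\<in>carrier R - P. u \<otimes>\<^bsub>R\<^esub> (a \<otimes>\<^bsub>R\<^esub> t \<ominus>\<^bsub>R\<^esub> b \<otimes>\<^bsub>R\<^esub> s) = \<zero>\<^bsub>R\<^esub>)}"

definition frac_space ::
  "('a, 'm) ring_scheme \<Rightarrow> ('k \<Rightarrow> 'a) \<Rightarrow> ('a \<times> 'a) set \<Rightarrow> 'a set topology \<Rightarrow>
    ('k, 'a set, 'a set \<Rightarrow> ('a \<times> 'a) set) kspace" where
  "frac_space R \<kappa> N T =
    \<lparr>topo = T,
     sheaf = (\<lambda>U.
      \<lparr>carrier = {\<sigma> \<in> extensional U. \<forall>P\<in>U. \<exists>V a f. openin T V \<and> P \<in> V \<and> V \<subseteq> U \<and> (a, f) \<in> N \<and>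
          (\<forall>Q\<in>V. f \<notin> Q \<and> \<sigma> Q = frac R N Q a f)},
       mult = (\<lambda>\<sigma> \<tau>. \<lambda>P\<in>U. \<Union>(a, f)\<in>\<sigma> P. \<Union>(b, g)\<in>\<tau> P.
          frac R N P (a \<otimes>\<^bsub>R\<^esub> b) (f \<otimes>\<^bsub>R\<^esub> g)),
       one = (\<lambda>P\<in>U. frac R N P \<one>\<^bsub>R\<^esub> \<one>\<^bsub>R\<^esub>),
       zero = (\<lambda>P\<in>U. frac R N P \<zero>\<^bsub>R\<^esub> \<one>\<^bsub>R\<^esub>),
       add = (\<lambda>\<sigma> \<tau>. \<lambda>P\<in>U. \<Union>(a, f)\<in>\<sigma> P. \<Union>(b, g)\<in>\<tau> P.
          frac R N P (a \<otimes>\<^bsub>R\<^esub> g \<oplus>\<^bsub>R\<^esub> b \<otimes>\<^bsub>R\<^esub> f) (f \<otimes>\<^bsub>R\<^esub> g))\<rparr>),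
     res = (\<lambda>U V \<sigma>. restrict \<sigma> V),
     kstr = (\<lambda>c. \<lambda>P\<in>topspace T. frac R N P (\<kappa> c) \<one>\<^bsub>R\<^esub>)\<rparr>"

definition Spec :: "('a, 'm) ring_scheme \<Rightarrow> ('k \<Rightarrow> 'a) \<Rightarrow> ('k, 'a set, 'a set \<Rightarrow> ('a \<times> 'a) set) kspace" where
  "Spec R \<kappa> =
    frac_space R \<kappa> (carrier R \<times> carrier R)
      (topology_generated_by ((\<lambda>f. {P. primeideal P R \<and> f \<notin> P}) ` carrier R))"

text \<open>The global function on \<open>Spec R\<close> defined by an element of \<open>R\<close>.\<close>

definition spec_function :: "('a, 'm) ring_scheme \<Rightarrow> 'a \<Rightarrow> 'a set \<Rightarrow> ('a \<times> 'a) set" where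
  "spec_function R a =
    (\<lambda>P\<in>{P. primeideal P R}. frac R (carrier R \<times> carrier R) P a \<one>\<^bsub>R\<^esub>)"

definition homog_ideal :: "('a, 'm) ring_scheme \<Rightarrow> (nat \<Rightarrow> 'a set) \<Rightarrow> 'a set \<Rightarrow> bool" where
  "homog_ideal R gr I \<longleftrightarrow> ideal I R \<and> I = genideal R (I \<inter> (\<Union>m. gr m))"

definition Proj ::
  "('a, 'm) ring_scheme \<Rightarrow> ('k \<Rightarrow> 'a) \<Rightarrow> (nat \<Rightarrow> 'a set) \<Rightarrow>
    ('k, 'a set, 'a set \<Rightarrow> ('a \<times> 'a) set) kspace" where
  "Proj R \<kappa> gr =
    frac_space R \<kappa> (\<Union>m. gr m \<times> gr m)
      (topology_generated_by
        ((\<lambda>f. {P. primeideal P R \<and> homog_ideal R gr P \<and> f \<notin> P}) ` (\<Union>m\<in>{1..}. gr m)))"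

text \<open>The closed subscheme of projective \<open>n\<close>-space defined by the homogeneous ideal \<open>I\<close>, as
  \<open>Proj (k[x_0, ..., x_n] / I)\<close>.\<close>

definition projective_subscheme ::
  "nat \<Rightarrow> 'k::field series set \<Rightarrow>
    ('k, 'k series set set, 'k series set set \<Rightarrow> ('k series set \<times> 'k series set) set) kspace" where
  "projective_subscheme n I =
    Proj (poly_ring {0..n} Quot I)
      (\<lambda>c. I +>\<^bsub>poly_ring {0..n}\<^esub> cst c)
      (\<lambda>m. (\<lambda>f. I +>\<^bsub>poly_ring {0..n}\<^esub> f) ` homog {0..n} m)"

section \<open>Schemes over a field\<close>

text \<open>If \<open>U\<close> is isomorphic to the spectrum of any ring, that ring is isomorphic to the ring of
  functions on \<open>U\<close>.\<close>

definition affine_open :: "('k::field, 'p, 'f) kspace \<Rightarrow> 'p set \<Rightarrow> bool" where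
  "affine_open X U \<longleftrightarrow>
    openin (topo X) U \<and>
    (\<exists>h. isomorphism (open_subspace X U) (Spec (sheaf X U) (kstr (open_subspace X U))) h)"

definition scheme :: "('k::field, 'p, 'f) kspace \<Rightarrow> bool" where
  "scheme X \<longleftrightarrow>
    ringed_kspace X \<and> (\<forall>x\<in>pts X. local_ring (stalk X x)) \<and> (\<forall>x\<in>pts X. \<exists>U. affine_open X U \<and> x \<in> U)"

definition quasi_projective :: "('k::field, 'p, 'f) kspace \<Rightarrow> bool" where
  "quasi_projective X \<longleftrightarrow>
    (\<exists>n I W h. homog_ideal (poly_ring {0..n}) (homog {0..n}) I \<and>
      openin (topo (projective_subscheme n I)) W \<and>
      isomorphism X (open_subspace (projective_subscheme n I) W) h)"

definition irreducible_closed :: "'p topology \<Rightarrow> 'p set \<Rightarrow> bool" where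
  "irreducible_closed T Z \<longleftrightarrow>
    closedin T Z \<and> Z \<noteq> {} \<and>
    (\<forall>A B. closedin T A \<and> closedin T B \<and> Z \<subseteq> A \<union> B \<longrightarrow> Z \<subseteq> A \<or> Z \<subseteq> B)"

definition irreducible_chain :: "'p topology \<Rightarrow> nat \<Rightarrow> (nat \<Rightarrow> 'p set) \<Rightarrow> bool" where
  "irreducible_chain T m Z \<longleftrightarrow>
    (\<forall>i\<le>m. irreducible_closed T (Z i)) \<and> (\<forall>i<m. Z i \<subset> Z (Suc i))"

definition has_dimension :: "('k, 'p, 'f) kspace \<Rightarrow> nat \<Rightarrow> bool" where
  "has_dimension X d \<longleftrightarrow>
    (\<exists>Z. irreducible_chain (topo X) d Z) \<and> \<not> (\<exists>Z. irreducible_chain (topo X) (Suc d) Z)"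

definition ring_det :: "('a, 'm) ring_scheme \<Rightarrow> nat \<Rightarrow> (nat \<Rightarrow> nat \<Rightarrow> 'a) \<Rightarrow> 'a" where
  "ring_det R c A =
    finsum R (\<lambda>\<pi>. if evenperm \<pi> then finprod R (\<lambda>i. A i (\<pi> i)) {1..c}
                  else \<ominus>\<^bsub>R\<^esub> finprod R (\<lambda>i. A i (\<pi> i)) {1..c}) {\<pi>. \<pi> permutes {1..c}}"

text \<open>\<open>R\<close> is standard smooth over \<open>k\<close>: \<open>R = k[x_1, ..., x_m] / (F_1, ..., F_c)\<close>, and the
  minor of the Jacobian matrix on the first \<open>c\<close> variables is invertible in \<open>R\<close>.\<close>

definition standard_smooth :: "('a, 'm) ring_scheme \<Rightarrow> ('k::field \<Rightarrow> 'a) \<Rightarrow> bool" where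
  "standard_smooth R \<kappa> \<longleftrightarrow>
    (\<exists>m c y F. c \<le> m \<and> (\<forall>i\<in>{1..m}. y i \<in> carrier R) \<and>
      (\<forall>i\<in>{1..c}. F i \<in> carrier (poly_ring {1..m})) \<and>
      peval R \<kappa> {1..m} y ` carrier (poly_ring {1..m}) = carrier R \<and>
      {f \<in> carrier (poly_ring {1..m}). peval R \<kappa> {1..m} y f = \<zero>\<^bsub>R\<^esub>} =
        genideal (poly_ring {1..m}) (F ` {1..c}) \<and>
      ring_det R c (\<lambda>i l. peval R \<kappa> {1..m} y (pdiff l (F i))) \<in> Units R)"

definition smooth_point :: "('k::field, 'p, 'f) kspace \<Rightarrow> 'p \<Rightarrow> bool" where
  "smooth_point X x \<longleftrightarrow>
    (\<exists>U. affine_open X U \<and> x \<in> U \<and> standard_smooth (sheaf X U) (kstr (open_subspace X U)))"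

definition generically_smooth :: "('k::field, 'p, 'f) kspace \<Rightarrow> bool" where
  "generically_smooth X \<longleftrightarrow>
    (\<exists>U. openin (topo X) U \<and> (topo X) closure_of U = pts X \<and> (\<forall>x\<in>U. smooth_point X x))"

section \<open>Invertible sheaves, divisors, linear systems\<close>

record ('p, 'f, 'l) msheaf =
  msec :: "'p set \<Rightarrow> ('f, 'l) module"
  mres :: "'p set \<Rightarrow> 'p set \<Rightarrow> 'l \<Rightarrow> 'l"

definition module_sheaf :: "('k, 'p, 'f) kspace \<Rightarrow> ('p, 'f, 'l) msheaf \<Rightarrow> bool" where
  "module_sheaf X L \<longleftrightarrow>
    (\<forall>U. openin (topo X) U \<longrightarrow> module (sheaf X U) (msec L U)) \<and>
    is_sheaf (topo X) (\<lambda>U. carrier (msec L U)) (mres L) \<and>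
    (\<forall>U V. openin (topo X) U \<and> openin (topo X) V \<and> V \<subseteq> U \<longrightarrow>
      (\<forall>\<sigma>\<in>carrier (msec L U). \<forall>\<tau>\<in>carrier (msec L U).
        mres L U V (\<sigma> \<oplus>\<^bsub>msec L U\<^esub> \<tau>) = mres L U V \<sigma> \<oplus>\<^bsub>msec L V\<^esub> mres L U V \<tau>) \<and>
      (\<forall>f\<in>carrier (sheaf X U). \<forall>\<sigma>\<in>carrier (msec L U).
        mres L U V (f \<odot>\<^bsub>msec L U\<^esub> \<sigma>) = res X U V f \<odot>\<^bsub>msec L V\<^esub> mres L U V \<sigma>))"

text \<open>\<open>e\<close> trivializes \<open>L\<close> over \<open>U\<close>.\<close>

definition generator :: "('k, 'p, 'f) kspace \<Rightarrow> ('p, 'f, 'l) msheaf \<Rightarrow> 'p set \<Rightarrow> 'l \<Rightarrow> bool" where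
  "generator X L U e \<longleftrightarrow>
    openin (topo X) U \<and> e \<in> carrier (msec L U) \<and>
    (\<forall>V. openin (topo X) V \<and> V \<subseteq> U \<longrightarrow>
      bij_betw (\<lambda>f. f \<odot>\<^bsub>msec L V\<^esub> mres L U V e) (carrier (sheaf X V)) (carrier (msec L V)))"

definition invertible_sheaf :: "('k, 'p, 'f) kspace \<Rightarrow> ('p, 'f, 'l) msheaf \<Rightarrow> bool" where
  "invertible_sheaf X L \<longleftrightarrow>
    module_sheaf X L \<and> (\<forall>x\<in>pts X. \<exists>U e. x \<in> U \<and> generator X L U e)"

definition kscale :: "('k, 'p, 'f) kspace \<Rightarrow> ('p, 'f, 'l) msheaf \<Rightarrow> 'k \<Rightarrow> 'l \<Rightarrow> 'l" where
  "kscale X L c \<sigma> = kstr X c \<odot>\<^bsub>msec L (pts X)\<^esub> \<sigma>"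

definition linear_system :: "('k, 'p, 'f) kspace \<Rightarrow> ('p, 'f, 'l) msheaf \<Rightarrow> 'l set \<Rightarrow> bool" where
  "linear_system X L \<L> \<longleftrightarrow>
    \<L> \<subseteq> carrier (msec L (pts X)) \<and> \<zero>\<^bsub>msec L (pts X)\<^esub> \<in> \<L> \<and>
    (\<forall>\<sigma>\<in>\<L>. \<forall>\<tau>\<in>\<L>. \<sigma> \<oplus>\<^bsub>msec L (pts X)\<^esub> \<tau> \<in> \<L>) \<and>
    (\<forall>c. \<forall>\<sigma>\<in>\<L>. kscale X L c \<sigma> \<in> \<L>)"

text \<open>Closed subschemes, in particular effective (Cartier) divisors, are given by their sheaves of
  ideals.\<close>

definition ideal_sheaf :: "('k, 'p, 'f) kspace \<Rightarrow> ('p set \<Rightarrow> 'f set) \<Rightarrow> bool" where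
  "ideal_sheaf X J \<longleftrightarrow>
    (\<forall>U. openin (topo X) U \<longrightarrow> ideal (J U) (sheaf X U)) \<and> is_sheaf (topo X) J (res X)"

definition local_equation :: "('k, 'p, 'f) kspace \<Rightarrow> ('p set \<Rightarrow> 'f set) \<Rightarrow> 'p set \<Rightarrow> 'f \<Rightarrow> bool" where
  "local_equation X D U g \<longleftrightarrow>
    openin (topo X) U \<and> g \<in> carrier (sheaf X U) \<and>
    (\<forall>V. openin (topo X) V \<and> V \<subseteq> U \<longrightarrow>
      D V = cgenideal (sheaf X V) (res X U V g) \<and>
      (\<forall>h\<in>carrier (sheaf X V).
        h \<otimes>\<^bsub>sheaf X V\<^esub> res X U V g = \<zero>\<^bsub>sheaf X V\<^esub> \<longrightarrow> h = \<zero>\<^bsub>sheaf X V\<^esub>))"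

definition effective_divisor :: "('k, 'p, 'f) kspace \<Rightarrow> ('p set \<Rightarrow> 'f set) \<Rightarrow> bool" where
  "effective_divisor X D \<longleftrightarrow>
    ideal_sheaf X D \<and> (\<forall>x\<in>pts X. \<exists>U g. x \<in> U \<and> local_equation X D U g)"

text \<open>\<open>L(-iD)\<close>, as the subsheaf of \<open>L\<close> of the sections that are locally of the form \<open>g\<^sup>i \<tau>\<close> with
  \<open>g\<close> an equation of \<open>D\<close>.\<close>

definition twist ::
  "('k, 'p, 'f) kspace \<Rightarrow> ('p, 'f, 'l) msheaf \<Rightarrow> ('p set \<Rightarrow> 'f set) \<Rightarrow> nat \<Rightarrow> ('p, 'f, 'l) msheaf" where
  "twist X L D i =
    L\<lparr>msec := (\<lambda>U. (msec L U)\<lparr>carrier :=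
      {\<sigma> \<in> carrier (msec L U). \<forall>x\<in>U. \<exists>V g. \<exists>\<tau>\<in>carrier (msec L V).
        x \<in> V \<and> V \<subseteq> U \<and> local_equation X D V g \<and>
        mres L U V \<sigma> = (g [^]\<^bsub>sheaf X V\<^esub> i) \<odot>\<^bsub>msec L V\<^esub> \<tau>}\<rparr>)\<rparr>"

definition vanishes_on ::
  "('k, 'p, 'f) kspace \<Rightarrow> ('p, 'f, 'l) msheaf \<Rightarrow> ('p set \<Rightarrow> 'f set) \<Rightarrow> 'l \<Rightarrow> bool" where
  "vanishes_on X L Z \<sigma> \<longleftrightarrow>
    \<sigma> \<in> carrier (msec L (pts X)) \<and>
    (\<forall>x\<in>pts X. \<exists>U e. \<exists>f\<in>Z U. x \<in> U \<and> generator X L U e \<and>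
      mres L (pts X) U \<sigma> = f \<odot>\<^bsub>msec L U\<^esub> e)"

text \<open>\<open>\<L>(-iD)\<close> and \<open>\<L>(-iD-Z)\<close>.\<close>

definition system_div ::
  "('k, 'p, 'f) kspace \<Rightarrow> ('p, 'f, 'l) msheaf \<Rightarrow> 'l set \<Rightarrow> ('p set \<Rightarrow> 'f set) \<Rightarrow> nat \<Rightarrow> 'l set" where
  "system_div X L \<L> D i = \<L> \<inter> carrier (msec (twist X L D i) (pts X))"

definition system_div_sub ::
  "('k, 'p, 'f) kspace \<Rightarrow> ('p, 'f, 'l) msheaf \<Rightarrow> 'l set \<Rightarrow> ('p set \<Rightarrow> 'f set) \<Rightarrow> nat \<Rightarrow>
    ('p set \<Rightarrow> 'f set) \<Rightarrow> 'l set" where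
  "system_div_sub X L \<L> D i Z =
    {\<sigma> \<in> system_div X L \<L> D i. vanishes_on X (twist X L D i) Z \<sigma>}"

section \<open>Staircases\<close>

definition staircase :: "nat \<Rightarrow> (nat \<Rightarrow> nat) set \<Rightarrow> bool" where
  "staircase d E \<longleftrightarrow>
    E \<subseteq> expo {1..d} \<and>
    (\<forall>c\<in>expo {1..d} - E. \<forall>a\<in>expo {1..d}. (\<lambda>i. a i + c i) \<in> expo {1..d} - E)"

definition mono_ideal :: "nat \<Rightarrow> (nat \<Rightarrow> nat) set \<Rightarrow> 'k::field series set" where
  "mono_ideal d E = genideal (pser {1..d}) (xmon ` (expo {1..d} - E))"

text \<open>The height function; the coordinate of \<open>a\<close> at index 1 is ignored, so that \<open>a\<close> stands for the
  point \<open>(a_2, ..., a_d)\<close>.\<close>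

definition height :: "(nat \<Rightarrow> nat) set \<Rightarrow> (nat \<Rightarrow> nat) \<Rightarrow> nat" where
  "height E a = (THE h. \<forall>m. a(1 := m) \<in> E \<longleftrightarrow> m < h)"

definition slice :: "nat \<Rightarrow> (nat \<Rightarrow> nat) set \<Rightarrow> nat \<Rightarrow> (nat \<Rightarrow> nat) set" where
  "slice d E t = {a \<in> expo {1..d}. a 1 = 0 \<and> a(1 := t) \<in> E}"

definition suppress :: "nat \<Rightarrow> (nat \<Rightarrow> nat) set \<Rightarrow> nat \<Rightarrow> (nat \<Rightarrow> nat) set" where
  "suppress d E t =
    {a \<in> expo {1..d}. a 1 < (if t \<ge> height E a then height E a else height E a - 1)}"

text \<open>\<open>S(E, t_1, ..., t_r)\<close> for tuples indexed by \<open>j\<close>.\<close>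

primrec suppress_seq ::
  "nat \<Rightarrow> (nat \<Rightarrow> (nat \<Rightarrow> nat) set) \<Rightarrow> (nat \<Rightarrow> nat \<Rightarrow> nat) \<Rightarrow> nat \<Rightarrow> nat \<Rightarrow> (nat \<Rightarrow> nat) set" where
  "suppress_seq d E t 0 = E"
| "suppress_seq d E t (Suc r) = (\<lambda>j. suppress d (suppress_seq d E t r j) (t (Suc r) j))"

section \<open>Formal neighborhoods and monomial subschemes\<close>

primrec ideal_pow :: "('a, 'm) ring_scheme \<Rightarrow> 'a set \<Rightarrow> nat \<Rightarrow> 'a set" where
  "ideal_pow R I 0 = carrier R"
| "ideal_pow R I (Suc n) = ideal_prod R (ideal_pow R I n) I"

text \<open>The inverse limit of the rings \<open>R/I\<^sup>n\<close>: the transition map sends a coset of \<open>I\<^sup>n\<^sup>+\<^sup>1\<close> to the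
  coset of \<open>I\<^sup>n\<close> that contains it.\<close>

definition completion :: "('a, 'm) ring_scheme \<Rightarrow> 'a set \<Rightarrow> (nat \<Rightarrow> 'a set) ring" where
  "completion R I =
    \<lparr>carrier = {s. \<forall>n. s n \<in> carrier (R Quot ideal_pow R I n) \<and> s (Suc n) \<subseteq> s n},
     mult = (\<lambda>s t n. s n \<otimes>\<^bsub>R Quot ideal_pow R I n\<^esub> t n),
     one = (\<lambda>n. \<one>\<^bsub>R Quot ideal_pow R I n\<^esub>),
     zero = (\<lambda>n. \<zero>\<^bsub>R Quot ideal_pow R I n\<^esub>),
     add = (\<lambda>s t n. s n \<oplus>\<^bsub>R Quot ideal_pow R I n\<^esub> t n)\<rparr>"

definition completion_map :: "('a, 'm) ring_scheme \<Rightarrow> 'a set \<Rightarrow> 'a \<Rightarrow> nat \<Rightarrow> 'a set" where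
  "completion_map R I a = (\<lambda>n. ideal_pow R I n +>\<^bsub>R\<^esub> a)"

type_synonym ('k, 'p, 'f) formal_map =
  "('k series set, 'k series set \<Rightarrow> ('k series \<times> 'k series) set, 'p, 'f) smap"

definition formal_spec ::
  "nat \<Rightarrow> ('k::field, 'k series set, 'k series set \<Rightarrow> ('k series \<times> 'k series) set) kspace" where
  "formal_spec d = Spec (pser {1..d}) cst"

text \<open>The morphism \<open>\<phi>\<close> is the composite of the isomorphism of spectra given by \<open>\<psi>\<close> and the
  canonical morphism from the spectrum of the completed local ring at \<open>x\<close> to \<open>X\<close>. The latter two
  conditions say this, since a morphism from the spectrum of a local ring is determined by the
  image \<open>x\<close> of the closed point and the map induced on germs at \<open>x\<close>.\<close>

definition formal_neighborhood ::
  "('k::field, 'p, 'f) kspace \<Rightarrow> nat \<Rightarrow> 'p \<Rightarrow> ('k, 'p, 'f) formal_map \<Rightarrow> bool" where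
  "formal_neighborhood X d x \<phi> \<longleftrightarrow>
    morphism (formal_spec d) X \<phi> \<and>
    fst \<phi> {f \<in> carrier (pser {1..d}). f (\<lambda>_. 0) = 0} = x \<and>
    (let A = stalk X x; M = (THE M. maximalideal M A) in
      \<exists>\<psi>\<in>ring_iso (completion A M) (pser {1..d}).
        \<forall>U. openin (topo X) U \<and> x \<in> U \<longrightarrow>
          (\<forall>f\<in>carrier (sheaf X U).
            snd \<phi> U f = spec_function (pser {1..d}) (\<psi> (completion_map A M (germ X x U f)))))"

text \<open>The power series expansion of a function on a neighborhood \<open>U\<close> of the point: its pull back is
  a function on the whole of \<open>Spec k[[x_1, ..., x_d]]\<close>, the only open set containing the closed
  point.\<close>

definition expansion :: "nat \<Rightarrow> ('k::field, 'p, 'f) formal_map \<Rightarrow> 'p set \<Rightarrow> 'f \<Rightarrow> 'k series" where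
  "expansion d \<phi> U f = (THE a. a \<in> carrier (pser {1..d}) \<and> snd \<phi> U f = spec_function (pser {1..d}) a)"

definition compatible ::
  "('k::field, 'p, 'f) kspace \<Rightarrow> nat \<Rightarrow> ('p set \<Rightarrow> 'f set) \<Rightarrow> 'p \<Rightarrow> ('k, 'p, 'f) formal_map \<Rightarrow> bool" where
  "compatible X d D x \<phi> \<longleftrightarrow>
    (\<exists>U g. x \<in> U \<and> local_equation X D U g \<and>
      cgenideal (pser {1..d}) (expansion d \<phi> U g) = cgenideal (pser {1..d}) (xvar 1))"

text \<open>The ideal sheaf of \<open>X_\<phi>(E)\<close>: the kernel of the map from the functions on \<open>X\<close> to the product
  of the rings \<open>k[[x_1, ..., x_d]] / I^(E_j)\<close> placed at the points \<open>p_j\<close>.\<close>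

definition monomial_subscheme ::
  "('k::field, 'p, 'f) kspace \<Rightarrow> nat \<Rightarrow> nat \<Rightarrow> (nat \<Rightarrow> 'p) \<Rightarrow> (nat \<Rightarrow> ('k, 'p, 'f) formal_map) \<Rightarrow>
    (nat \<Rightarrow> (nat \<Rightarrow> nat) set) \<Rightarrow> 'p set \<Rightarrow> 'f set" where
  "monomial_subscheme X d s p \<phi> E U =
    {f \<in> carrier (sheaf X U). \<forall>j\<in>{1..s}. p j \<in> U \<longrightarrow> expansion d (\<phi> j) U f \<in> mono_ideal d (E j)}"

section \<open>The moving subscheme\<close>

text \<open>The parameter \<open>t\<close> is the variable of index 0, so \<open>k[[x_1, ..., x_d]] \<otimes> k[[t]]\<close> (completed)
  is \<open>pser {0..d}\<close>. \<open>translate v\<close> is the substitution of \<open>x_1 - t^v\<close> for \<open>x_1\<close>; expanding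
  \<open>(x_1 - t^v)^(m+l)\<close>, the term \<open>x_1^m t^(v l)\<close> has coefficient \<open>(-1)^l ((m+l) choose l)\<close>. The
  sum has at most one term since \<open>v > 0\<close>.\<close>

definition translate :: "nat \<Rightarrow> 'k::field series \<Rightarrow> 'k series" where
  "translate v f =
    (\<lambda>b. \<Sum>l\<in>{l. v * l = b 0}. (- 1) ^ l * of_nat ((b 1 + l) choose l) * f (b(0 := 0, 1 := b 1 + l)))"

definition family_ideal :: "nat \<Rightarrow> nat \<Rightarrow> (nat \<Rightarrow> nat) set \<Rightarrow> 'k::field series set" where
  "family_ideal d v E = genideal (pser {0..d}) (translate v ` mono_ideal d E)"

text \<open>\<open>\<L> \<otimes> k((t))\<close> and \<open>\<L> \<otimes> k[[t]]\<close>, embedded in the Laurent series with coefficients in \<open>\<L>\<close>: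
  the tensor \<open>\<Sum>i. \<sigma>_i \<otimes> c_i\<close> is the series with coefficient \<open>\<Sum>i. c_i[t^n] \<sigma>_i\<close> at \<open>t^n\<close>.\<close>

definition tensor_laurent ::
  "('k::field, 'p, 'f) kspace \<Rightarrow> ('p, 'f, 'l) msheaf \<Rightarrow> 'l set \<Rightarrow> (int \<Rightarrow> 'l) set" where
  "tensor_laurent X L \<L> =
    {(\<lambda>n. finsum (msec L (pts X)) (\<lambda>i. kscale X L (fls_nth (c i) n) (\<sigma> i)) {..<m})
      |m \<sigma> (c :: nat \<Rightarrow> 'k fls). \<forall>i<m. \<sigma> i \<in> \<L>}"

definition tensor_power ::
  "('k::field, 'p, 'f) kspace \<Rightarrow> ('p, 'f, 'l) msheaf \<Rightarrow> 'l set \<Rightarrow> (int \<Rightarrow> 'l) set" where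
  "tensor_power X L \<L> =
    {(\<lambda>n. finsum (msec L (pts X)) (\<lambda>i. kscale X L (fls_nth (fps_to_fls (c i)) n) (\<sigma> i)) {..<m})
      |m \<sigma> (c :: nat \<Rightarrow> 'k fps). \<forall>i<m. \<sigma> i \<in> \<L>}"

definition lscale ::
  "('k::field, 'p, 'f) kspace \<Rightarrow> ('p, 'f, 'l) msheaf \<Rightarrow> 'k fls \<Rightarrow> (int \<Rightarrow> 'l) \<Rightarrow> int \<Rightarrow> 'l" where
  "lscale X L c F = (\<lambda>n. finsum (msec L (pts X)) (\<lambda>i. kscale X L (fls_nth c i) (F (n - i)))
    {i. fls_nth c i \<noteq> 0 \<and> F (n - i) \<noteq> \<zero>\<^bsub>msec L (pts X)\<^esub>})"

text \<open>A section \<open>G\<close> in \<open>\<L> \<otimes> k[[t]]\<close> vanishes on the family \<open>F_j\<close> if its pull back along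
  \<open>\<phi>_j \<times> id\<close> (in a trivialization of \<open>L\<close> near \<open>p_j\<close>) lies in the ideal of the family.\<close>

definition vanishes_on_family ::
  "('k::field, 'p, 'f) kspace \<Rightarrow> ('p, 'f, 'l) msheaf \<Rightarrow> nat \<Rightarrow> 'p \<Rightarrow> ('k, 'p, 'f) formal_map \<Rightarrow>
    nat \<Rightarrow> (nat \<Rightarrow> nat) set \<Rightarrow> (int \<Rightarrow> 'l) \<Rightarrow> bool" where
  "vanishes_on_family X L d x \<phi> v E G \<longleftrightarrow>
    (\<exists>U e f. x \<in> U \<and> generator X L U e \<and>
      (\<forall>n::nat. f n \<in> carrier (sheaf X U) \<and> mres L (pts X) U (G (int n)) = f n \<odot>\<^bsub>msec L U\<^esub> e) \<and>
      (\<lambda>b. expansion d \<phi> U (f (b 0)) (b(0 := 0))) \<in> family_ideal d v E)"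

text \<open>\<open>\<L>(-X_\<phi>(E,t,v))\<close>, a subspace of \<open>\<L> \<otimes> k((t))\<close>. The generic member is obtained from the
  family by inverting \<open>t\<close>, so a section vanishes on it iff a multiple by a power of \<open>t\<close> vanishes
  on the family.\<close>

definition moving_system ::
  "('k::field, 'p, 'f) kspace \<Rightarrow> ('p, 'f, 'l) msheaf \<Rightarrow> 'l set \<Rightarrow> nat \<Rightarrow> nat \<Rightarrow> (nat \<Rightarrow> 'p) \<Rightarrow>
    (nat \<Rightarrow> ('k, 'p, 'f) formal_map) \<Rightarrow> (nat \<Rightarrow> nat) \<Rightarrow> (nat \<Rightarrow> (nat \<Rightarrow> nat) set) \<Rightarrow>
    (int \<Rightarrow> 'l) set" where
  "moving_system X L \<L> d s p \<phi> v E =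
    {F \<in> tensor_laurent X L \<L>. \<exists>N. lscale X L (fls_X ^ N) F \<in> tensor_power X L \<L> \<and>
      (\<forall>j\<in>{1..s}. vanishes_on_family X L d (p j) (\<phi> j) (v j) (E j) (lscale X L (fls_X ^ N) F))}"

section \<open>Limits in the Grassmannian\<close>

text \<open>A \<open>k[[t]]\<close>-valued point of the Grassmannian of finite-codimensional subspaces of \<open>\<L>\<close>: a
  \<open>k[[t]]\<close>-submodule of \<open>\<L> \<otimes> k[[t]]\<close> whose quotient is free of finite rank \<open>c\<close> (here with basis
  the classes of \<open>B 1, ..., B c\<close>).\<close>

definition grassmann_point ::
  "('k::field, 'p, 'f) kspace \<Rightarrow> ('p, 'f, 'l) msheaf \<Rightarrow> 'l set \<Rightarrow> (int \<Rightarrow> 'l) set \<Rightarrow> bool" where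
  "grassmann_point X L \<L> M \<longleftrightarrow>
    M \<subseteq> tensor_power X L \<L> \<and>
    (\<lambda>_. \<zero>\<^bsub>msec L (pts X)\<^esub>) \<in> M \<and>
    (\<forall>F\<in>M. \<forall>G\<in>M. (\<lambda>n. F n \<oplus>\<^bsub>msec L (pts X)\<^esub> G n) \<in> M) \<and>
    (\<forall>a :: 'k fps. \<forall>F\<in>M. lscale X L (fps_to_fls a) F \<in> M) \<and>
    (\<exists>c B. (\<forall>i\<in>{1..c::nat}. B i \<in> tensor_power X L \<L>) \<and>
      (\<forall>F\<in>tensor_power X L \<L>. \<exists>!a. a \<in> extensional {1..c} \<and>
        (\<lambda>n. F n \<ominus>\<^bsub>msec L (pts X)\<^esub>
          finsum (msec L (pts X)) (\<lambda>i. lscale X L (fps_to_fls (a i)) (B i) n) {1..c}) \<in> M))"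

text \<open>The limit of a \<open>k((t))\<close>-valued point \<open>W\<close>: \<open>M\<close> is the extension to a \<open>k[[t]]\<close>-valued point,
  and the limit is its value at the closed point \<open>t = 0\<close>. As \<open>M\<close> is a \<open>k[[t]]\<close>-module, the
  multiples of its elements form the \<open>k((t))\<close>-span.\<close>

definition limit_system ::
  "('k::field, 'p, 'f) kspace \<Rightarrow> ('p, 'f, 'l) msheaf \<Rightarrow> 'l set \<Rightarrow> (int \<Rightarrow> 'l) set \<Rightarrow> 'l set" where
  "limit_system X L \<L> W =
    (\<lambda>F. F 0) ` (THE M. grassmann_point X L \<L> M \<and> W = {lscale X L c F |c F. F \<in> M})"

end

theory Submission
  imports Defs
begin

text \<open>
  Write a section of the family near \<open>p_j\<close> as a power series in \<open>x_1, \<dots>, x_d, t\<close> and let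
  \<open>F(X, T)\<close> be the coefficient of a monomial in \<open>x_2, \<dots>, x_d\<close> over which the staircase \<open>E_j\<close> has
  height \<open>h\<close>. The section vanishes on the moving subscheme iff \<open>(X - T\<^sup>v)\<^sup>h\<close> divides all these \<open>F\<close>
  (with \<open>v = v_j\<close>); these are finitely many \<open>k[[t]]\<close>-linear conditions, so that the limit consists of
  the values at \<open>t = 0\<close> of the sections over \<open>k[[t]]\<close> which satisfy them.

  Let \<open>F = (X - T\<^sup>v)\<^sup>h q\<close>. By induction on \<open>i\<close>, the coefficients of \<open>t\<^sup>m\<close> with \<open>m \<le> n_i\<close> of such a
  section lie in \<open>\<L>(-iD)\<close>, i.e. the coefficient of \<open>X\<^sup>l\<close> in \<open>F\<close> is divisible by \<open>T\<close> to the power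
  \<open>n_{l+1} + 1\<close> for \<open>l < i\<close>. As \<open>n_l - n_{l+1} \<ge> v\<close>, this makes the coefficients of \<open>X\<^sup>l\<close> in \<open>q\<close> divisible
  by \<open>T\<close> to the power \<open>n_{l+1} + 1 - v h\<close>; if \<open>h > [n_{i+1}/v]\<close>, the coefficient of \<open>X\<^sup>i\<close> in \<open>F\<close> is then
  divisible by \<open>T\<close> to the power \<open>n_{i+1} + 1\<close>, which is the vanishing on \<open>Z_{i+1}\<close> needed for the next
  step. At \<open>T = 0\<close>, where \<open>F = X\<^sup>h q\<close>, the coefficients of \<open>q\<close> in the degrees \<open>l < r\<close> with
  \<open>h \<le> [n_{l+1}/v]\<close> vanish, which accounts for the steps that do not suppress a slice.
\<close>

section \<open>The power series rings\<close>

text \<open>The limit is defined through the unique extension of a \<open>k((t))\<close>-point to a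
  \<open>k[[t]]\<close>-point of the Grassmannian, so the sections over \<open>k[[t]]\<close> must
  be recognised as such a point. For this reason divisibility by \<open>(X - T^v)^h\<close> is
  rewritten as the vanishing of \<open>h\<close> remainders: the quotient by the kernel of finitely
  many \<open>k[[t]]\<close>-linear forms embeds in a finite free module over a principal ideal
  domain, hence is free, and saturation makes the extension unique. Two obstacles shape the rest.
  Generated ideals of power series contain only finite combinations, so monomial and family ideals
  are described by coefficients after capping the exponents at a bound for the staircase. And
  vanishing on \<open>X\<close> is stated with arbitrary local generators and equations; these are
  compared with one fixed trivialization per point by multipliers that do not involve
  \<open>t\<close>. In the induction, hypothesis (2) is applied to the single coefficients of
  \<open>t^m\<close>. Only \<open>m <= n_{i+1}\<close> matters at the next step, and those
  coefficients lie in \<open>L(-iD)\<close> already because \<open>n\<close> decreases.\<close>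

definition conv :: "'k::field series \<Rightarrow> 'k series \<Rightarrow> 'k series" where
  "conv f g = (\<lambda>c. \<Sum>a\<in>{a. \<forall>i. a i \<le> c i}. f a * g (\<lambda>i. c i - a i))"

lemma pser_simps [simp]:
  "f \<otimes>\<^bsub>pser V\<^esub> g = conv f g"
  "f \<oplus>\<^bsub>pser V\<^esub> g = (\<lambda>a. f a + g a)"
  "\<zero>\<^bsub>pser V\<^esub> = (\<lambda>_. 0)"
  "\<one>\<^bsub>pser V\<^esub> = (\<lambda>a. if a = (\<lambda>_. 0) then 1 else 0)"
  by (simp_all add: pser_def conv_def)

lemma carrier_pser: "f \<in> carrier (pser V) \<longleftrightarrow> (\<forall>a. f a \<noteq> 0 \<longrightarrow> a \<in> expo V)"
  by (simp add: pser_def)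

lemma pser_zero_outside: "f \<in> carrier (pser V) \<Longrightarrow> a \<notin> expo V \<Longrightarrow> f a = 0"
  by (auto simp: carrier_pser)

lemma expo_le: "c \<in> expo V \<Longrightarrow> \<forall>i. a i \<le> c i \<Longrightarrow> a \<in> expo V"
proof -
  assume c: "c \<in> expo V" and le: "\<forall>i. a i \<le> c i"
  have "a i = 0" if "i \<notin> V" for i using c le[rule_format, of i] that by (simp add: expo_def)
  then show ?thesis by (simp add: expo_def)
qed

lemma expo_diff: "c \<in> expo V \<Longrightarrow> (\<lambda>i. c i - a i) \<in> expo V"
  by (rule expo_le[where c = c]) auto

lemma expo_add: "a \<in> expo V \<Longrightarrow> b \<in> expo V \<Longrightarrow> (\<lambda>i. a i + b i) \<in> expo V"
  by (simp add: expo_def)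

lemma expo_split:
  assumes "\<forall>i. a i \<le> c i" "a \<in> expo V" "(\<lambda>i. c i - a i) \<in> expo V"
  shows "c \<in> expo V"
proof -
  have "c = (\<lambda>i. a i + (c i - a i))" using assms(1) by auto
  then show ?thesis using expo_add[OF assms(2,3)] by simp
qed

lemma expo_parameter: "b(0 := 0) \<in> expo {1..d} \<longleftrightarrow> b \<in> expo {0..d}"
proof -
  have "(i \<notin> {1..d} \<longrightarrow> (b(0 := 0)) i = 0) \<longleftrightarrow> (i \<notin> {0..d} \<longrightarrow> b i = 0)" for i
    by (cases "i = 0") auto
  then show ?thesis unfolding expo_def mem_Collect_eq by (simp only:)
qed

text \<open>A sum over an infinite set is 0 by convention, so the Cauchy product has its intended
  meaning at \<open>c\<close> only when the box below \<open>c\<close> is finite. This is why later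
  proofs treat exponents outside \<open>expo V\<close> separately.\<close>

lemma finite_below:
  assumes "finite V" "c \<in> expo V"
  shows "finite {a. \<forall>i. a i \<le> (c i :: nat)}"
proof -
  have "{a. \<forall>i. a i \<le> c i} \<subseteq> {f. \<forall>i. (i \<in> V \<longrightarrow> f i \<in> (\<Union>i\<in>V. {..c i})) \<and> (i \<notin> V \<longrightarrow> f i = 0)}"
  proof (intro subsetI CollectI allI conjI impI)
    fix a i assume a: "a \<in> {a. \<forall>i. a i \<le> c i}"
    then show "a i \<in> (\<Union>i\<in>V. {..c i})" if "i \<in> V" using that by blast
    show "a i = 0" if "i \<notin> V" using expo_le[OF assms(2)] a that by (simp add: expo_def)
  qed
  moreover have "finite {f. \<forall>i. (i \<in> V \<longrightarrow> f i \<in> (\<Union>i\<in>V. {..c i})) \<and> (i \<notin> V \<longrightarrow> f i = (0::nat))}"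
    by (rule finite_set_of_finite_funs) (use assms in auto)
  ultimately show ?thesis by (rule finite_subset)
qed

section \<open>Ring laws of the convolution product\<close>

lemma conv_closed:
  assumes "f \<in> carrier (pser V)" "g \<in> carrier (pser V)"
  shows "conv f g \<in> carrier (pser V)"
  unfolding carrier_pser
proof (intro allI impI)
  fix c assume "conv f g c \<noteq> 0"
  then obtain a where "a \<in> {a. \<forall>i. a i \<le> c i}" "f a * g (\<lambda>i. c i - a i) \<noteq> 0"
    unfolding conv_def by (meson sum.not_neutral_contains_not_neutral)
  then show "c \<in> expo V"
    using assms by (auto simp: carrier_pser intro: expo_split)
qed

text \<open>The reflection of the box below \<open>c\<close> that sends \<open>a\<close> to
  \<open>c - a\<close> exchanges the factors; being a bijection, it works on infinite boxes
  too.\<close>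

lemma conv_commute: "conv f g = conv g f"
proof
  fix c
  show "conv f g c = conv g f c"
    unfolding conv_def
    by (rule sum.reindex_bij_witness[where i = "\<lambda>a i. c i - a i" and j = "\<lambda>a i. c i - a i"])
      (auto simp: mult.commute)
qed

lemma conv_xmon:
  assumes "finite V" "f \<in> carrier (pser V)" "e \<in> expo V"
  shows "conv (xmon e) f c = (if \<forall>i. e i \<le> c i then f (\<lambda>i. c i - e i) else 0)"
proof (cases "c \<in> expo V")
  case True
  have "conv (xmon e) f c = (\<Sum>a\<in>{a. \<forall>i. a i \<le> c i}. if a = e then f (\<lambda>i. c i - e i) else 0)"
    unfolding conv_def xmon_def by (intro sum.cong) auto
  then show ?thesis using finite_below[OF assms(1) True] by (simp add: sum.delta)
next
  case False
  \<comment> \<open>Outside \<open>expo V\<close> the box below \<open>c\<close> may be infinite, so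
    the value is obtained from closure of the ring instead of from the sum.\<close>
  have "xmon e \<in> carrier (pser V)" using assms(3) by (auto simp: carrier_pser xmon_def)
  then have "conv (xmon e) f c = 0"
    using conv_closed[OF _ assms(2)] False by (auto simp: carrier_pser)
  then show ?thesis using False assms(2,3) by (auto simp: carrier_pser intro: expo_split)
qed

lemma one_xmon: "(\<lambda>a. if a = (\<lambda>_. 0) then 1 else 0) = xmon (\<lambda>_. 0)"
  by (simp add: xmon_def)

lemma conv_one:
  assumes "finite V" "f \<in> carrier (pser V)"
  shows "conv (xmon (\<lambda>_. 0)) f = f"
  using conv_xmon[OF assms, of "\<lambda>_. 0"] by (auto simp: expo_def)

lemma conv_assoc:
  assumes V: "finite V"
    and f: "f \<in> carrier (pser V)" and g: "g \<in> carrier (pser V)" and h: "h \<in> carrier (pser V)"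
  shows "conv (conv f g) h = conv f (conv g h)"
proof
  fix c
  show "conv (conv f g) h c = conv f (conv g h) c"
  proof (cases "c \<in> expo V")
    case False
    have "conv (conv f g) h \<in> carrier (pser V)" "conv f (conv g h) \<in> carrier (pser V)"
      using assms by (auto intro!: conv_closed)
    then show ?thesis using False by (simp add: pser_zero_outside)
  next
    case True
    have fin: "finite {a. \<forall>i. a i \<le> c i}" by (rule finite_below[OF V True])
    have fin': "finite {b. \<forall>i. b i \<le> a i}" if "\<forall>i. a i \<le> c i" for a
      by (rule finite_below[OF V expo_le[OF True that]])
    have fin'': "finite {b. \<forall>i. b i \<le> c i - a i}" for a
      by (rule finite_subset[OF _ fin]) (auto intro: order_trans)
    have "conv (conv f g) h c = (\<Sum>(a, b)\<in>(SIGMA a:{a. \<forall>i. a i \<le> c i}. {b. \<forall>i. b i \<le> a i}).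
        f b * g (\<lambda>i. a i - b i) * h (\<lambda>i. c i - a i))"
      unfolding conv_def by (subst sum.Sigma[symmetric]) (use fin fin' in \<open>auto simp: sum_distrib_right\<close>)
    also have "\<dots> = (\<Sum>(a, b)\<in>(SIGMA a:{a. \<forall>i. a i \<le> c i}. {b. \<forall>i. b i \<le> c i - a i}).
        f a * (g b * h (\<lambda>i. c i - a i - b i)))"
    \<comment> \<open>Both sides run over the ways to write \<open>c\<close> as a sum of three
      exponents: a pair \<open>(a, b)\<close> on the left stands for
      \<open>(b, a - b, c - a)\<close>, on the right for \<open>(a, b, c - a - b)\<close>.\<close>
    proof (rule sum.reindex_bij_witness[where i = "\<lambda>(a, b). (\<lambda>i. a i + b i, a)"
          and j = "\<lambda>(a, b). (b, \<lambda>i. a i - b i)"], goal_cases)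
      case (1 x) then show ?case by (auto simp: fun_eq_iff)
    next
      case (2 x) then show ?case by (auto intro: order_trans diff_le_mono)
    next
      case (3 x) then show ?case by (auto simp: fun_eq_iff)
    next
      case (4 x) then show ?case
        by (auto) (metis Nat.le_diff_conv2 add.commute le_diff_conv)
    next
      case (5 x) 
      have "(\<lambda>i. c i - b i - (a i - b i)) = (\<lambda>i. c i - a i)" if "\<forall>i. b i \<le> a i" for a b
        using that by auto
      then show ?case using 5 by (auto simp: mult.assoc)
    qed
    also have "\<dots> = conv f (conv g h) c"
      unfolding conv_def by (subst sum.Sigma[symmetric]) (use fin fin'' in \<open>auto simp: sum_distrib_left\<close>)
    finally show ?thesis .
  qed
qed

lemma conv_add_left: "conv (\<lambda>a. f a + g a) h = (\<lambda>a. conv f h a + conv g h a)"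
  by (simp add: conv_def fun_eq_iff distrib_right sum.distrib)

lemma pser_cring:
  assumes "finite V"
  shows "cring (pser V :: 'k::field series ring)"
proof (rule cringI)
  show "abelian_group (pser V :: 'k series ring)"
  proof (rule abelian_groupI)
    fix x :: "'k series" assume x: "x \<in> carrier (pser V)"
    show "\<exists>y\<in>carrier (pser V). y \<oplus>\<^bsub>pser V\<^esub> x = \<zero>\<^bsub>pser V\<^esub>"
      by (rule bexI[of _ "\<lambda>a. - x a"]) (use x in \<open>auto simp: carrier_pser\<close>)
  qed (auto simp: carrier_pser add.assoc add.commute, metis add.right_neutral)
  show "Group.comm_monoid (pser V :: 'k series ring)"
  proof (rule comm_monoidI)
    fix x y :: "'k series"
    assume x: "x \<in> carrier (pser V)" and "y \<in> carrier (pser V)" 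
    then show "x \<otimes>\<^bsub>pser V\<^esub> y \<in> carrier (pser V)" by (simp add: conv_closed)
    show "x \<otimes>\<^bsub>pser V\<^esub> y = y \<otimes>\<^bsub>pser V\<^esub> x" by (simp add: conv_commute)
    show "\<one>\<^bsub>pser V\<^esub> \<otimes>\<^bsub>pser V\<^esub> x = x"
      by (simp add: one_xmon conv_one[OF assms x])
  next
    show "(\<one>\<^bsub>pser V\<^esub> :: 'k series) \<in> carrier (pser V)" by (auto simp: carrier_pser expo_def)
  qed (simp add: conv_assoc[OF assms])
qed (simp add: conv_add_left)

lemma cst_closed [simp]: "cst c \<in> carrier (pser V)"
  by (auto simp: cst_def carrier_pser expo_def)

lemma conv_cst:
  assumes "finite V" "f \<in> carrier (pser V)"
  shows "conv (cst c) f = (\<lambda>a. c * f a)"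
proof
  fix a
  have "conv (cst c) f a = c * conv (xmon (\<lambda>_. 0)) f a"
    unfolding conv_def sum_distrib_left by (intro sum.cong) (auto simp: cst_def xmon_def)
  then show "conv (cst c) f a = c * f a" by (simp add: conv_one[OF assms])
qed

lemma xmon_closed: "e \<in> expo V \<Longrightarrow> xmon e \<in> carrier (pser V)"
  by (auto simp: xmon_def carrier_pser)

lemma pser_mono: "U \<subseteq> V \<Longrightarrow> f \<in> carrier (pser U) \<Longrightarrow> f \<in> carrier (pser V)"
  unfolding carrier_pser expo_def by blast

lemma xvar_conv:
  assumes "finite V" "f \<in> carrier (pser V)" "l \<in> V"
  shows "conv (xvar l) f c = (if 1 \<le> c l then f (c(l := c l - 1)) else 0)"
proof -
  have *: "(\<forall>i. (if i = l then 1 else 0) \<le> c i) \<longleftrightarrow> 1 \<le> c l" by (metis zero_le)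
  have **: "(\<lambda>i. c i - (if i = l then 1 else 0)) = c(l := c l - 1)" by auto
  have "(\<lambda>i. if i = l then 1 else 0) \<in> expo V" using assms(3) by (auto simp: expo_def)
  from conv_xmon[OF assms(1,2) this, of c] show ?thesis unfolding xvar_def * ** .
qed

lemma xvar_closed: "l \<in> V \<Longrightarrow> xvar l \<in> carrier (pser V)"
  unfolding xvar_def by (rule xmon_closed) (auto simp: expo_def)

lemma pow_xvar_conv:
  assumes "finite V" "f \<in> carrier (pser V)" "l \<in> V"
  shows "(xvar l [^]\<^bsub>pser V\<^esub> (i::nat) \<otimes>\<^bsub>pser V\<^esub> f) c = (if i \<le> c l then f (c(l := c l - i)) else 0)"
  using assms(2)
proof (induction i arbitrary: f c)
  case 0
  interpret cring "pser V :: 'a series ring" by (rule pser_cring[OF assms(1)])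
  show ?case using 0 by (simp add: one_xmon conv_one[OF assms(1)])
next
  case (Suc i)
  interpret cring "pser V :: 'a series ring" by (rule pser_cring[OF assms(1)])
  have x: "(xvar l :: 'a series) \<in> carrier (pser V)" by (rule xvar_closed[OF assms(3)])
  have "xvar l [^]\<^bsub>pser V\<^esub> Suc i \<otimes>\<^bsub>pser V\<^esub> f = xvar l [^]\<^bsub>pser V\<^esub> i \<otimes>\<^bsub>pser V\<^esub> conv (xvar l) f"
    using x Suc.prems m_assoc[of "xvar l [^]\<^bsub>pser V\<^esub> i" "xvar l" f] by simp
  then have "(xvar l [^]\<^bsub>pser V\<^esub> Suc i \<otimes>\<^bsub>pser V\<^esub> f) c = 
      (if i \<le> c l then conv (xvar l) f (c(l := c l - i)) else 0)"
    using Suc.IH[OF conv_closed[OF x Suc.prems]] by simp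
  then show ?case using xvar_conv[OF assms(1) Suc.prems assms(3), of "c(l := c l - i)"]
    by (cases "Suc i \<le> c l") (auto simp: fun_upd_def intro!: arg_cong[where f = f])
qed

section \<open>Vanishing on down-closed sets of exponents; monomial ideals\<close>

definition vanish :: "(nat \<Rightarrow> nat) set \<Rightarrow> 'k::field series \<Rightarrow> bool" where
  "vanish S f \<longleftrightarrow> (\<forall>e\<in>S. f e = 0)"

definition down_closed :: "(nat \<Rightarrow> nat) set \<Rightarrow> bool" where
  "down_closed S \<longleftrightarrow> (\<forall>e\<in>S. \<forall>a. (\<forall>i. a i \<le> e i) \<longrightarrow> a \<in> S)"

text \<open>The coefficient at \<open>e\<close> involves only coefficients of \<open>f\<close> below
  \<open>e\<close>, and these stay in a down-closed set. Vanishing on a staircase is thus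
  insensitive to multipliers such as changes of trivialization.\<close>

lemma vanish_conv: "down_closed S \<Longrightarrow> vanish S f \<Longrightarrow> vanish S (conv u f)"
proof -
  assume S: "down_closed S" and f: "vanish S f"
  have "f (\<lambda>i. e i - a i) = 0" if "e \<in> S" for e a
    using S f that by (auto simp: vanish_def down_closed_def)
  then show ?thesis by (simp add: vanish_def conv_def)
qed

text \<open>If some \<open>a\<close> below \<open>e\<close> were outside \<open>E\<close>, then
  \<open>e = (e - a) + a\<close> would be outside too.\<close>

lemma staircase_down_closed:
  assumes "staircase d E" shows "down_closed E"
  unfolding down_closed_def
proof (intro ballI allI impI)
  fix e a assume e: "e \<in> E" and le: "\<forall>i. a i \<le> e i"
  have ex: "e \<in> expo {1..d}" using assms e by (auto simp: staircase_def)
  have "(\<lambda>i. (e i - a i) + a i) = e" using le by auto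
  show "a \<in> E"
  proof (rule ccontr)
    assume "a \<notin> E"
    then have "(\<lambda>i. (e i - a i) + a i) \<in> expo {1..d} - E"
      using assms expo_le[OF ex le] expo_diff[OF ex, of a] unfolding staircase_def by auto
    then show False using e \<open>(\<lambda>i. (e i - a i) + a i) = e\<close> by simp
  qed
qed

text \<open>Sorting the monomials of \<open>f\<close> by the value of \<open>\<pi>\<close> writes \<open>f\<close> as a finite combination of the
  monomials \<open>x\<^sup>b\<close>, \<open>b \<in> B\<close>.\<close>

lemma in_ideal_by_parts:
  fixes f :: "'k::field series"
  assumes V: "finite V" and f: "f \<in> carrier (pser V)" and I: "ideal I (pser V)"
    and B: "finite B" "B \<subseteq> expo V"
    and \<pi>: "\<And>e. e \<in> expo V \<Longrightarrow> \<pi> e \<in> B \<and> (\<forall>i. \<pi> e i \<le> e i)"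
    and parts: "\<And>b. b \<in> B \<Longrightarrow>
      conv (xmon b) (\<lambda>a. if \<pi> (\<lambda>i. a i + b i) = b then f (\<lambda>i. a i + b i) else 0) \<in> I"
  shows "f \<in> I"
proof -
  let ?g = "\<lambda>b a. if \<pi> (\<lambda>i. a i + b i) = b then f (\<lambda>i. a i + b i) else 0"
  interpret I: ideal I "pser V" by (rule I)
  have g: "?g b \<in> carrier (pser V)" if "b \<in> B" for b
    using f unfolding carrier_pser by (auto intro: expo_le split: if_splits)
  have sums: "(\<lambda>c. \<Sum>b\<in>B'. conv (xmon b) (?g b) c) \<in> I" if "B' \<subseteq> B" for B'
    using finite_subset[OF that B(1)] that
  proof (induction B' rule: finite_induct)
    case empty
    then show ?case using additive_subgroup.zero_closed[OF I.is_additive_subgroup] by simp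
  next
    case (insert b B')
    then show ?case using additive_subgroup.a_closed[OF I.is_additive_subgroup parts[of b], of "\<lambda>c. \<Sum>b\<in>B'. conv (xmon b) (?g b) c"] by simp
  qed
  have "(\<lambda>c. \<Sum>b\<in>B. conv (xmon b) (?g b) c) = f"
  proof
    fix c
    show "(\<Sum>b\<in>B. conv (xmon b) (?g b) c) = f c"
    proof (cases "c \<in> expo V")
      case False
      have "conv (xmon b) (?g b) \<in> carrier (pser V)" if "b \<in> B" for b
        using that B(2) by (intro conv_closed g xmon_closed) auto
      then have "conv (xmon b) (?g b) c = 0" if "b \<in> B" for b
        using False that pser_zero_outside by blast
      then show ?thesis using False f by (simp add: pser_zero_outside)
    next
      case True
      \<comment> \<open>The part of \<open>b\<close> contributes at \<open>c\<close> only if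
        \<open>b\<close> lies below \<open>c\<close> and \<open>b = \<pi> c\<close>; as
        \<open>\<pi> c\<close> does lie below \<open>c\<close>, exactly one part
        contributes.\<close>
      have "conv (xmon b) (?g b) c = (if b = \<pi> c then f c else 0)" if b: "b \<in> B" for b
      proof -
        have "(\<lambda>i. c i - b i + b i) = c" if "\<forall>i. b i \<le> c i" using that by auto
        then show ?thesis
          using conv_xmon[OF V g[OF b], of b c] B(2) b \<pi>[OF True] by auto
      qed
      then have "(\<Sum>b\<in>B. conv (xmon b) (?g b) c) = (\<Sum>b\<in>B. if b = \<pi> c then f c else 0)"
        by (rule sum.cong[OF refl])
      then show ?thesis using \<pi>[OF True] B(1) by simp
    qed
  qed
  then show ?thesis using sums[OF order_refl] by simp
qed

lemma pser_idealI:
  fixes J :: "'k::field series set"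
  assumes V: "finite V" and J: "J \<subseteq> carrier (pser V)" "(\<lambda>_. 0) \<in> J"
    and add: "\<And>f g. f \<in> J \<Longrightarrow> g \<in> J \<Longrightarrow> (\<lambda>a. f a + g a) \<in> J"
    and conv: "\<And>u f. u \<in> carrier (pser V) \<Longrightarrow> f \<in> J \<Longrightarrow> conv u f \<in> J"
  shows "ideal J (pser V)"
proof (rule idealI)
  interpret cring "pser V :: 'k series ring" by (rule pser_cring[OF V])
  show "ring (pser V :: 'k series ring)" by (rule ring_axioms)
  show "subgroup J (add_monoid (pser V))"
  proof (rule add.subgroupI)
    fix f assume f: "f \<in> J"
    \<comment> \<open>Negation is multiplication by the constant series -1, so closure under
      \<open>conv\<close> covers it.\<close>
    have "\<ominus>\<^bsub>pser V\<^esub> f = conv (cst (- 1)) f"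
      using f J conv[OF cst_closed f, of "- 1"] by (intro minus_equality) (auto simp: conv_cst[OF V] subset_eq)
    then show "\<ominus>\<^bsub>pser V\<^esub> f \<in> J" using conv[OF cst_closed f] by simp
  qed (use J add in auto)
  fix a x :: "'k series" assume "a \<in> J" "x \<in> carrier (pser V)"
  then show "x \<otimes>\<^bsub>pser V\<^esub> a \<in> J" "a \<otimes>\<^bsub>pser V\<^esub> x \<in> J"
    using conv[of x a] by (simp_all add: conv_commute[of a x])
qed

lemma vanish_ideal:
  assumes "staircase d E"
  shows "ideal {f \<in> carrier (pser {1..d}). vanish E f} (pser {1..d} :: 'k::field series ring)"
proof (rule pser_idealI)
  fix f g :: "'k series"
  assume "f \<in> {f \<in> carrier (pser {1..d}). vanish E f}" "g \<in> {f \<in> carrier (pser {1..d}). vanish E f}"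
  then show "(\<lambda>a. f a + g a) \<in> {f \<in> carrier (pser {1..d}). vanish E f}"
    by (auto simp: carrier_pser vanish_def) (metis add.right_neutral)
qed (auto simp: conv_closed vanish_conv[OF staircase_down_closed[OF assms]] carrier_pser[of "\<lambda>_. 0"] vanish_def[of E "\<lambda>_. 0"])

lemma finite_staircase_bound:
  assumes "finite (E :: (nat \<Rightarrow> nat) set)" "E \<subseteq> expo V" "finite V"
  obtains M where "\<And>e i. e \<in> E \<Longrightarrow> e i < M"
proof -
  have "finite (\<Union>e\<in>E. e ` V)" using assms by auto
  then obtain M where M: "\<forall>m\<in>(\<Union>e\<in>E. e ` V). m < M" using finite_nat_set_iff_bounded by blast
  have "e i < Suc M" if "e \<in> E" for e i
  proof (cases "i \<in> V")
    case True then have "e i < M" using that M by auto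
    then show ?thesis by simp
  next
    case False then show ?thesis using that assms(2) by (auto simp: expo_def)
  qed
  then show ?thesis by (rule that)
qed

lemma finite_box: "finite V \<Longrightarrow> finite {e \<in> expo V. \<forall>i. e i \<le> (M::nat)}"
proof -
  assume "finite V"
  then have "finite {f. \<forall>i. (i \<in> V \<longrightarrow> f i \<in> {..M}) \<and> (i \<notin> V \<longrightarrow> f i = 0)}"
    by (intro finite_set_of_finite_funs) auto
  then show ?thesis by (rule finite_subset[rotated]) (auto simp: expo_def)
qed

text \<open>The delicate inclusion is from right to left, since the generated ideal has only finite
  combinations. The monomials of \<open>f\<close> are grouped by their exponents capped at a strict
  bound \<open>M\<close> of \<open>E\<close>; this gives finitely many groups, each zero or a
  multiple of one generator.\<close>

lemma mono_ideal_eq: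
  assumes st: "staircase d E" and fin: "finite E"
  shows "mono_ideal d E = {f \<in> carrier (pser {1..d}). vanish E (f :: 'k::field series)}"
proof
  have "xmon ` (expo {1..d} - E) \<subseteq> {f \<in> carrier (pser {1..d}). vanish E (f :: 'k series)}"
    by (auto simp: xmon_closed vanish_def) (auto simp: xmon_def)
  then show "mono_ideal d E \<subseteq> {f \<in> carrier (pser {1..d}). vanish E (f :: 'k series)}"
    using vanish_ideal[OF st] by (auto simp: mono_ideal_def genideal_def)
next
  have Eex: "E \<subseteq> expo {1..d}" using st by (simp add: staircase_def)
  obtain M where M: "\<And>e i. e \<in> E \<Longrightarrow> e i < M"
    using finite_staircase_bound[OF fin Eex] by auto
  show "{f \<in> carrier (pser {1..d}). vanish E (f :: 'k series)} \<subseteq> mono_ideal d E"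
    unfolding mono_ideal_def genideal_def
  proof (intro subsetI InterI, clarify)
    fix f :: "'k series" and I
    assume f: "f \<in> carrier (pser {1..d})" "vanish E f"
      and I: "ideal I (pser {1..d} :: 'k series ring)" "xmon ` (expo {1..d} - E) \<subseteq> I"
    interpret I: ideal I "pser {1..d}" by (rule I)
    let ?\<pi> = "\<lambda>e i. min (e i) M"
    show "f \<in> I"
    proof (rule in_ideal_by_parts[where \<pi> = ?\<pi> and B = "{e \<in> expo {1..d}. \<forall>i. e i \<le> M}"])
      fix b assume b: "b \<in> {e \<in> expo {1..d}. \<forall>i. e i \<le> M}"
      let ?g = "\<lambda>a. if ?\<pi> (\<lambda>i. a i + b i) = b then f (\<lambda>i. a i + b i) else 0"
      have g: "?g \<in> carrier (pser {1..d})"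
        using f(1) unfolding carrier_pser by (auto intro: expo_le split: if_splits)
      show "conv (xmon b) ?g \<in> I"
      proof (cases "b \<in> E")
        case False
        then have "xmon b \<in> I" using I(2) b by auto
        then show ?thesis using I.I_r_closed[OF _ g, of "xmon b"] by simp
      next
        case True
        \<comment> \<open>For \<open>b\<close> in \<open>E\<close> all coordinates are below the
          cap, so only the exponent \<open>b\<close> itself belongs to its group, and
          \<open>f b = 0\<close>.\<close>
        have "?g a = 0" for a
        proof (rule ccontr)
          assume "?g a \<noteq> 0"
          then have *: "?\<pi> (\<lambda>i. a i + b i) = b" "f (\<lambda>i. a i + b i) \<noteq> 0" by (auto split: if_splits)
          have "a i = 0" for i
            using fun_cong[OF *(1), of i] M[OF True, of i] by auto
          then have "(\<lambda>i. a i + b i) = b" by auto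
          then show False using * f(2) True by (auto simp: vanish_def)
        qed
        then have "?g = (\<lambda>_. 0)" by blast
        then have "conv (xmon b) ?g = (\<lambda>_. 0)" by (simp add: conv_def)
        then show ?thesis
          using additive_subgroup.zero_closed[OF I.is_additive_subgroup] by simp
      qed
    next
      show "finite {e \<in> expo {1..d}. \<forall>i. e i \<le> M}" by (rule finite_box) simp
    qed (use f I in \<open>auto simp: expo_def\<close>)
  qed
qed

section \<open>Division by powers of \<open>X - T\<^sup>v\<close>\<close>

text \<open>The inner variable of \<open>'k fps fps\<close> is \<open>T\<close>, the outer one is \<open>X = x_1\<close>.\<close>

definition lin :: "nat \<Rightarrow> 'k::field fps fps" where
  "lin v = fps_X - fps_const (fps_X ^ v)"

text \<open>The value \<open>F(T\<^sup>v)\<close>, and the quotient of \<open>F - F(T\<^sup>v)\<close> by \<open>X - T\<^sup>v\<close>.\<close>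

definition at_root :: "nat \<Rightarrow> 'k::field fps fps \<Rightarrow> 'k fps" where
  "at_root v F = Abs_fps (\<lambda>m. \<Sum>l\<le>m. (fps_X ^ (v * l) * F $ l) $ m)"

definition quot :: "nat \<Rightarrow> 'k::field fps fps \<Rightarrow> 'k fps fps" where
  "quot v F = Abs_fps (\<lambda>a. at_root v (fps_shift (Suc a) F))"

text \<open>The term with index \<open>l\<close> has order at least \<open>v * l\<close> and does
  not reach \<open>m\<close> once \<open>l > m\<close>. All sufficiently long truncations agree, so
  coefficients for different \<open>m\<close> can be computed with a common one.\<close>

lemma at_root_nth:
  assumes "0 < v" "m \<le> N"
  shows "at_root v F $ m = (\<Sum>l\<le>N. (fps_X ^ (v * l) * F $ l) $ m)"
proof -
  have "m < v * l" if "m < l" for l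
    using assms(1) that by (metis less_le_trans nat_mult_1 mult_le_mono1 Suc_leI One_nat_def)
  then show ?thesis unfolding at_root_def fps_nth_Abs_fps
    by (intro sum.mono_neutral_left) (use assms in \<open>auto simp: fps_X_power_mult_nth\<close>)
qed

text \<open>Horner's rule at \<open>X = T^v\<close>.\<close>

lemma at_root_rec:
  assumes v: "0 < v"
  shows "at_root v F = F $ 0 + fps_X ^ v * at_root v (fps_shift 1 F)"
proof (rule fps_ext)
  fix m
  have "at_root v F $ m = (\<Sum>l\<le>Suc m. (fps_X ^ (v * l) * F $ l) $ m)"
    by (rule at_root_nth[OF v]) simp
  also have "\<dots> = F $ 0 $ m + (\<Sum>l\<le>m. (fps_X ^ (v * Suc l) * F $ Suc l) $ m)"
    by (subst sum.atMost_Suc_shift) simp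
  also have "(\<Sum>l\<le>m. (fps_X ^ (v * Suc l) * F $ Suc l) $ m) = (fps_X ^ v * at_root v (fps_shift 1 F)) $ m"
  proof (cases "m < v")
    case True
    then show ?thesis by (simp add: fps_X_power_mult_nth)
  next
    case False
    then have "(fps_X ^ v * at_root v (fps_shift 1 F)) $ m
        = (\<Sum>l\<le>m. (fps_X ^ (v * l) * F $ Suc l) $ (m - v))"
      by (simp add: fps_X_power_mult_nth at_root_nth[OF v, of "m - v" m])
    also have "\<dots> = (\<Sum>l\<le>m. (fps_X ^ (v * Suc l) * F $ Suc l) $ m)"
      using False by (intro sum.cong refl) (auto simp: fps_X_power_mult_nth)
    finally show ?thesis by simp
  qed
  finally show "at_root v F $ m = (F $ 0 + fps_X ^ v * at_root v (fps_shift 1 F)) $ m" by simp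
qed

lemma at_root_add: "at_root v (F + G) = at_root v F + at_root v G"
  by (rule fps_ext) (simp add: at_root_def distrib_left sum.distrib)

lemma at_root_diff: "at_root v (F - G) = at_root v F - at_root v G"
  by (rule fps_ext) (simp add: at_root_def right_diff_distrib sum_subtractf)

lemma at_root_scale:
  assumes v: "0 < v"
  shows "at_root v (fps_const c * F) = c * at_root v F"
proof (rule fps_ext)
  fix m
  have "(c * at_root v F) $ m = (\<Sum>i=0..m. c $ i * (\<Sum>l\<le>m. (fps_X ^ (v * l) * F $ l) $ (m - i)))"
    unfolding fps_mult_nth[of c]
    by (intro sum.cong refl arg_cong2[where f = "(*)"] at_root_nth[OF v]) simp
  also have "\<dots> = (\<Sum>l\<le>m. \<Sum>i=0..m. c $ i * (fps_X ^ (v * l) * F $ l) $ (m - i))"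
    unfolding sum_distrib_left by (rule sum.swap)
  also have "\<dots> = (\<Sum>l\<le>m. (c * (fps_X ^ (v * l) * F $ l)) $ m)"
    by (simp add: fps_mult_nth[of c])
  also have "\<dots> = at_root v (fps_const c * F) $ m"
    unfolding at_root_def by (simp add: mult.left_commute)
  finally show "at_root v (fps_const c * F) $ m = (c * at_root v F) $ m" by simp
qed

lemma quot_add: "quot v (F + G) = quot v F + quot v G"
  by (rule fps_ext) (simp add: quot_def fps_shift_add at_root_add)

lemma quot_scale: "0 < v \<Longrightarrow> quot v (fps_const c * F) = fps_const c * quot v F"
proof -
  assume v: "0 < v"
  have "fps_shift n (fps_const c * F) = fps_const c * fps_shift n F" for n
    by (rule fps_ext) simp
  then show ?thesis by (intro fps_ext) (simp add: quot_def at_root_scale[OF v])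
qed

lemma quot_pow_add: "(quot v ^^ n) (F + G) = (quot v ^^ n) F + (quot v ^^ n) G"
  by (induction n) (simp_all add: quot_add)

lemma quot_pow_scale: "0 < v \<Longrightarrow> (quot v ^^ n) (fps_const c * F) = fps_const c * (quot v ^^ n) F"
  by (induction n) (simp_all add: quot_scale)

text \<open>Division by a monic linear polynomial: coefficient \<open>a\<close> of the identity is
  Horner's rule for \<open>fps_shift a F\<close>.\<close>

lemma division_by_lin:
  assumes v: "0 < v"
  shows "F = fps_const (at_root v F) + lin v * quot v F"
proof (rule fps_ext)
  fix a
  have shift: "fps_shift (Suc 0) (fps_shift n F) = fps_shift (Suc n) F" for n
    by (rule fps_ext) simp
  show "F $ a = (fps_const (at_root v F) + lin v * quot v F) $ a"
  proof (cases a)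
    case 0
    then show ?thesis using at_root_rec[OF v, of F] by (simp add: lin_def quot_def algebra_simps)
  next
    case (Suc b)
    then show ?thesis using at_root_rec[OF v, of "fps_shift a F"]
      by (simp add: lin_def quot_def algebra_simps shift)
  qed
qed

lemma at_root_lin:
  assumes v: "0 < v"
  shows "at_root v (lin v * F) = 0"
proof -
  have "fps_shift 1 (fps_X * F) = F" by (rule fps_ext) simp
  then have "at_root v (fps_X * F) = fps_X ^ v * at_root v F"
    using at_root_rec[OF v, of "fps_X * F"] by simp
  then show ?thesis by (simp add: lin_def left_diff_distrib at_root_diff at_root_scale[OF v])
qed

lemma lin_nonzero: "lin v \<noteq> 0"
proof
  assume "lin v = (0 :: 'a fps fps)"
  then have "lin v $ 1 = (0 :: 'a fps)" by simp
  then show False by (simp add: lin_def)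
qed

lemma lin_power_dvd_Suc:
  assumes v: "0 < v"
  shows "lin v ^ Suc h dvd F \<longleftrightarrow> at_root v F = 0 \<and> lin v ^ h dvd quot v F"
proof
  assume "lin v ^ Suc h dvd F"
  then obtain G where G: "F = lin v * (lin v ^ h * G)" by (auto simp: dvd_def mult.assoc)
  have root: "at_root v F = 0" unfolding G by (rule at_root_lin[OF v])
  have "F = lin v * quot v F"
    using division_by_lin[OF v, of F] unfolding root fps_const_0_eq_0 add_0_left .
  then have "lin v * quot v F = lin v * (lin v ^ h * G)" using G by metis
  then have "quot v F = lin v ^ h * G" by (rule mult_left_cancel[OF lin_nonzero, THEN iffD1])
  then show "at_root v F = 0 \<and> lin v ^ h dvd quot v F" using root by simp
next
  assume *: "at_root v F = 0 \<and> lin v ^ h dvd quot v F"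
  then have "F = lin v * quot v F" using division_by_lin[OF v, of F] by simp
  then show "lin v ^ Suc h dvd F" using * mult_dvd_mono[OF dvd_refl[of "lin v"], of "lin v ^ h" "quot v F"] by simp
qed

text \<open>Iterated division produces the digits of \<open>F\<close> in powers of
  \<open>X - T^v\<close>, and the first \<open>h\<close> of them must vanish. In this form
  divisibility is a list of equations linear over \<open>k[[T]]\<close>.\<close>

lemma lin_power_dvd_iff:
  assumes v: "0 < v"
  shows "lin v ^ h dvd F \<longleftrightarrow> (\<forall>a<h. at_root v ((quot v ^^ a) F) = 0)"
proof (induction h arbitrary: F)
  case (Suc h)
  have "(\<forall>a<Suc h. at_root v ((quot v ^^ a) F) = 0) \<longleftrightarrow>
      at_root v F = 0 \<and> (\<forall>a<h. at_root v ((quot v ^^ a) (quot v F)) = 0)"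
    unfolding All_less_Suc2 by (simp add: funpow_swap1)
  then show ?case unfolding lin_power_dvd_Suc[OF v] Suc.IH by simp
qed simp

text \<open>\<open>tr v c\<close> is \<open>c(X - T\<^sup>v)\<close>.\<close>

definition tr :: "nat \<Rightarrow> 'k::field fps \<Rightarrow> 'k fps fps" where
  "tr v c = Abs_fps (\<lambda>a. Abs_fps (\<lambda>m.
    \<Sum>l\<in>{l. v * l = m}. (- 1) ^ l * of_nat ((a + l) choose l) * c $ (a + l)))"

section \<open>The substitution of X - T^v for X\<close>

lemma tr_nth:
  assumes v: "0 < v"
  shows "tr v c $ a $ m = (if v dvd m then
    (- 1) ^ (m div v) * of_nat ((a + m div v) choose (m div v)) * c $ (a + m div v) else 0)"
proof (cases "v dvd m")
  case True
  then have "{l. v * l = m} = {m div v}" using v by auto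
  then show ?thesis using True by (simp add: tr_def)
next
  case False
  then have "{l. v * l = m} = {}" by auto
  then show ?thesis using False by (simp add: tr_def)
qed

text \<open>Pascal's rule for the binomial coefficients in \<open>tr\<close>. Iterated, it splits
  \<open>(X - T^v)^h\<close> off the translate of a series divisible by \<open>X^h\<close>.\<close>

lemma tr_X_mult:
  assumes v: "0 < v"
  shows "tr v (fps_X * c) = lin v * tr v c"
proof (rule fps_ext, rule fps_ext)
  fix a m
  have rhs: "(lin v * tr v c) $ a $ m =
      (if a = 0 then 0 else tr v c $ (a - 1) $ m) - (if m < v then 0 else tr v c $ a $ (m - v))"
    by (simp add: lin_def left_diff_distrib fps_X_power_mult_nth)
  show "tr v (fps_X * c) $ a $ m = (lin v * tr v c) $ a $ m"
  proof (cases "v dvd m")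
    case False
    then have "\<not> v dvd (m - v)" if "\<not> m < v" using that by (simp add: dvd_minus_self)
    then show ?thesis using False by (simp add: rhs tr_nth[OF v])
  next
    case True
    then obtain l where l: "m = v * l" by blast
    have *: "v * l - v = v * (l - 1)" by (simp add: diff_mult_distrib2)
    show ?thesis
    proof (cases l)
      case 0
      then show ?thesis unfolding rhs using v by (cases a) (simp_all add: tr_nth[OF v] l)
    next
      case (Suc k)
      show ?thesis
      proof (cases a)
        case 0
        then show ?thesis unfolding rhs using v Suc by (simp add: tr_nth[OF v] l *)
      next
        case (Suc b)
        have "(Suc b + Suc k) choose (Suc k) = (b + Suc k choose Suc k) + (Suc b + k choose k)"
          by simp
        then have "of_nat ((Suc b + Suc k) choose (Suc k)) =
            (of_nat (b + Suc k choose Suc k) + of_nat (Suc b + k choose k) :: 'a)"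
          by (metis of_nat_add)
        then show ?thesis unfolding rhs using v Suc \<open>l = Suc k\<close>
          by (simp add: tr_nth[OF v] l * algebra_simps del: binomial_Suc_Suc)
      qed
    qed
  qed
qed

lemma tr_X_power_mult: "0 < v \<Longrightarrow> tr v (fps_X ^ h * c) = lin v ^ h * tr v c"
  by (induction h) (simp_all add: mult.assoc tr_X_mult)

lemma tr_one: "0 < v \<Longrightarrow> tr v 1 = 1"
  by (intro fps_ext) (auto simp: tr_nth)

lemma fps_X_power_dvd_0: "0 < m \<Longrightarrow> fps_X ^ m dvd (c :: 'k::field fps) \<Longrightarrow> c $ 0 = 0"
  by (auto simp: dvd_def fps_X_power_mult_nth)

section \<open>Orders in T of the coefficients of multiples of (X - T^v)^h\<close>

lemma lin_mult_nth:
  "(lin v * F) $ l = (if l = 0 then 0 else F $ (l - 1)) - fps_X ^ v * F $ l"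
  by (simp add: lin_def left_diff_distrib)

text \<open>By the binomial theorem the coefficient is a multiple of \<open>T^(v (h - l))\<close>;
  for \<open>l > h\<close> the exponent truncates to 0.\<close>

lemma lin_power_nth_dvd: "fps_X ^ (v * (h - l)) dvd ((lin v :: 'a::field fps fps) ^ h) $ l"
proof (induction h arbitrary: l)
  case (Suc h)
  have 1: "fps_X ^ (v * (Suc h - l)) dvd fps_X ^ v * ((lin v :: 'a fps fps) ^ h) $ l"
  proof (rule dvd_trans)
    have "v * (Suc h - l) \<le> v + v * (h - l)" by (cases "l \<le> h") (simp_all add: Suc_diff_le)
    then show "fps_X ^ (v * (Suc h - l)) dvd (fps_X ^ (v + v * (h - l)) :: 'a fps)"
      by (rule le_imp_power_dvd)
    show "fps_X ^ (v + v * (h - l)) dvd fps_X ^ v * ((lin v :: 'a fps fps) ^ h) $ l"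
      unfolding power_add using Suc.IH[of l] by (intro mult_dvd_mono) auto
  qed
  have 2: "fps_X ^ (v * (Suc h - l)) dvd (if l = 0 then 0 else ((lin v :: 'a fps fps) ^ h) $ (l - 1))"
    using Suc.IH[of "l - 1"] by (cases l) auto
  show ?case unfolding power_Suc lin_mult_nth using dvd_diff[OF 2 1] .
qed simp

lemma lin_power_nth_0: "(lin v ^ h) $ 0 = (- 1) ^ h * fps_X ^ (v * h)"
proof (induction h)
  case (Suc h)
  then show ?case unfolding power_Suc[of "lin v"] lin_mult_nth by (simp add: power_add)
qed simp

lemma lin_power_nth_nth_0:
  assumes "0 < v" shows "(lin v ^ h) $ l $ 0 = (if l = h then 1 else 0)"
proof (induction h arbitrary: l)
  case (Suc h)
  have "(fps_X ^ v * (lin v ^ h) $ l) $ 0 = 0" using assms by (simp add: fps_X_power_mult_nth)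
  then show ?case using Suc.IH[of "l - 1"] unfolding power_Suc lin_mult_nth by auto
qed simp

text \<open>The hypotheses on \<open>n\<close> at one point, with \<open>v = v_j\<close>. Below,
  step number \<open>Suc i\<close> governs the coefficient of \<open>X^i\<close>; the order
  \<open>Suc (n (Suc i))\<close> says that no \<open>t^m\<close> with \<open>m <= n (Suc i)\<close>
  occurs in it.\<close>

locale step_orders =
  fixes n :: "nat \<Rightarrow> nat" and v r :: nat
  assumes v: "0 < v" and step: "\<And>k. 1 \<le> k \<Longrightarrow> k < r \<Longrightarrow> n (Suc k) + v \<le> n k"
begin

lemma steps: "1 \<le> a \<Longrightarrow> a + l \<le> r \<Longrightarrow> n (a + l) + v * l \<le> n a"
proof (induction l)
  case (Suc l)
  then show ?case using step[of "a + l"] by simp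
qed simp

lemma term_order:
  assumes "1 \<le> l" "l \<le> j" "j < r" "fps_X ^ (Suc (n (Suc (j - l))) - v * h) dvd q $ (j - l)"
  shows "fps_X ^ Suc (n (Suc j)) dvd (lin v ^ h) $ l * q $ (j - l)"
proof (rule dvd_trans)
  have "Suc (j - l) + l = Suc j" using assms by simp
  then have *: "n (Suc j) + v * l \<le> n (Suc (j - l))" using steps[of "Suc (j - l)" l] assms by simp
  \<comment> \<open>Passing from index 0 to \<open>l\<close> loses \<open>v * l\<close> of the order
    \<open>v * h\<close>, and \<open>steps\<close> gives back at least as much. Truncated
    subtraction keeps the inequality true when \<open>l > h\<close> or when \<open>v * h\<close>
    exceeds the order.\<close>
  have "Suc (n (Suc j)) \<le> v * (h - l) + (Suc (n (Suc (j - l))) - v * h)"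
    using * by (simp add: diff_mult_distrib2)
  then show "fps_X ^ Suc (n (Suc j)) dvd
      (fps_X ^ (v * (h - l) + (Suc (n (Suc (j - l))) - v * h)) :: 'a fps)"
    by (rule le_imp_power_dvd)
  show "fps_X ^ (v * (h - l) + (Suc (n (Suc (j - l))) - v * h)) dvd (lin v ^ h) $ l * q $ (j - l)"
    unfolding power_add by (rule mult_dvd_mono[OF lin_power_nth_dvd assms(4)])
qed

text \<open>Isolates the one term containing \<open>q $ j\<close>; up to sign its factor is the pure
  power \<open>T^(v h)\<close>, which can be cancelled.\<close>

lemma nth_split:
  fixes F :: "'a::field fps fps"
  assumes "F = lin v ^ h * q"
  shows "F $ j = (- 1) ^ h * fps_X ^ (v * h) * q $ j + (\<Sum>l=1..j. (lin v ^ h) $ l * q $ (j - l))"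
proof -
  have "F $ j = (\<Sum>l=0..j. (lin v ^ h) $ l * q $ (j - l))" unfolding assms fps_mult_nth ..
  then show ?thesis by (simp add: sum.atLeast_Suc_atMost lin_power_nth_0)
qed

text \<open>The terms with \<open>l >= 1\<close> involve earlier coefficients of \<open>q\<close>
  and have the full order by \<open>term_order\<close>. Hence so does the isolated term, and
  \<open>T^(v h)\<close> is cancelled; when \<open>v h\<close> exceeds the order, the truncated
  exponent is 0.\<close>

lemma quotient_order:
  fixes F :: "'a::field fps fps"
  assumes F: "F = lin v ^ h * q" and i: "i \<le> r"
    and ord: "\<And>j. j < i \<Longrightarrow> fps_X ^ Suc (n (Suc j)) dvd F $ j"
  shows "j < i \<Longrightarrow> fps_X ^ (Suc (n (Suc j)) - v * h) dvd q $ j"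
proof (induction j rule: less_induct)
  case (less j)
  have "fps_X ^ Suc (n (Suc j)) dvd (\<Sum>l=1..j. (lin v ^ h) $ l * q $ (j - l))"
    using less i by (intro dvd_sum term_order) auto
  from dvd_diff[OF ord[OF less.prems] this]
  have "fps_X ^ Suc (n (Suc j)) dvd (- 1) ^ h * fps_X ^ (v * h) * q $ j"
    unfolding nth_split[OF F, of j] add_diff_cancel_right' .
  then have *: "fps_X ^ Suc (n (Suc j)) dvd fps_X ^ (v * h) * q $ j"
    by (cases "even h") (simp_all del: power_Suc)
  show ?case
  proof (cases "v * h \<le> Suc (n (Suc j))")
    case True
    then have "fps_X ^ Suc (n (Suc j)) = fps_X ^ (v * h) * (fps_X ^ (Suc (n (Suc j)) - v * h) :: 'a fps)"
      unfolding power_add[symmetric] by simp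
    from *[unfolded this] show ?thesis by (simp add: dvd_mult_cancel_left)
  qed simp
qed

text \<open>For \<open>h > [n_{i+1}/v]\<close> the factor \<open>T^(v h)\<close> alone gives the
  isolated term the order \<open>n_{i+1} + 1\<close>, whatever \<open>q $ i\<close> is.\<close>

lemma next_order:
  fixes F :: "'a::field fps fps"
  assumes "lin v ^ h dvd F" "i < r"
    and ord: "\<And>j. j < i \<Longrightarrow> fps_X ^ Suc (n (Suc j)) dvd F $ j"
    and h: "n (Suc i) div v < h"
  shows "fps_X ^ Suc (n (Suc i)) dvd F $ i"
proof -
  obtain q where F: "F = lin v ^ h * q" using assms(1) by blast
  have "Suc (n (Suc i)) \<le> v * h" using h v by (simp add: div_less_iff_less_mult mult.commute)
  then have 1: "fps_X ^ Suc (n (Suc i)) dvd (- 1) ^ h * fps_X ^ (v * h) * q $ i"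
    by (intro dvd_mult2 dvd_mult le_imp_power_dvd)
  have "fps_X ^ Suc (n (Suc i)) dvd (\<Sum>l=1..i. (lin v ^ h) $ l * q $ (i - l))"
    using assms(2) by (intro dvd_sum term_order quotient_order[OF F _ ord]) auto
  then show ?thesis unfolding nth_split[OF F, of i] using 1 by (rule dvd_add[rotated])
qed

lemma special_order:
  fixes F :: "'a::field fps fps"
  assumes "lin v ^ h dvd F" "i \<le> r"
    and ord: "\<And>j. j < i \<Longrightarrow> fps_X ^ Suc (n (Suc j)) dvd F $ j"
    and a: "\<And>j. j < i \<Longrightarrow> h \<le> n (Suc j) div v"
    and m: "m < h + i"
  shows "F $ m $ 0 = 0"
proof -
  obtain q where F: "F = lin v ^ h * q" using assms(1) by blast
  have "F $ m $ 0 = (\<Sum>l=0..m. (lin v ^ h) $ l $ 0 * q $ (m - l) $ 0)"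
    unfolding F fps_mult_nth by (simp add: fps_sum_nth)
  also have "\<dots> = (\<Sum>l=0..m. if l = h then q $ (m - h) $ 0 else 0)"
    by (intro sum.cong refl) (simp add: lin_power_nth_nth_0[OF v])
  also have "\<dots> = (if h \<le> m then q $ (m - h) $ 0 else 0)" by simp
  also have "\<dots> = 0"
  proof (cases "h \<le> m")
    case True
    then have j: "m - h < i" using m by simp
    \<comment> \<open>The \<open>Suc\<close> in the order matters: from
      \<open>v h <= n_{l+1}\<close> with \<open>l = m - h\<close> the exponent
      \<open>n_{l+1} + 1 - v h\<close> is still positive, so \<open>T\<close> divides
      \<open>q $ l\<close>.\<close>
    have "v * h \<le> n (Suc (m - h))"
      using a[OF j] v by (metis less_eq_div_iff_mult_less_eq mult.commute)
    then have "(q $ (m - h)) $ 0 = 0"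
      using quotient_order[OF F assms(2) ord j] by (intro fps_X_power_dvd_0) auto
    then show ?thesis by simp
  qed simp
  finally show ?thesis .
qed

end

section \<open>Staircases and the ideal of the family\<close>

lemma nat_eqI: "(\<And>m. m < a \<longleftrightarrow> m < b) \<Longrightarrow> a = (b :: nat)"
  by (metis less_irrefl nat_neq_iff)

text \<open>Justifies the definite description in \<open>height\<close>: finiteness leaves a first
  missing level over \<open>e\<close>, and down-closedness makes the levels below it exactly those
  in \<open>E\<close>.\<close>

lemma height_iff:
  assumes "down_closed E" "finite E"
  shows "e(1 := m) \<in> E \<longleftrightarrow> m < height E e"
proof -
  have fin: "finite {m. e(1 := m) \<in> E}"
  proof (rule finite_imageD)
    show "finite ((\<lambda>m. e(1 := m)) ` {m. e(1 := m) \<in> E})"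
      by (rule finite_subset[OF _ assms(2)]) auto
    show "inj_on (\<lambda>m. e(1 := m)) {m. e(1 := m) \<in> E}"
      by (rule inj_onI) (metis fun_upd_same)
  qed
  then obtain N where N: "e(1 := N) \<notin> E" 
    using ex_new_if_finite[OF infinite_UNIV_nat fin] by auto
  define h where "h = (LEAST m. e(1 := m) \<notin> E)"
  have h: "e(1 := h) \<notin> E" "m < h \<Longrightarrow> e(1 := m) \<in> E" for m
    unfolding h_def using LeastI[of "\<lambda>m. e(1 := m) \<notin> E", OF N] not_less_Least by blast+
  have dc: "e(1 := m) \<in> E" if "e(1 := m') \<in> E" "m \<le> m'" for m m'
  proof -
    have "\<forall>i. (e(1 := m)) i \<le> (e(1 := m')) i" using that(2) by simp
    then show ?thesis using assms(1) that(1) unfolding down_closed_def by blast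
  qed
  have hh: "\<forall>m. e(1 := m) \<in> E \<longleftrightarrow> m < h"
    using h dc not_less by blast
  have "height E e = h"
    unfolding height_def
  proof (rule the_equality)
    show "\<forall>m. e(1 := m) \<in> E \<longleftrightarrow> m < h" by (rule hh)
    fix h' assume "\<forall>m. e(1 := m) \<in> E \<longleftrightarrow> m < h'"
    then have "m < h' \<longleftrightarrow> m < h" for m using hh by blast
    then show "h' = h" by (rule nat_eqI)
  qed
  then show ?thesis using hh by simp
qed

lemma height_upd [simp]: "height E (e(1 := m)) = height E e" "height E (e(Suc 0 := m)) = height E e"
  by (simp_all add: height_def)

lemma mem_height:
  assumes "down_closed E" "finite E"
  shows "e \<in> E \<longleftrightarrow> e 1 < height E e"
  using height_iff[OF assms, of e "e 1"] by simp

lemma height_antimono: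
  assumes "down_closed E" "finite E" "\<forall>i. i \<noteq> 1 \<longrightarrow> a i \<le> e i"
  shows "height E e \<le> height E a"
proof (rule ccontr)
  assume "\<not> ?thesis"
  then have "e(1 := height E a) \<in> E" unfolding height_iff[OF assms(1,2)] by simp
  moreover have "\<forall>i. (a(1 := height E a)) i \<le> (e(1 := height E a)) i" using assms(3) by simp
  ultimately have "a(1 := height E a) \<in> E" using assms(1) unfolding down_closed_def by blast
  then show False unfolding height_iff[OF assms(1,2)] by simp
qed

lemma expo_upd: "e \<in> expo V \<Longrightarrow> i \<in> V \<Longrightarrow> e(i := m) \<in> expo V"
  by (auto simp: expo_def)

section \<open>Suppression and slicing of staircases\<close>

lemma suppress_facts:
  assumes d: "1 \<le> d" and st: "staircase d E" and fin: "finite E"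
  shows "staircase d (suppress d E t)" "finite (suppress d E t)"
    "e \<in> expo {1..d} \<Longrightarrow> height (suppress d E t) e =
      (if height E e \<le> t then height E e else height E e - 1)"
proof -
  note dc = staircase_down_closed[OF st]
  have sub: "suppress d E t \<subseteq> E"
  proof
    fix e assume "e \<in> suppress d E t"
    then have "e 1 < height E e" by (auto simp: suppress_def split: if_splits)
    then show "e \<in> E" using mem_height[OF dc fin] by simp
  qed
  then show fin': "finite (suppress d E t)" using fin by (rule finite_subset)
  show st': "staircase d (suppress d E t)"
    unfolding staircase_def
  proof (intro conjI ballI)
    show "suppress d E t \<subseteq> expo {1..d}" by (auto simp: suppress_def)
    fix c a assume c: "c \<in> expo {1..d} - suppress d E t" and a: "a \<in> expo {1..d}"
    \<comment> \<open>The height after suppression is a monotone function of the old height, so the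
      columns of the new set are still ordered as in a staircase.\<close>
    have "height E (\<lambda>i. a i + c i) \<le> height E c" by (rule height_antimono[OF dc fin]) simp
    then show "(\<lambda>i. a i + c i) \<in> expo {1..d} - suppress d E t"
      using c expo_add[OF a, of c] by (auto simp: suppress_def split: if_splits)
  qed
  assume e: "e \<in> expo {1..d}"
  have "m < height (suppress d E t) e \<longleftrightarrow> m < (if height E e \<le> t then height E e else height E e - 1)" for m
    unfolding height_iff[OF staircase_down_closed[OF st'] fin', symmetric]
    using expo_upd[OF e, of 1 m] d by (simp add: suppress_def)
  then show "height (suppress d E t) e = (if height E e \<le> t then height E e else height E e - 1)"
    by (rule nat_eqI)
qed

lemma suppress_seq_facts:
  assumes d: "1 \<le> d" and st: "staircase d (E j)" and fin: "finite (E j)"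
  shows "staircase d (suppress_seq d E t k j) \<and> finite (suppress_seq d E t k j)"
  by (induction k) (use assms suppress_facts in auto)

text \<open>As the \<open>t_i\<close> decrease strictly, nothing is suppressed in the first \<open>a\<close> steps (those with
  \<open>h \<le> t_i\<close>), and then each step suppresses one.\<close>

lemma suppress_seq_height:
  assumes d: "1 \<le> d" and st: "staircase d (E j)" and fin: "finite (E j)"
    and e: "e \<in> expo {1..d}"
    and dec: "\<And>k. 1 \<le> k \<Longrightarrow> k < r \<Longrightarrow> t (Suc k) j < t k j"
  defines "h \<equiv> height (E j) e"
  obtains a where "a \<le> r" "\<And>i. i < a \<Longrightarrow> h \<le> t (Suc i) j"
    "height (suppress_seq d E t r j) e + r = h + a"
proof -
  let ?h = "\<lambda>k. height (suppress_seq d E t k j) e"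
  have rec: "?h (Suc k) = (if ?h k \<le> t (Suc k) j then ?h k else ?h k - 1)" for k
    using suppress_facts(3)[OF d _ _ e] suppress_seq_facts[where E = E and j = j, OF assms(1-3)] by simp
  \<comment> \<open>Here \<open>a\<close> counts the steps without suppression. The last disjunct
    records that once a step has suppressed something the current height is still at least
    \<open>t_k\<close>; then \<open>t_{k+1} < t_k\<close> forces every later step to
    suppress.\<close>
  have "\<exists>a\<le>k. (\<forall>i<a. h \<le> t (Suc i) j) \<and> ?h k + k = h + a \<and> (a = k \<or> t k j \<le> ?h k)" if "k \<le> r" for k
    using that
  proof (induction k)
    case 0
    then show ?case by (simp add: h_def)
  next
    case (Suc k)
    then obtain a where a: "a \<le> k" "\<forall>i<a. h \<le> t (Suc i) j" "?h k + k = h + a" "a = k \<or> t k j \<le> ?h k"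
      by auto
    show ?case
    proof (cases "?h k \<le> t (Suc k) j")
      case True
      have "a = k"
      proof (rule ccontr)
        assume "a \<noteq> k"
        then have "t (Suc k) j < t k j" "t k j \<le> ?h k" using dec[of k] Suc.prems a by auto
        then show False using True by simp
      qed
      then show ?thesis using a True rec[of k]
        by (intro exI[of _ "Suc k"]) (auto simp: less_Suc_eq)
    next
      case False
      then show ?thesis using a rec[of k] by (intro exI[of _ a]) auto
    qed
  qed
  then show ?thesis using that by (metis order_refl)
qed

lemma slice_facts:
  assumes d: "1 \<le> d" and st: "staircase d E" and fin: "finite E"
  shows "staircase d (slice d E t)" "finite (slice d E t)"
proof -
  have "slice d E t \<subseteq> (\<lambda>a. a(1 := 0)) ` E"
  proof
    fix a assume "a \<in> slice d E t"
    then have "a(1 := t) \<in> E" "a = (a(1 := t))(1 := 0)" by (auto simp: slice_def)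
    then show "a \<in> (\<lambda>a. a(1 := 0)) ` E" by blast
  qed
  then show "finite (slice d E t)" using fin by (rule finite_surj[rotated])
  show "staircase d (slice d E t)"
    unfolding staircase_def
  proof (intro conjI ballI)
    show "slice d E t \<subseteq> expo {1..d}" by (auto simp: slice_def)
    fix c a assume c: "c \<in> expo {1..d} - slice d E t" and a: "a \<in> expo {1..d}"
    have "(\<lambda>i. a i + c i) \<notin> slice d E t"
    proof
      assume "(\<lambda>i. a i + c i) \<in> slice d E t"
      then have *: "(\<lambda>i. a i + c i)(1 := t) \<in> E" "c 1 = 0" by (auto simp: slice_def)
      have "\<forall>i. (c(1 := t)) i \<le> ((\<lambda>i. a i + c i)(1 := t)) i" by simp
      then have "c(1 := t) \<in> E"
        using *(1) staircase_down_closed[OF st] unfolding down_closed_def by blast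
      then show False using c *(2) by (simp add: slice_def)
    qed
    then show "(\<lambda>i. a i + c i) \<in> expo {1..d} - slice d E t" using c expo_add[OF a, of c] by auto
  qed
qed

text \<open>The coefficient of \<open>x_2^(e_2) \<dots> x_d^(e_d)\<close>, as a series in \<open>X = x_1\<close> and \<open>T = t\<close>.\<close>

definition slc :: "(nat \<Rightarrow> nat) \<Rightarrow> 'k::field series \<Rightarrow> 'k fps fps" where
  "slc e F = Abs_fps (\<lambda>a. Abs_fps (\<lambda>m. F (e(0 := m, 1 := a))))"

lemma slc_nth [simp]: "slc e F $ a $ m = F (e(0 := m, 1 := a))"
  by (simp add: slc_def)

lemma slc_cong: "e(0 := 0, 1 := 0) = e'(0 := 0, 1 := 0) \<Longrightarrow> slc e F = slc e' F"
proof -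
  assume *: "e(0 := 0, 1 := 0) = e'(0 := 0, 1 := 0)"
  have "e(0 := m, 1 := a) = e'(0 := m, 1 := a)" for m a
    using arg_cong[OF *, of "\<lambda>f. f(0 := m, 1 := a)"] by (simp add: fun_upd_twist)
  then show ?thesis by (simp add: slc_def)
qed

text \<open>Coordinates 0 and 1 of the convolution form the product in \<open>k[[T]][[X]]\<close>,
  the others an outer sum. The box below \<open>e(0 := 0, 1 := 0)\<close> forces
  \<open>a 0 = a 1 = 0\<close>, so that each slice occurs once.\<close>

lemma slc_conv:
  assumes V: "finite V" "e \<in> expo V"
  shows "slc e (conv F G) =
    (\<Sum>a\<in>{a. \<forall>i. a i \<le> (e(0 := 0, 1 := 0)) i}. slc a F * slc (\<lambda>i. e i - a i) G)"
proof (rule fps_ext, rule fps_ext)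
  fix k m
  let ?A = "{a. \<forall>i. a i \<le> (e(0 := 0, 1 := 0)) i}"
  let ?B = "{c. \<forall>i. c i \<le> (e(0 := m, 1 := k)) i}"
  have "(\<Sum>a\<in>?A. slc a F * slc (\<lambda>i. e i - a i) G) $ k $ m =
      (\<Sum>a\<in>?A. \<Sum>i=0..k. \<Sum>j=0..m. F (a(0 := j, 1 := i)) * G ((\<lambda>i. e i - a i)(0 := m - j, 1 := k - i)))"
    by (simp add: fps_sum_nth fps_mult_nth)
  also have "\<dots> = (\<Sum>(a, i, j)\<in>?A \<times> {0..k} \<times> {0..m}.
      F (a(0 := j, 1 := i)) * G ((\<lambda>i. e i - a i)(0 := m - j, 1 := k - i)))"
    by (simp add: sum.cartesian_product)
  also have "\<dots> = (\<Sum>c\<in>?B. F c * G (\<lambda>i. (e(0 := m, 1 := k)) i - c i))"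
  proof (rule sum.reindex_bij_witness[where i = "\<lambda>c. (c(0 := 0, 1 := 0), c 1, c 0)"
        and j = "\<lambda>(a, i, j). a(0 := j, 1 := i)"], goal_cases)
    case (1 x)
    obtain a i j where x: "x = (a, i, j)" by (cases x)
    have "\<forall>i. a i \<le> (e(0 := 0, 1 := 0)) i" using 1 unfolding x by blast
    from this[rule_format, of 0] this[rule_format, of 1] have "a 0 = 0" "a 1 = 0" by simp_all
    then have "a(0 := 0, 1 := 0) = a" by auto
    then show ?case by (simp add: x fun_upd_twist)
  next
    case (2 x)
    obtain a i j where x: "x = (a, i, j)" by (cases x)
    have a: "a l \<le> (e(0 := 0, 1 := 0)) l" for l using 2 unfolding x by blast
    have "i \<le> k" "j \<le> m" using 2 unfolding x by simp_all
    then have "(a(0 := j, 1 := i)) l \<le> (e(0 := m, 1 := k)) l" for l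
      using a[of l] by (cases "l = 0"; cases "l = 1") simp_all
    then show ?case by (simp add: x)
  next
    case (3 c)
    then show ?case by (simp add: fun_upd_twist)
  next
    case (4 c)
    then have "c i \<le> (e(0 := m, 1 := k)) i" for i by blast
    from this[of 0] this[of 1] have "c 0 \<le> m" "c 1 \<le> k" by simp_all
    moreover have "(c(0 := 0, 1 := 0)) i \<le> (e(0 := 0, 1 := 0)) i" for i
      using \<open>\<And>i. c i \<le> (e(0 := m, 1 := k)) i\<close>[of i] by (cases "i = 0"; cases "i = 1") simp_all
    ultimately show ?case by simp
  next
    case (5 x)
    obtain a i j where x: "x = (a, i, j)" by (cases x)
    have "(\<lambda>l. (e(0 := m, 1 := k)) l - (a(0 := j, 1 := i)) l) = (\<lambda>i. e i - a i)(0 := m - j, 1 := k - i)"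
      by auto
    then show ?case by (simp add: x)
  qed
  finally show "slc e (conv F G) $ k $ m =
      (\<Sum>a\<in>?A. slc a F * slc (\<lambda>i. e i - a i) G) $ k $ m"
    by (simp add: conv_def)
qed

lemma slc_eqI:
  assumes d: "1 \<le> d" and F: "F \<in> carrier (pser {0..d})" and G: "G \<in> carrier (pser {0..d})"
    and eq: "\<And>e. e \<in> expo {1..d} \<Longrightarrow> slc e F = slc e G"
  shows "F = G"
proof
  fix b
  show "F b = G b"
  proof (cases "b \<in> expo {0..d}")
    case False
    then show ?thesis using F G by (simp add: pser_zero_outside)
  next
    case True
    then have "b(0 := 0) \<in> expo {1..d}" by (simp only: expo_parameter)
    from eq[OF this] have "slc (b(0 := 0)) F $ b 1 $ b 0 = slc (b(0 := 0)) G $ b 1 $ b 0" by simp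
    then show ?thesis by simp
  qed
qed

text \<open>Translation moves only \<open>x_1\<close>, so it can be computed separately over each
  monomial in the other variables.\<close>

lemma slc_translate:
  assumes "e 0 = 0"
  shows "slc e (translate v f) = tr v (Abs_fps (\<lambda>a. f (e(1 := a))))"
proof (rule fps_ext, rule fps_ext)
  fix a m
  have "e(0 := 0, Suc 0 := x) = e(Suc 0 := x)" for x using assms by auto
  then show "slc e (translate v f) $ a $ m = tr v (Abs_fps (\<lambda>a. f (e(1 := a)))) $ a $ m"
    by (simp add: translate_def tr_def fun_upd_twist)
qed

lemma translate_closed:
  assumes d: "1 \<le> d" and f: "f \<in> carrier (pser {1..d})"
  shows "translate v f \<in> carrier (pser {0..d})"
  unfolding carrier_pser
proof (intro allI impI)
  fix b assume "translate v f b \<noteq> 0"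
  then obtain l where "f (b(0 := 0, 1 := b 1 + l)) \<noteq> 0"
    unfolding translate_def by (metis (no_types, lifting) mult_eq_0_iff sum.neutral)
  then have "b(0 := 0, 1 := b 1 + l) \<in> expo {1..d}" using f by (auto simp: carrier_pser)
  then have "(b(0 := 0, 1 := b 1 + l))(1 := b 1) \<in> expo {1..d}"
    using d by (intro expo_upd[of "b(0 := 0, 1 := b 1 + l)"]) auto
  moreover have "(b(0 := 0, 1 := b 1 + l))(1 := b 1) = b(0 := 0)" by auto
  ultimately show "b \<in> expo {0..d}" by (simp only: expo_parameter)
qed

lemma slc_translate_xmon:
  assumes v: "0 < v" and "e 0 = 0" "c 0 = 0"
  shows "slc e (translate v (xmon c)) = (if e(1 := 0) = c(1 := 0) then lin v ^ c 1 else 0)"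
proof (cases "e(1 := 0) = c(1 := 0)")
  case True
  have "e(1 := a) = c \<longleftrightarrow> a = c 1" for a
    using arg_cong[OF True, of "\<lambda>f. f(1 := a)"] by auto
  then have "Abs_fps (\<lambda>a. xmon c (e(1 := a))) = (fps_X ^ c 1 :: 'a fps)"
    by (intro fps_ext) (simp add: xmon_def)
  then show ?thesis using True tr_X_power_mult[OF v, of "c 1" "1 :: 'a fps"]
    by (simp add: slc_translate[of e, OF assms(2)] tr_one[OF v])
next
  case False
  then have "e(1 := a) \<noteq> c" for a by auto
  then have "Abs_fps (\<lambda>a. xmon c (e(1 := a))) = (0 :: 'a fps)"
    by (intro fps_ext) (simp add: xmon_def)
  moreover have "tr v (0 :: 'a fps) = 0" by (intro fps_ext) (simp add: tr_def)
  ultimately show ?thesis using False by (simp add: slc_translate[of e, OF assms(2)])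
qed

text \<open>The family ideal by explicit conditions, as \<open>family_ideal_iff\<close> shows.
  Neither \<open>height\<close> nor \<open>slc\<close> depends on coordinate 1 of \<open>e\<close>,
  so each column is merely listed repeatedly.\<close>

definition in_family :: "nat \<Rightarrow> nat \<Rightarrow> (nat \<Rightarrow> nat) set \<Rightarrow> 'k::field series \<Rightarrow> bool" where
  "in_family d v E F \<longleftrightarrow> (\<forall>e\<in>expo {1..d}. lin v ^ height E e dvd slc e F)"

section \<open>The ideal of the family in terms of slices\<close>

context
  fixes d v :: nat and E :: "(nat \<Rightarrow> nat) set"
  assumes d: "1 \<le> d" and v: "0 < v" and st: "staircase d E" and fin: "finite E"
begin

text \<open>A slice of the product at \<open>e\<close> is built from slices of \<open>F\<close> at
  exponents below \<open>e\<close>, where the staircase is at least as high.\<close>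

lemma in_family_conv:
  assumes F: "in_family d v E F" and G: "G \<in> carrier (pser {0..d})"
  shows "in_family d v E (conv G F)"
  unfolding in_family_def
proof
  fix e assume e: "e \<in> expo {1..d}"
  note dc = staircase_down_closed[OF st]
  show "lin v ^ height E e dvd slc e (conv G F)"
    unfolding slc_conv[OF finite_atLeastAtMost e]
  proof (intro dvd_sum dvd_mult)
    fix a assume "a \<in> {a. \<forall>i. a i \<le> (e(0 := 0, 1 := 0)) i}"
    have "height E e \<le> height E (\<lambda>i. e i - a i)" by (rule height_antimono[OF dc fin]) simp
    then have "lin v ^ height E e dvd (lin v ^ height E (\<lambda>i. e i - a i) :: 'a fps fps)"
      by (rule le_imp_power_dvd)
    then show "lin v ^ height E e dvd slc (\<lambda>i. e i - a i) F"
      using F expo_diff[OF e, of a] unfolding in_family_def by (meson dvd_trans)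
  qed
qed

lemma in_family_ideal:
  "ideal {F \<in> carrier (pser {0..d}). in_family d v E F} (pser {0..d} :: 'k::field series ring)"
proof (rule pser_idealI)
  have "slc e (\<lambda>_. 0) = (0 :: 'k fps fps)" for e by (intro fps_ext) simp
  then show "(\<lambda>_. 0 :: 'k) \<in> {F \<in> carrier (pser {0..d}). in_family d v E F}"
    by (simp add: carrier_pser in_family_def)
  fix f g :: "'k series"
  assume f: "f \<in> {F \<in> carrier (pser {0..d}). in_family d v E F}"
    and g: "g \<in> {F \<in> carrier (pser {0..d}). in_family d v E F}"
  have "slc e (\<lambda>a. f a + g a) = slc e f + slc e g" for e by (intro fps_ext) simp
  then show "(\<lambda>a. f a + g a) \<in> {F \<in> carrier (pser {0..d}). in_family d v E F}"
    using f g by (auto simp: in_family_def carrier_pser) (metis add.right_neutral)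
qed (auto simp: conv_closed in_family_conv)

lemma in_family_translate:
  assumes f: "f \<in> mono_ideal d E"
  shows "in_family d v E (translate v f)"
  unfolding in_family_def
proof
  fix e assume e: "e \<in> expo {1..d}"
  then have e0: "e 0 = 0" by (simp add: expo_def)
  let ?h = "height E e" and ?c = "Abs_fps (\<lambda>a. f (e(1 := a)))"
  \<comment> \<open>The column of \<open>E\<close> over \<open>e\<close> has height
    \<open>?h\<close>, so there \<open>f\<close> has order at least \<open>?h\<close> in
    \<open>x_1\<close>.\<close>
  have "?c = fps_X ^ ?h * fps_shift ?h ?c"
  proof (rule fps_ext)
    fix a
    have "f (e(1 := a)) = 0" if "a < ?h"
      using f that height_iff[OF staircase_down_closed[OF st] fin, of e a]
      unfolding mono_ideal_eq[OF st fin] vanish_def by auto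
    then show "?c $ a = (fps_X ^ ?h * fps_shift ?h ?c) $ a"
      by (simp add: fps_X_power_mult_nth)
  qed
  then have "slc e (translate v f) = lin v ^ ?h * tr v (fps_shift ?h ?c)"
    unfolding slc_translate[of e, OF e0] by (metis tr_X_power_mult[OF v])
  then show "lin v ^ ?h dvd slc e (translate v f)" by simp
qed

lemma family_ideal_subset:
  assumes "F \<in> family_ideal d v E"
  shows "F \<in> carrier (pser {0..d}) \<and> in_family d v E F"
proof -
  have "translate v ` mono_ideal d E \<subseteq> {F \<in> carrier (pser {0..d}). in_family d v E F}"
    using in_family_translate translate_closed[OF d] by (auto simp: mono_ideal_eq[OF st fin])
  then show ?thesis using assms in_family_ideal unfolding family_ideal_def genideal_def by blast
qed

text \<open>\<open>F\<close> has infinitely many slices but must be a finite combination. Capping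
  the coordinates from 2 on at a bound of \<open>E\<close> preserves heights, so \<open>F\<close> is
  a finite sum of parts \<open>x^b g\<close> in which every slice of \<open>g\<close> is divisible
  by the same \<open>(X - T^v)^h\<close>, with \<open>h\<close> the height over \<open>b\<close>.
  Since \<open>x^b (X - T^v)^h\<close> is the translate of a monomial in \<open>I^E\<close>, each
  part lies in the ideal.\<close>

lemma in_family_imp_family_ideal:
  fixes F :: "'k::field series"
  assumes F: "F \<in> carrier (pser {0..d})" and fam: "in_family d v E F"
  shows "F \<in> family_ideal d v E"
  unfolding family_ideal_def genideal_def
proof (intro InterI, clarify)
  fix I assume I: "ideal I (pser {0..d} :: 'k series ring)" "translate v ` mono_ideal d E \<subseteq> I"
  interpret I: ideal I "pser {0..d}" by (rule I)
  note dc = staircase_down_closed[OF st]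
  have Eex: "E \<subseteq> expo {1..d}" using st by (simp add: staircase_def)
  obtain M where M: "\<And>e i. e \<in> E \<Longrightarrow> e i < M"
    using finite_staircase_bound[OF fin Eex] by auto
  let ?\<pi> = "\<lambda>e i. if i \<le> 1 then 0 else min (e i) M"
  \<comment> \<open>If the capped exponent has a point of \<open>E\<close> over it, its coordinates
    are below \<open>M\<close>, so none was actually cut.\<close>
  have height_\<pi>: "height E (?\<pi> e) = height E e" if e0: "e 0 = 0" for e
  proof (rule antisym)
    show "height E e \<le> height E (?\<pi> e)" by (rule height_antimono[OF dc fin]) simp
    show "height E (?\<pi> e) \<le> height E e"
    proof (cases "height E (?\<pi> e)")
      case (Suc m)
      then have *: "(?\<pi> e)(1 := m) \<in> E" unfolding height_iff[OF dc fin] by simp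
      have "e i \<le> ?\<pi> e i" if "i \<noteq> 1" for i
      proof (cases "i = 0")
        case False
        then show ?thesis using M[OF *, of i] that by simp
      qed (simp add: e0)
      then show ?thesis by (intro height_antimono[OF dc fin]) blast
    qed simp
  qed
  show "F \<in> I"
  proof (rule in_ideal_by_parts[where \<pi> = ?\<pi> and B = "{e \<in> expo {0..d}. \<forall>i. e i \<le> M}"])
    fix b assume b: "b \<in> {e \<in> expo {0..d}. \<forall>i. e i \<le> M}"
    let ?g = "\<lambda>a. if ?\<pi> (\<lambda>i. a i + b i) = b then F (\<lambda>i. a i + b i) else 0"
    have g: "?g \<in> carrier (pser {0..d})"
      using F unfolding carrier_pser by (auto intro: expo_le split: if_splits)
    show "conv (xmon b) ?g \<in> I"
    proof (cases "b 0 = 0 \<and> b 1 = 0")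
      case False
      have "?\<pi> e \<noteq> b" for e
      proof
        assume "?\<pi> e = b"
        from fun_cong[OF this, of 0] fun_cong[OF this, of 1] show False using False by simp
      qed
      then have "?g = (\<lambda>_. 0)" by simp
      then have "conv (xmon b) ?g = (\<lambda>_. 0)" by (simp add: conv_def)
      then show ?thesis using additive_subgroup.zero_closed[OF I.is_additive_subgroup] by simp
    next
      case True
      then have b0: "b 0 = 0" and b1: "b 1 = 0" by auto
      have bex: "b \<in> expo {1..d}" using b b0 by (auto simp: expo_def not_le less_Suc_eq)
      \<comment> \<open>\<open>?b'\<close> is the lowest exponent over \<open>b\<close> outside
        \<open>E\<close>; the translate of its monomial is \<open>x^b (X - T^v)^?h\<close>.\<close>
      let ?h = "height E b" and ?b' = "b(1 := height E b)"
      have dvd: "lin v ^ ?h dvd slc e ?g" if e: "e \<in> expo {1..d}" for e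
      proof -
        have e0: "e 0 = 0" using e by (simp add: expo_def)
        have "(\<lambda>i. (e(0 := m, 1 := k)) i + b i) = (\<lambda>i. e i + b i)(0 := m, 1 := k)" for m k
          using True by auto
        moreover have "?\<pi> (\<lambda>i. (e(0 := m, 1 := k)) i + b i) = ?\<pi> (\<lambda>i. e i + b i)" for m k
          by auto
        ultimately have "slc e ?g = (if ?\<pi> (\<lambda>i. e i + b i) = b then slc (\<lambda>i. e i + b i) F else 0)"
          by (intro fps_ext) (simp only: slc_nth if_distrib[of "\<lambda>f. f $ _"] fps_zero_nth)
        moreover have "lin v ^ ?h dvd slc (\<lambda>i. e i + b i) F" if "?\<pi> (\<lambda>i. e i + b i) = b"
        proof -
          have "height E (\<lambda>i. e i + b i) = ?h"
            using height_\<pi>[of "\<lambda>i. e i + b i"] unfolding that by (simp add: e0 b0)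
          then show ?thesis using bspec[OF fam[unfolded in_family_def] expo_add[OF e bex]] by simp
        qed
        ultimately show ?thesis by simp
      qed
      define q0 where "q0 e = (SOME q. slc e ?g = lin v ^ ?h * q)" for e
      have q0: "slc e ?g = lin v ^ ?h * q0 e" if "e \<in> expo {1..d}" for e
        unfolding q0_def using dvd[OF that] by (intro someI_ex[of "\<lambda>q. slc e ?g = lin v ^ ?h * q"]) (auto simp: dvd_def)
      \<comment> \<open>Different slices share no coefficient, so quotients chosen independently fit
        into one series. Setting coordinates 0 and 1 to zero selects one choice per slice.\<close>
      define Q where "Q = (\<lambda>a. if a \<in> expo {0..d} then q0 (a(0 := 0, 1 := 0)) $ a 1 $ a 0 else 0)"
      have Q: "Q \<in> carrier (pser {0..d})" by (simp add: Q_def carrier_pser)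
      have slcQ: "lin v ^ ?h * slc e Q = slc e ?g" if e: "e \<in> expo {1..d}" for e
      proof -
        have e': "e(0 := 0, 1 := 0) \<in> expo {1..d}" using e by (auto simp: expo_def)
        have up: "e(0 := m, 1 := k) \<in> expo {0..d}" for m k using e d by (auto simp: expo_def)
        have "(e(0 := m, 1 := k))(0 := 0, 1 := 0) = e(0 := 0, 1 := 0)" for m k by auto
        then have "slc e Q = q0 (e(0 := 0, 1 := 0))"
          by (intro fps_ext) (simp only: slc_nth Q_def up if_True, simp)
        then show ?thesis using q0[OF e'] slc_cong[of e "e(0 := 0, 1 := 0)" ?g] by simp
      qed
      have b'ex: "?b' \<in> expo {1..d}" using expo_upd[OF bex, of 1] d by simp
      have tr_closed: "translate v (xmon ?b') \<in> carrier (pser {0..d} :: 'k series ring)"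
        by (rule translate_closed[OF d xmon_closed[OF b'ex]])
      have "conv (xmon b) ?g = conv (translate v (xmon ?b')) Q"
      proof (rule slc_eqI[OF d])
        show "conv (xmon b) ?g \<in> carrier (pser {0..d})"
          using b by (intro conv_closed xmon_closed g) auto
        show "conv (translate v (xmon ?b')) Q \<in> carrier (pser {0..d})"
          by (intro conv_closed tr_closed Q)
        fix e assume e: "e \<in> expo {1..d}"
        then have e0: "e 0 = 0" by (simp add: expo_def)
        have le: "(\<forall>i. b i \<le> (e(0 := m, 1 := k)) i) \<longleftrightarrow> (\<forall>i. b i \<le> e i)" for m k
          using b0 b1 by (metis fun_upd_apply zero_le)
        have sub: "(e(0 := m, 1 := k)) i - b i = ((\<lambda>i. e i - b i)(0 := m, 1 := k)) i" for m k i
          using True by auto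
        have bex0: "b \<in> expo {0..d}" using b by simp
        have left: "slc e (conv (xmon b) ?g) = (if \<forall>i. b i \<le> e i then slc (\<lambda>i. e i - b i) ?g else 0)"
          by (intro fps_ext) (simp only: slc_nth conv_xmon[OF finite_atLeastAtMost g bex0] le sub
              if_distrib[of "\<lambda>f. f $ _"] fps_zero_nth)
        let ?A = "{a. \<forall>i. a i \<le> (e(0 := 0, 1 := 0)) i}"
        have finA: "finite ?A"
          by (rule finite_below[of "{1..d}"]) (use e in \<open>auto simp: expo_def\<close>)
        \<comment> \<open>A translated monomial has a single nonzero slice, which collapses the
          convolution to the term \<open>a = b\<close>.\<close>
        have "slc a (translate v (xmon ?b')) = (if a = b then lin v ^ ?h else 0 :: 'k fps fps)"
          if "a \<in> ?A" for a
        proof -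
          have "a i \<le> (e(0 := 0, 1 := 0)) i" for i using that by blast
          from this[of 0] this[of 1] have a: "a 0 = 0" "a 1 = 0" by simp_all
          then have "a(1 := 0) = a" "?b'(1 := 0) = b" using b1 by auto
          then show ?thesis using a b0 by (subst slc_translate_xmon[OF v]) simp_all
        qed
        then have "slc e (conv (translate v (xmon ?b')) Q) =
            (\<Sum>a\<in>?A. if a = b then lin v ^ ?h * slc (\<lambda>i. e i - b i) Q else 0)"
          unfolding slc_conv[OF finite_atLeastAtMost e] by (intro sum.cong) auto
        also have "\<dots> = (if \<forall>i. b i \<le> e i then lin v ^ ?h * slc (\<lambda>i. e i - b i) Q else 0)"
          using finA le[of 0 0] by (simp only: sum.delta mem_Collect_eq)
        also have "\<dots> = slc e (conv (xmon b) ?g)"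
          unfolding left slcQ[OF expo_diff[OF e]] ..
        finally show "slc e (conv (xmon b) ?g) = slc e (conv (translate v (xmon ?b')) Q)" ..
      qed
      moreover have "(xmon ?b' :: 'k series) \<in> mono_ideal d E"
        using height_iff[OF dc fin, of b ?h] xmon_closed[OF b'ex]
        unfolding mono_ideal_eq[OF st fin] vanish_def by (auto simp: xmon_def)
      then have "translate v (xmon ?b') \<in> I" using I(2) by blast
      ultimately show ?thesis using I.I_r_closed[OF _ Q] by simp
    qed
  next
    show "finite {e \<in> expo {0..d}. \<forall>i. e i \<le> M}" by (rule finite_box) simp
  qed (use F I in \<open>auto simp: expo_def\<close>)
qed

lemma family_ideal_iff:
  "F \<in> family_ideal d v E \<longleftrightarrow> F \<in> carrier (pser {0..d}) \<and> in_family d v E F"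
  using family_ideal_subset in_family_imp_family_ideal by blast

end

section \<open>Functions and germs on a scheme\<close>

lemma sheaf_restrict_id: "is_sheaf T S \<rho> \<Longrightarrow> openin T U \<Longrightarrow> f \<in> S U \<Longrightarrow> \<rho> U U f = f"
  by (simp add: is_sheaf_def)

lemma sheaf_restrict_restrict:
  "is_sheaf T S \<rho> \<Longrightarrow> openin T U \<Longrightarrow> openin T V \<Longrightarrow> openin T W \<Longrightarrow> W \<subseteq> V \<Longrightarrow> V \<subseteq> U \<Longrightarrow>
    f \<in> S U \<Longrightarrow> \<rho> V W (\<rho> U V f) = \<rho> U W f"
  by (simp add: is_sheaf_def)

lemma sheaf_restrict_closed:
  assumes "is_sheaf T S \<rho>" "openin T U" "openin T V" "V \<subseteq> U" "f \<in> S U"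
  shows "\<rho> U V f \<in> S V"
proof -
  have "\<forall>U V. openin T U \<and> openin T V \<and> V \<subseteq> U \<longrightarrow> \<rho> U V ` S U \<subseteq> S V"
    using assms(1) unfolding is_sheaf_def by (elim conjE)
  then have "\<rho> U V ` S U \<subseteq> S V" using assms by simp
  then show ?thesis using assms(5) by blast
qed

lemma sheaf_eqI:
  assumes "is_sheaf T S \<rho>" "\<And>V. V \<in> C \<Longrightarrow> openin T V" "f \<in> S (\<Union>C)" "g \<in> S (\<Union>C)"
    "\<And>V. V \<in> C \<Longrightarrow> \<rho> (\<Union>C) V f = \<rho> (\<Union>C) V g"
  shows "f = g"
proof -
  have "\<forall>C. (\<forall>V\<in>C. openin T V) \<longrightarrow>
      (\<forall>f\<in>S (\<Union>C). \<forall>g\<in>S (\<Union>C). (\<forall>V\<in>C. \<rho> (\<Union>C) V f = \<rho> (\<Union>C) V g) \<longrightarrow> f = g)"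
    using assms(1) unfolding is_sheaf_def by (elim conjE)
  from mp[OF spec[OF this, of C]] assms(2)
  have "\<forall>f\<in>S (\<Union>C). \<forall>g\<in>S (\<Union>C). (\<forall>V\<in>C. \<rho> (\<Union>C) V f = \<rho> (\<Union>C) V g) \<longrightarrow> f = g"
    by blast
  from mp[OF bspec[OF bspec[OF this assms(3)] assms(4)]] assms(5) show ?thesis by blast
qed

lemma sheaf_glue:
  assumes "is_sheaf T S \<rho>" "\<And>V. V \<in> C \<Longrightarrow> openin T V \<and> s V \<in> S V"
    "\<And>V W. V \<in> C \<Longrightarrow> W \<in> C \<Longrightarrow> \<rho> V (V \<inter> W) (s V) = \<rho> W (V \<inter> W) (s W)"
  obtains f where "f \<in> S (\<Union>C)" "\<And>V. V \<in> C \<Longrightarrow> \<rho> (\<Union>C) V f = s V"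
proof -
  have "\<forall>C s. (\<forall>V\<in>C. openin T V \<and> s V \<in> S V) \<and>
      (\<forall>V\<in>C. \<forall>W\<in>C. \<rho> V (V \<inter> W) (s V) = \<rho> W (V \<inter> W) (s W)) \<longrightarrow>
      (\<exists>f\<in>S (\<Union>C). \<forall>V\<in>C. \<rho> (\<Union>C) V f = s V)"
    using assms(1) unfolding is_sheaf_def by (elim conjE)
  from mp[OF spec[OF spec[OF this, of C], of s]] assms(2,3)
  have "\<exists>f\<in>S (\<Union>C). \<forall>V\<in>C. \<rho> (\<Union>C) V f = s V" by blast
  then show ?thesis using that by blast
qed

locale kscheme =
  fixes X :: "('k::field, 'p, 'f) kspace"
  assumes scheme_X: "scheme X"
begin

lemma ringed: "ringed_kspace X"
  using scheme_X by (simp add: scheme_def)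

lemma cring_sheaf: "openin (topo X) U \<Longrightarrow> cring (sheaf X U)"
  using ringed by (simp add: ringed_kspace_def)

lemma res_hom:
  "openin (topo X) U \<Longrightarrow> openin (topo X) V \<Longrightarrow> V \<subseteq> U \<Longrightarrow> res X U V \<in> ring_hom (sheaf X U) (sheaf X V)"
  using ringed by (simp add: ringed_kspace_def)

lemma res_closed:
  "openin (topo X) U \<Longrightarrow> openin (topo X) V \<Longrightarrow> V \<subseteq> U \<Longrightarrow> f \<in> carrier (sheaf X U) \<Longrightarrow>
    res X U V f \<in> carrier (sheaf X V)"
  using ring_hom_closed[OF res_hom] .

lemma sheaf_X: "is_sheaf (topo X) (\<lambda>U. carrier (sheaf X U)) (res X)"
  using ringed by (simp add: ringed_kspace_def)

lemma kstr_closed: "kstr X c \<in> carrier (sheaf X (pts X))"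
  using ringed by (simp add: ringed_kspace_def)

lemmas res_id = sheaf_restrict_id[OF sheaf_X]
lemmas res_res = sheaf_restrict_restrict[OF sheaf_X]
lemmas function_eqI = sheaf_eqI[OF sheaf_X]
lemmas function_glue = sheaf_glue[OF sheaf_X]

section \<open>Germs and the maps to the stalks\<close>

lemma cring_stalk: "x \<in> pts X \<Longrightarrow> cring (stalk X x)"
  using scheme_X by (simp add: scheme_def local_ring_def)

lemma germ_self:
  assumes "openin (topo X) U" "x \<in> U" "f \<in> carrier (sheaf X U)"
  shows "(U, f) \<in> germ X x U f"
  unfolding germ_def using assms by auto

lemma germ_subset:
  assumes U: "openin (topo X) U" "f \<in> carrier (sheaf X U)"
    and V: "openin (topo X) V" "g \<in> carrier (sheaf X V)"
    and W: "openin (topo X) W" "x \<in> W" "W \<subseteq> U \<inter> V" "res X U W f = res X V W g"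
  shows "germ X x U f \<subseteq> germ X x V g"
proof
  fix a assume "a \<in> germ X x U f"
  then obtain U' f' W' where a: "a = (U', f')" "openin (topo X) U'" "x \<in> U'" "f' \<in> carrier (sheaf X U')"
    and W': "openin (topo X) W'" "x \<in> W'" "W' \<subseteq> U \<inter> U'" "res X U W' f = res X U' W' f'"
    by (auto simp: germ_def)
  let ?W = "W \<inter> W'"
  have o: "openin (topo X) ?W" using W W' by blast
  have "res X V ?W g = res X W ?W (res X V W g)" using V W o by (subst res_res) auto
  also have "\<dots> = res X U ?W f" using U W o unfolding W(4)[symmetric] by (subst res_res) auto
  also have "\<dots> = res X W' ?W (res X U W' f)" using U W' o by (subst res_res) auto
  also have "\<dots> = res X U' ?W f'" using a W' o unfolding W'(4) by (subst res_res) auto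
  finally show "a \<in> germ X x V g" using a W W' o by (auto simp: germ_def intro!: exI[of _ ?W])
qed

lemma germ_eqI:
  assumes "openin (topo X) U" "f \<in> carrier (sheaf X U)"
    and "openin (topo X) V" "g \<in> carrier (sheaf X V)"
    and "openin (topo X) W" "x \<in> W" "W \<subseteq> U \<inter> V" "res X U W f = res X V W g"
  shows "germ X x U f = germ X x V g"
  using germ_subset[OF assms] germ_subset[OF assms(3,4,1,2,5,6)] assms(7,8) by (simp add: Int_commute subset_antisym)

lemma germ_res:
  assumes "openin (topo X) U" "openin (topo X) V" "x \<in> V" "V \<subseteq> U" "f \<in> carrier (sheaf X U)"
  shows "germ X x V (res X U V f) = germ X x U f"
  using assms by (intro germ_eqI[where W = V]) (auto simp: res_closed res_id)

text \<open>An arbitrary operation compatible with restriction is allowed, so that one proof serves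
  sums and products. The unions over representatives collapse because all pairs give the same germ,
  and at least one pair exists.\<close>

lemma germ_operation:
  fixes P :: "'p set \<Rightarrow> 'f \<Rightarrow> 'f \<Rightarrow> 'f"
  assumes cl: "\<And>W f g. openin (topo X) W \<Longrightarrow> f \<in> carrier (sheaf X W) \<Longrightarrow> g \<in> carrier (sheaf X W) \<Longrightarrow>
      P W f g \<in> carrier (sheaf X W)"
    and res: "\<And>V W f g. openin (topo X) V \<Longrightarrow> openin (topo X) W \<Longrightarrow> W \<subseteq> V \<Longrightarrow> f \<in> carrier (sheaf X V) \<Longrightarrow>
      g \<in> carrier (sheaf X V) \<Longrightarrow> res X V W (P V f g) = P W (res X V W f) (res X V W g)"
    and U: "openin (topo X) U" "x \<in> U" "f \<in> carrier (sheaf X U)" "g \<in> carrier (sheaf X U)"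
  shows "(\<Union>(U', f')\<in>germ X x U f. \<Union>(V', g')\<in>germ X x U g.
      germ X x (U' \<inter> V') (P (U' \<inter> V') (res X U' (U' \<inter> V') f') (res X V' (U' \<inter> V') g'))) =
    germ X x U (P U f g)"
proof -
  have *: "germ X x (U' \<inter> V') (P (U' \<inter> V') (res X U' (U' \<inter> V') f') (res X V' (U' \<inter> V') g')) =
      germ X x U (P U f g)" if mem: "(U', f') \<in> germ X x U f" "(V', g') \<in> germ X x U g" for U' V' f' g'
  proof -
    obtain W1 where U': "openin (topo X) U'" "x \<in> U'" "f' \<in> carrier (sheaf X U')"
      and W1: "openin (topo X) W1" "x \<in> W1" "W1 \<subseteq> U \<inter> U'" "res X U W1 f = res X U' W1 f'"
      using mem(1) unfolding germ_def by blast
    obtain W2 where V': "openin (topo X) V'" "x \<in> V'" "g' \<in> carrier (sheaf X V')"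
      and W2: "openin (topo X) W2" "x \<in> W2" "W2 \<subseteq> U \<inter> V'" "res X U W2 g = res X V' W2 g'"
      using mem(2) unfolding germ_def by blast
    let ?W = "W1 \<inter> W2" and ?V = "U' \<inter> V'"
    have o: "openin (topo X) ?W" "openin (topo X) ?V" using W1 W2 U' V' by blast+
    have f: "res X U ?W f = res X U' ?W f'"
    proof -
      have "res X U ?W f = res X W1 ?W (res X U W1 f)" using U W1 o by (subst res_res) auto
      also have "\<dots> = res X U' ?W f'" using U' W1 o unfolding W1(4) by (subst res_res) auto
      finally show ?thesis .
    qed
    have g: "res X U ?W g = res X V' ?W g'"
    proof -
      have "res X U ?W g = res X W2 ?W (res X U W2 g)" using U W2 o by (subst res_res) auto
      also have "\<dots> = res X V' ?W g'" using V' W2 o unfolding W2(4) by (subst res_res) auto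
      finally show ?thesis .
    qed
    have cf: "res X U' ?V f' \<in> carrier (sheaf X ?V)" "res X V' ?V g' \<in> carrier (sheaf X ?V)"
      using U' V' o by (auto intro: res_closed)
    have "res X ?V ?W (P ?V (res X U' ?V f') (res X V' ?V g')) =
        P ?W (res X U' ?W f') (res X V' ?W g')"
      using res[OF o(2,1) _ cf] res_res[OF U'(1) o(2,1) _ _ U'(3)] res_res[OF V'(1) o(2,1) _ _ V'(3)]
        W1(3) W2(3) by auto
    also have "\<dots> = res X U ?W (P U f g)"
      using res[OF U(1) o(1) _ U(3,4)] W1(3) f g by (simp add: le_infI1)
    finally show ?thesis
      using cl[OF o(2) cf] cl[OF U(1,3,4)] U W1 W2 o by (intro germ_eqI[where W = ?W]) auto
  qed
  have ne: "(U, f) \<in> germ X x U f" "(U, g) \<in> germ X x U g" using germ_self U by auto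
  show ?thesis
  proof (rule subset_antisym)
    show "(\<Union>(U', f')\<in>germ X x U f. \<Union>(V', g')\<in>germ X x U g.
        germ X x (U' \<inter> V') (P (U' \<inter> V') (res X U' (U' \<inter> V') f') (res X V' (U' \<inter> V') g'))) \<subseteq>
        germ X x U (P U f g)" using * by blast
    show "germ X x U (P U f g) \<subseteq> (\<Union>(U', f')\<in>germ X x U f. \<Union>(V', g')\<in>germ X x U g.
        germ X x (U' \<inter> V') (P (U' \<inter> V') (res X U' (U' \<inter> V') f') (res X V' (U' \<inter> V') g')))"
      using *[OF ne] ne by blast
  qed
qed

lemma germ_hom:
  assumes U: "openin (topo X) U" "x \<in> U"
  shows "germ X x U \<in> ring_hom (sheaf X U) (stalk X x)"
proof (rule ring_hom_memI)
  have sub: "U \<subseteq> pts X" using U(1) by (rule openin_subset)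
  have o: "openin (topo X) (pts X)" by simp
  fix f g assume fg: "f \<in> carrier (sheaf X U)" "g \<in> carrier (sheaf X U)"
  show "germ X x U f \<in> carrier (stalk X x)" using U fg by (auto simp: stalk_def)
  show "germ X x U (f \<otimes>\<^bsub>sheaf X U\<^esub> g) = germ X x U f \<otimes>\<^bsub>stalk X x\<^esub> germ X x U g"
    unfolding stalk_def monoid.simps
    by (rule germ_operation[symmetric])
      (use U fg cring.cring_simprules(5)[OF cring_sheaf] ring_hom_mult[OF res_hom] in auto)
  show "germ X x U (f \<oplus>\<^bsub>sheaf X U\<^esub> g) = germ X x U f \<oplus>\<^bsub>stalk X x\<^esub> germ X x U g"
    unfolding stalk_def ring.simps
    by (rule germ_operation[symmetric])
      (use U fg cring.cring_simprules(1)[OF cring_sheaf] ring_hom_add[OF res_hom] in auto)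
next
  have sub: "U \<subseteq> pts X" using U(1) by (rule openin_subset)
  have o: "openin (topo X) (pts X)" by simp
  have "res X (pts X) U \<one>\<^bsub>sheaf X (pts X)\<^esub> = \<one>\<^bsub>sheaf X U\<^esub>" by (rule ring_hom_one[OF res_hom[OF o U(1) sub]])
  moreover have "\<one>\<^bsub>sheaf X (pts X)\<^esub> \<in> carrier (sheaf X (pts X))"
    by (rule cring.cring_simprules(6)[OF cring_sheaf[OF o]])
  ultimately show "germ X x U \<one>\<^bsub>sheaf X U\<^esub> = \<one>\<^bsub>stalk X x\<^esub>"
    using germ_res[OF o U sub] by (fastforce simp: stalk_def)
qed

end

section \<open>The map from a ring to its completion\<close>

lemma ideal_pow_ideal:
  assumes "cring A" "ideal M A" shows "ideal (ideal_pow A M n) A"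
proof -
  interpret cring A by (rule assms)
  show ?thesis by (induction n) (use assms(2) in \<open>auto intro: oneideal ideal_prod_is_ideal\<close>)
qed

text \<open>The powers of the ideal descend, so the cosets of one element are nested and form a
  point of the inverse limit.\<close>

lemma completion_map_hom:
  assumes "cring A" "ideal M A"
  shows "completion_map A M \<in> ring_hom A (completion A M)"
proof -
  interpret cring A by (rule assms)
  have hom: "a_r_coset A (ideal_pow A M n) \<in> ring_hom A (A Quot ideal_pow A M n)" for n
    by (rule ideal.rcos_ring_hom[OF ideal_pow_ideal[OF assms]])
  have "ideal_pow A M (Suc n) \<subseteq> ideal_pow A M n" for n
    using ideal_prod_inter[OF ideal_pow_ideal[OF assms, of n] assms(2)] by auto
  then have "a_r_coset A (ideal_pow A M (Suc n)) a \<subseteq> a_r_coset A (ideal_pow A M n) a" for n a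
    unfolding a_r_coset_def' by blast
  then show ?thesis
    by (intro ring_hom_memI)
      (simp_all add: completion_def completion_map_def ring_hom_closed[OF hom]
        ring_hom_mult[OF hom] ring_hom_add[OF hom] ring_hom_one[OF hom] del: ideal_pow.simps)
qed

section \<open>Expansions at a formal point\<close>

text \<open>Take \<open>c\<close> of least total degree in the support of \<open>w\<close>. Every
  other contribution to the product at \<open>c\<close> uses a coefficient of \<open>w\<close> of
  smaller degree, which leaves the nonzero product of \<open>u\<close> at 0 and
  \<open>w c\<close>.\<close>

lemma pser_cancel_unit:
  assumes V: "finite V" and u: "u \<in> carrier (pser V)" "u (\<lambda>_. 0) \<noteq> 0"
    and w: "w \<in> carrier (pser V)" and uw: "conv u w = (\<lambda>_. 0 :: 'k::field)"
  shows "w = (\<lambda>_. 0)"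
proof (rule ccontr)
  assume "w \<noteq> (\<lambda>_. 0)"
  then have "\<exists>c. w c \<noteq> 0" by auto
  then obtain c where c: "w c \<noteq> 0" "\<And>b. sum b V < sum c V \<Longrightarrow> w b = 0"
    using arg_min_natI[of "\<lambda>c. w c \<noteq> 0" _ "\<lambda>c. sum c V"] arg_min_nat_le[of "\<lambda>c. w c \<noteq> 0" _ "\<lambda>c. sum c V"]
    by (metis linorder_not_less)
  have cex: "c \<in> expo V" using w c(1) by (auto simp: carrier_pser)
  have z: "u a * w (\<lambda>i. c i - a i) = 0" if a: "\<forall>i. a i \<le> c i" and a0: "a \<noteq> (\<lambda>_. 0)" for a
  proof -
    obtain l where l: "a l \<noteq> 0" using a0 by auto
    have "l \<in> V" using l a cex expo_le[OF cex a] by (auto simp: expo_def)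
    then have "sum (\<lambda>i. c i - a i) V < sum c V"
      using V a l by (intro sum_strict_mono_ex1) (auto intro!: bexI[of _ l], metis diff_less le_zero_eq neq0_conv)
    then show ?thesis using c(2) by simp
  qed
  have "conv u w c = (\<Sum>a\<in>{a. \<forall>i. a i \<le> c i}. if a = (\<lambda>_. 0) then u (\<lambda>_. 0) * w c else 0)"
    unfolding conv_def using z by (intro sum.cong) auto
  also have "\<dots> = u (\<lambda>_. 0) * w c" using finite_below[OF V cex] by simp
  finally show False using uw u(2) c(1) by simp
qed

lemma maximal_prime:
  "primeideal {f \<in> carrier (pser {1..d}). f (\<lambda>_. 0) = (0 :: 'k::field)} (pser {1..d})"
proof (rule primeidealI)
  show cr: "cring (pser {1..d} :: 'k series ring)" by (rule pser_cring) simp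
  have add0: "(\<lambda>i. a i + c i) = (\<lambda>_. 0) \<Longrightarrow> c = (\<lambda>_. 0)" for a c :: "nat \<Rightarrow> nat"
    by (simp add: fun_eq_iff)
  \<comment> \<open>The series without constant term form the ideal belonging to the one-point
    staircase.\<close>
  have "staircase d {\<lambda>_. 0}"
    unfolding staircase_def by (auto simp: expo_add dest: add0) (auto simp: expo_def)
  from vanish_ideal[OF this]
  show "ideal {f \<in> carrier (pser {1..d}). f (\<lambda>_. 0) = (0 :: 'k)} (pser {1..d})"
    by (simp add: vanish_def)
  have "(\<one>\<^bsub>pser {1..d}\<^esub> :: 'k series) \<in> carrier (pser {1..d})"
    by (rule cring.cring_simprules(6)[OF cr])
  moreover have "(\<one>\<^bsub>pser {1..d}\<^esub> :: 'k series) \<notin> {f \<in> carrier (pser {1..d}). f (\<lambda>_. 0) = (0 :: 'k)}"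
    by simp
  ultimately show "carrier (pser {1..d}) \<noteq> {f \<in> carrier (pser {1..d}). f (\<lambda>_. 0) = (0 :: 'k)}" by blast
  fix a b :: "'k series"
  assume ab: "a \<in> carrier (pser {1..d})" "b \<in> carrier (pser {1..d})"
    "a \<otimes>\<^bsub>pser {1..d}\<^esub> b \<in> {f \<in> carrier (pser {1..d}). f (\<lambda>_. 0) = (0 :: 'k)}"
  have "{a :: nat \<Rightarrow> nat. \<forall>i. a i \<le> 0} = {\<lambda>_. 0}" by auto
  then have "conv a b (\<lambda>_. 0) = a (\<lambda>_. 0) * b (\<lambda>_. 0)" by (simp add: conv_def)
  then show "a \<in> {f \<in> carrier (pser {1..d}). f (\<lambda>_. 0) = (0 :: 'k)} \<or>
      b \<in> {f \<in> carrier (pser {1..d}). f (\<lambda>_. 0) = (0 :: 'k)}" using ab by simp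
qed

text \<open>Compared at the closed point, equality of \<open>a/1\<close> and \<open>b/1\<close>
  gives \<open>u (b - a) = 0\<close> with a \<open>u\<close> that has a constant term. This is the
  uniqueness behind the definite description in \<open>expansion\<close>.\<close>

lemma spec_function_inj:
  assumes a: "a \<in> carrier (pser {1..d})" and b: "b \<in> carrier (pser {1..d} :: 'k::field series ring)"
    and eq: "spec_function (pser {1..d}) a = spec_function (pser {1..d}) b"
  shows "a = b"
proof -
  let ?R = "pser {1..d} :: 'k series ring"
  let ?P = "{f \<in> carrier ?R. f (\<lambda>_. 0) = 0}"
  interpret cring ?R by (rule pser_cring) simp
  have "frac ?R (carrier ?R \<times> carrier ?R) ?P a \<one>\<^bsub>?R\<^esub> = frac ?R (carrier ?R \<times> carrier ?R) ?P b \<one>\<^bsub>?R\<^esub>"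
    using fun_cong[OF eq, of ?P] maximal_prime[of d, where ?'k = 'k] unfolding spec_function_def by simp
  moreover have "(a, \<one>\<^bsub>?R\<^esub>) \<in> frac ?R (carrier ?R \<times> carrier ?R) ?P a \<one>\<^bsub>?R\<^esub>"
  proof -
    have "\<one>\<^bsub>?R\<^esub> \<in> carrier ?R - ?P" using one_closed by simp
    moreover have "\<one>\<^bsub>?R\<^esub> \<otimes>\<^bsub>?R\<^esub> (a \<otimes>\<^bsub>?R\<^esub> \<one>\<^bsub>?R\<^esub> \<ominus>\<^bsub>?R\<^esub> a \<otimes>\<^bsub>?R\<^esub> \<one>\<^bsub>?R\<^esub>) = \<zero>\<^bsub>?R\<^esub>"
      using a r_neg by (metis minus_eq m_closed one_closed r_null)
    ultimately show ?thesis unfolding frac_def using a by blast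
  qed
  ultimately obtain u where u: "u \<in> carrier ?R - ?P"
    "u \<otimes>\<^bsub>?R\<^esub> (b \<otimes>\<^bsub>?R\<^esub> \<one>\<^bsub>?R\<^esub> \<ominus>\<^bsub>?R\<^esub> a \<otimes>\<^bsub>?R\<^esub> \<one>\<^bsub>?R\<^esub>) = \<zero>\<^bsub>?R\<^esub>"
    by (auto simp: frac_def simp del: pser_simps)
  then have "conv u (b \<ominus>\<^bsub>?R\<^esub> a) = (\<lambda>_. 0)" using r_one[OF a] r_one[OF b] by (metis pser_simps(1,3))
  then have "b \<ominus>\<^bsub>?R\<^esub> a = \<zero>\<^bsub>?R\<^esub>"
    using u pser_cancel_unit[of "{1..d}" u "b \<ominus>\<^bsub>?R\<^esub> a"] minus_closed[OF b a] by simp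
  moreover have "b = (b \<ominus>\<^bsub>?R\<^esub> a) \<oplus>\<^bsub>?R\<^esub> a"
    using a b by (simp del: pser_simps One_nat_def add: minus_eq a_assoc l_neg)
  ultimately show ?thesis using l_zero[OF a] by simp
qed

locale formal_point = kscheme X for X :: "('k::field, 'p, 'f) kspace" +
  fixes d :: nat and x :: 'p and \<phi> :: "('k, 'p, 'f) formal_map"
  assumes x: "x \<in> pts X" and nbhd: "formal_neighborhood X d x \<phi>"
begin

abbreviation "ex \<equiv> expansion d \<phi>"

lemma expansion_eqI:
  "a \<in> carrier (pser {1..d}) \<Longrightarrow> snd \<phi> U f = spec_function (pser {1..d}) a \<Longrightarrow> ex U f = a"
  unfolding expansion_def by (rule the_equality) (auto intro: spec_function_inj)

text \<open>A single homomorphism from the stalk computes the expansions on all neighborhoods;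
  compatibility with products and with restriction is then inherited from germs.\<close>

lemma expansion_via_stalk:
  "\<exists>\<eta>\<in>ring_hom (stalk X x) (pser {1..d}). \<forall>U f. openin (topo X) U \<longrightarrow> x \<in> U \<longrightarrow>
    f \<in> carrier (sheaf X U) \<longrightarrow> ex U f = \<eta> (germ X x U f)"
proof -
  define M where "M = (THE M. maximalideal M (stalk X x))"
  have "\<exists>!M. maximalideal M (stalk X x)"
    using scheme_X x by (simp add: scheme_def local_ring_def)
  then have "maximalideal M (stalk X x)" unfolding M_def by (rule theI')
  then have hom: "completion_map (stalk X x) M \<in> ring_hom (stalk X x) (completion (stalk X x) M)"
    by (intro completion_map_hom[OF cring_stalk[OF x]] maximalideal.axioms(1))
  obtain \<psi> where \<psi>: "\<psi> \<in> ring_iso (completion (stalk X x) M) (pser {1..d})"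
    "\<And>U f. openin (topo X) U \<Longrightarrow> x \<in> U \<Longrightarrow> f \<in> carrier (sheaf X U) \<Longrightarrow>
      snd \<phi> U f = spec_function (pser {1..d}) (\<psi> (completion_map (stalk X x) M (germ X x U f)))"
    using nbhd unfolding formal_neighborhood_def Let_def M_def by blast
  have hom': "\<psi> \<circ> completion_map (stalk X x) M \<in> ring_hom (stalk X x) (pser {1..d})"
    using hom \<psi>(1) by (auto simp: ring_iso_def intro: ring_hom_trans)
  show ?thesis
  proof (intro bexI[OF _ hom'] allI impI)
    fix U f assume U: "openin (topo X) U" "x \<in> U" "f \<in> carrier (sheaf X U)"
    have "(\<psi> \<circ> completion_map (stalk X x) M) (germ X x U f) \<in> carrier (pser {1..d})"
      by (rule ring_hom_closed[OF hom' ring_hom_closed[OF germ_hom[OF U(1,2)] U(3)]])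
    then show "ex U f = (\<psi> \<circ> completion_map (stalk X x) M) (germ X x U f)"
      using \<psi>(2)[OF U] by (intro expansion_eqI) auto
  qed
qed

lemma ex_hom:
  assumes "openin (topo X) U" "x \<in> U"
  shows "ex U \<in> ring_hom (sheaf X U) (pser {1..d})"
proof -
  obtain \<eta> where \<eta>: "\<eta> \<in> ring_hom (stalk X x) (pser {1..d})"
    "\<And>U f. openin (topo X) U \<Longrightarrow> x \<in> U \<Longrightarrow> f \<in> carrier (sheaf X U) \<Longrightarrow> ex U f = \<eta> (germ X x U f)"
    using expansion_via_stalk by blast
  have "\<eta> \<circ> germ X x U \<in> ring_hom (sheaf X U) (pser {1..d})"
    using germ_hom[OF assms] \<eta>(1) by (rule ring_hom_trans)
  note h = ring_hom_memE[OF this]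
  interpret U: cring "sheaf X U" by (rule cring_sheaf[OF assms(1)])
  have ex: "ex U f = (\<eta> \<circ> germ X x U) f" if "f \<in> carrier (sheaf X U)" for f
    using \<eta>(2)[OF assms that] by simp
  show ?thesis
    by (rule ring_hom_memI) (use h in \<open>simp_all add: ex del: comp_apply pser_simps\<close>)
qed

lemma ex_res:
  assumes "openin (topo X) U" "openin (topo X) V" "x \<in> V" "V \<subseteq> U" "f \<in> carrier (sheaf X U)"
  shows "ex V (res X U V f) = ex U f"
proof -
  obtain \<eta> where \<eta>: "\<eta> \<in> ring_hom (stalk X x) (pser {1..d})"
    "\<And>U f. openin (topo X) U \<Longrightarrow> x \<in> U \<Longrightarrow> f \<in> carrier (sheaf X U) \<Longrightarrow> ex U f = \<eta> (germ X x U f)"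
    using expansion_via_stalk by blast
  show ?thesis using \<eta>(2)[of V "res X U V f"] \<eta>(2)[of U f] assms germ_res[OF assms(1-5)]
    by (auto simp: res_closed)
qed

lemma ex_kstr: "ex (pts X) (kstr X c) = cst c"
proof (rule expansion_eqI)
  let ?R = "pser {1..d} :: 'k series ring"
  interpret R: cring ?R by (rule pser_cring) simp
  show "cst c \<in> carrier (pser {1..d})" by simp
  have "snd \<phi> (pts X) (kstr X c) = kstr (formal_spec d) c"
    using nbhd unfolding formal_neighborhood_def morphism_def ringed_morphism_def by blast
  also have "\<dots> = spec_function ?R (cst c)"
  proof -
    \<comment> \<open>Every prime omits some element, so the basic open sets cover all primes and
      the constant is a function on the whole spectrum.\<close>
    have "\<exists>f\<in>carrier ?R. f \<notin> P" if "primeideal P ?R" for P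
      using primeideal.I_notcarr[OF that] ideal.Icarr[OF primeideal.axioms(1)[OF that]] by blast
    then have "topspace (topology_generated_by ((\<lambda>f. {P. primeideal P ?R \<and> f \<notin> P}) ` carrier ?R)) =
        {P. primeideal P ?R}" by (auto simp: topology_generated_by_topspace)
    then show ?thesis by (simp add: formal_spec_def Spec_def frac_space_def spec_function_def)
  qed
  finally show "snd \<phi> (pts X) (kstr X c) = spec_function ?R (cst c)" .
qed

end

section \<open>Line bundles and divisors at a formal point\<close>

locale line_bundle = kscheme X for X :: "('k::field, 'p, 'f) kspace" +
  fixes L :: "('p, 'f, 'l) msheaf"
  assumes invertible: "invertible_sheaf X L"
begin

lemma module_L: "openin (topo X) U \<Longrightarrow> module (sheaf X U) (msec L U)"
  using invertible by (simp add: invertible_sheaf_def module_sheaf_def)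

lemma sheaf_L: "is_sheaf (topo X) (\<lambda>U. carrier (msec L U)) (mres L)"
  using invertible by (simp add: invertible_sheaf_def module_sheaf_def)

lemmas mres_id = sheaf_restrict_id[OF sheaf_L]
lemmas mres_mres = sheaf_restrict_restrict[OF sheaf_L]
lemmas mres_closed = sheaf_restrict_closed[OF sheaf_L]

lemma mres_add:
  "openin (topo X) U \<Longrightarrow> openin (topo X) V \<Longrightarrow> V \<subseteq> U \<Longrightarrow> \<sigma> \<in> carrier (msec L U) \<Longrightarrow>
    \<tau> \<in> carrier (msec L U) \<Longrightarrow>
    mres L U V (\<sigma> \<oplus>\<^bsub>msec L U\<^esub> \<tau>) = mres L U V \<sigma> \<oplus>\<^bsub>msec L V\<^esub> mres L U V \<tau>"
  using invertible by (simp add: invertible_sheaf_def module_sheaf_def)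

lemma mres_smult:
  "openin (topo X) U \<Longrightarrow> openin (topo X) V \<Longrightarrow> V \<subseteq> U \<Longrightarrow> f \<in> carrier (sheaf X U) \<Longrightarrow>
    \<sigma> \<in> carrier (msec L U) \<Longrightarrow>
    mres L U V (f \<odot>\<^bsub>msec L U\<^esub> \<sigma>) = res X U V f \<odot>\<^bsub>msec L V\<^esub> mres L U V \<sigma>"
  using invertible by (simp add: invertible_sheaf_def module_sheaf_def)

lemma smult_closed:
  "openin (topo X) U \<Longrightarrow> f \<in> carrier (sheaf X U) \<Longrightarrow> \<sigma> \<in> carrier (msec L U) \<Longrightarrow>
    f \<odot>\<^bsub>msec L U\<^esub> \<sigma> \<in> carrier (msec L U)"
  by (rule module.smult_closed[OF module_L])

lemma smult_assoc:
  "openin (topo X) U \<Longrightarrow> f \<in> carrier (sheaf X U) \<Longrightarrow> g \<in> carrier (sheaf X U) \<Longrightarrow>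
    \<sigma> \<in> carrier (msec L U) \<Longrightarrow>
    (f \<otimes>\<^bsub>sheaf X U\<^esub> g) \<odot>\<^bsub>msec L U\<^esub> \<sigma> = f \<odot>\<^bsub>msec L U\<^esub> (g \<odot>\<^bsub>msec L U\<^esub> \<sigma>)"
  by (rule module.smult_assoc1[OF module_L])

lemma generatorD:
  assumes "generator X L U e"
  shows "openin (topo X) U" "e \<in> carrier (msec L U)"
  using assms by (auto simp: generator_def)

lemma generator_bij:
  assumes "generator X L U e" "openin (topo X) V" "V \<subseteq> U"
  shows "bij_betw (\<lambda>f. f \<odot>\<^bsub>msec L V\<^esub> mres L U V e) (carrier (sheaf X V)) (carrier (msec L V))"
  using assms by (simp add: generator_def)

lemma generator_res:
  assumes e: "generator X L U e" and V: "openin (topo X) V" "V \<subseteq> U"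
  shows "generator X L V (mres L U V e)"
  unfolding generator_def
proof (intro conjI allI impI)
  note U = generatorD[OF e]
  show "openin (topo X) V" "mres L U V e \<in> carrier (msec L V)" using V U by (auto intro: mres_closed)
  fix W assume "openin (topo X) W \<and> W \<subseteq> V"
  then have W: "openin (topo X) W" "W \<subseteq> V" "W \<subseteq> U" using V(2) by auto
  show "bij_betw (\<lambda>f. f \<odot>\<^bsub>msec L W\<^esub> mres L V W (mres L U V e))
      (carrier (sheaf X W)) (carrier (msec L W))"
    unfolding mres_mres[OF U(1) V(1) W(1,2) V(2) U(2)] by (rule generator_bij[OF e W(1,3)])
qed

lemma generator_cancel:
  assumes e: "generator X L U e" and "f \<in> carrier (sheaf X U)" "g \<in> carrier (sheaf X U)"
    "f \<odot>\<^bsub>msec L U\<^esub> e = g \<odot>\<^bsub>msec L U\<^esub> e"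
  shows "f = g"
  using generator_bij[OF e generatorD(1)[OF e] order_refl] assms
  unfolding mres_id[OF generatorD[OF e]] bij_betw_def inj_on_def by blast

lemma generator_obtain:
  assumes e: "generator X L U e" and "\<sigma> \<in> carrier (msec L U)"
  obtains f where "f \<in> carrier (sheaf X U)" "\<sigma> = f \<odot>\<^bsub>msec L U\<^esub> e"
  using generator_bij[OF e generatorD(1)[OF e] order_refl] assms(2)
  unfolding mres_id[OF generatorD[OF e]] bij_betw_def by blast

section \<open>Equations of the divisor\<close>

lemma local_equation_res:
  assumes g: "local_equation X D U g" and V: "openin (topo X) V" "V \<subseteq> U"
  shows "local_equation X D V (res X U V g)"
proof -
  have U: "openin (topo X) U" "g \<in> carrier (sheaf X U)" using g by (auto simp: local_equation_def)
  show ?thesis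
    unfolding local_equation_def
  proof (intro conjI allI impI)
    show "openin (topo X) V" "res X U V g \<in> carrier (sheaf X V)" using U V by (auto intro: res_closed)
    fix W assume W: "openin (topo X) W \<and> W \<subseteq> V"
    then have r: "res X V W (res X U V g) = res X U W g" using U V by (intro res_res) auto
    have "W \<subseteq> U" using W V by blast
    then show "D W = cgenideal (sheaf X W) (res X V W (res X U V g))"
      "\<forall>h\<in>carrier (sheaf X W). h \<otimes>\<^bsub>sheaf X W\<^esub> res X V W (res X U V g) = \<zero>\<^bsub>sheaf X W\<^esub> \<longrightarrow>
        h = \<zero>\<^bsub>sheaf X W\<^esub>"
      unfolding r using g W unfolding local_equation_def by simp_all
  qed
qed

lemma local_equationD:
  assumes g: "local_equation X D U g"
  shows "openin (topo X) U" "g \<in> carrier (sheaf X U)" "D U = cgenideal (sheaf X U) g"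
    "h \<in> carrier (sheaf X U) \<Longrightarrow> h \<otimes>\<^bsub>sheaf X U\<^esub> g = \<zero>\<^bsub>sheaf X U\<^esub> \<Longrightarrow> h = \<zero>\<^bsub>sheaf X U\<^esub>"
proof -
  show U: "openin (topo X) U" "g \<in> carrier (sheaf X U)" using g by (auto simp: local_equation_def)
  have "D U = cgenideal (sheaf X U) (res X U U g)"
    and "\<forall>h\<in>carrier (sheaf X U). h \<otimes>\<^bsub>sheaf X U\<^esub> res X U U g = \<zero>\<^bsub>sheaf X U\<^esub> \<longrightarrow> h = \<zero>\<^bsub>sheaf X U\<^esub>"
    using g U(1) unfolding local_equation_def by blast+
  then show "D U = cgenideal (sheaf X U) g"
    "h \<in> carrier (sheaf X U) \<Longrightarrow> h \<otimes>\<^bsub>sheaf X U\<^esub> g = \<zero>\<^bsub>sheaf X U\<^esub> \<Longrightarrow> h = \<zero>\<^bsub>sheaf X U\<^esub>"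
    using res_id[OF U] by auto
qed

lemma local_equation_multiple:
  assumes g: "local_equation X D U g" and g': "local_equation X D U g'"
  obtains a where "a \<in> carrier (sheaf X U)" "g' = a \<otimes>\<^bsub>sheaf X U\<^esub> g"
proof -
  interpret cring "sheaf X U" by (rule cring_sheaf[OF local_equationD(1)[OF g]])
  have "g' \<in> cgenideal (sheaf X U) g"
    using cgenideal_self[OF local_equationD(2)[OF g']] local_equationD(3)[OF g]
      local_equationD(3)[OF g'] by simp
  then show ?thesis using that by (auto simp: cgenideal_def)
qed

lemma local_equation_cancel_power:
  assumes g: "local_equation X D U g" and f: "f \<in> carrier (sheaf X U)" "h \<in> carrier (sheaf X U)"
  shows "f \<otimes>\<^bsub>sheaf X U\<^esub> g [^]\<^bsub>sheaf X U\<^esub> (i::nat) = h \<otimes>\<^bsub>sheaf X U\<^esub> g [^]\<^bsub>sheaf X U\<^esub> i \<Longrightarrow> f = h"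
proof (induction i)
  interpret cring "sheaf X U" by (rule cring_sheaf[OF local_equationD(1)[OF g]])
  case 0
  then show ?case using f by simp
next
  interpret cring "sheaf X U" by (rule cring_sheaf[OF local_equationD(1)[OF g]])
  note gc = local_equationD(2)[OF g]
  case (Suc i)
  let ?p = "g [^]\<^bsub>sheaf X U\<^esub> i"
  have "(f \<otimes>\<^bsub>sheaf X U\<^esub> ?p \<ominus>\<^bsub>sheaf X U\<^esub> h \<otimes>\<^bsub>sheaf X U\<^esub> ?p) \<otimes>\<^bsub>sheaf X U\<^esub> g =
      f \<otimes>\<^bsub>sheaf X U\<^esub> (?p \<otimes>\<^bsub>sheaf X U\<^esub> g) \<ominus>\<^bsub>sheaf X U\<^esub> h \<otimes>\<^bsub>sheaf X U\<^esub> (?p \<otimes>\<^bsub>sheaf X U\<^esub> g)"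
    using f gc by (simp add: minus_eq l_distr l_minus m_assoc)
  also have "\<dots> = \<zero>\<^bsub>sheaf X U\<^esub>"
    using Suc.prems f gc by (simp add: minus_eq r_neg)
  finally have "f \<otimes>\<^bsub>sheaf X U\<^esub> ?p \<ominus>\<^bsub>sheaf X U\<^esub> h \<otimes>\<^bsub>sheaf X U\<^esub> ?p = \<zero>\<^bsub>sheaf X U\<^esub>"
    by (rule local_equationD(4)[OF g, rotated]) (use f gc in auto)
  moreover have "f \<otimes>\<^bsub>sheaf X U\<^esub> ?p =
      (f \<otimes>\<^bsub>sheaf X U\<^esub> ?p \<ominus>\<^bsub>sheaf X U\<^esub> h \<otimes>\<^bsub>sheaf X U\<^esub> ?p) \<oplus>\<^bsub>sheaf X U\<^esub> h \<otimes>\<^bsub>sheaf X U\<^esub> ?p"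
    using f gc by (simp add: minus_eq a_assoc l_neg)
  ultimately have "f \<otimes>\<^bsub>sheaf X U\<^esub> ?p = h \<otimes>\<^bsub>sheaf X U\<^esub> ?p" using f gc by simp
  then show ?case by (rule Suc.IH)
qed

lemma res_power:
  assumes "openin (topo X) U" "openin (topo X) V" "V \<subseteq> U" "g \<in> carrier (sheaf X U)"
  shows "res X U V (g [^]\<^bsub>sheaf X U\<^esub> (i::nat)) = res X U V g [^]\<^bsub>sheaf X V\<^esub> i"
  by (rule ring_hom_ring.hom_nat_pow[OF ring_hom_ringI2[OF _ _ res_hom[OF assms(1-3)]] assms(4)])
    (use assms in \<open>auto intro: cring.axioms(1) cring_sheaf\<close>)

section \<open>The twisted sheaves L(-iD)\<close>

lemma twist_simps [simp]:
  "mres (twist X L D i) = mres L"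
  "smult (msec (twist X L D i) U) = smult (msec L U)"
  by (simp_all add: twist_def)

lemma twist_carrier:
  "\<sigma> \<in> carrier (msec (twist X L D i) U) \<longleftrightarrow> \<sigma> \<in> carrier (msec L U) \<and>
    (\<forall>x\<in>U. \<exists>V g. \<exists>\<tau>\<in>carrier (msec L V). x \<in> V \<and> V \<subseteq> U \<and> local_equation X D V g \<and>
      mres L U V \<sigma> = (g [^]\<^bsub>sheaf X V\<^esub> i) \<odot>\<^bsub>msec L V\<^esub> \<tau>)"
  by (simp add: twist_def)

lemma power_generates:
  assumes g: "local_equation X D U g" and e: "generator X L U e"
    and f: "f \<in> carrier (sheaf X U)"
  shows "f \<odot>\<^bsub>msec L U\<^esub> (g [^]\<^bsub>sheaf X U\<^esub> (i::nat) \<odot>\<^bsub>msec L U\<^esub> e) \<in> carrier (msec (twist X L D i) U)"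
proof -
  note U = generatorD[OF e]
  interpret cring "sheaf X U" by (rule cring_sheaf[OF U(1)])
  note gc = local_equationD(2)[OF g]
  have eq: "f \<odot>\<^bsub>msec L U\<^esub> (g [^]\<^bsub>sheaf X U\<^esub> i \<odot>\<^bsub>msec L U\<^esub> e) =
      g [^]\<^bsub>sheaf X U\<^esub> i \<odot>\<^bsub>msec L U\<^esub> (f \<odot>\<^bsub>msec L U\<^esub> e)"
    using f gc U by (simp add: smult_assoc[symmetric] m_comm)
  have fe: "f \<odot>\<^bsub>msec L U\<^esub> e \<in> carrier (msec L U)" by (rule smult_closed[OF U(1) f U(2)])
  have cl: "g [^]\<^bsub>sheaf X U\<^esub> i \<odot>\<^bsub>msec L U\<^esub> (f \<odot>\<^bsub>msec L U\<^esub> e) \<in> carrier (msec L U)"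
    using gc by (intro smult_closed[OF U(1) _ fe]) auto
  show ?thesis
    unfolding twist_carrier eq
    using cl fe g mres_id[OF U(1) cl] by (intro conjI ballI) auto
qed

text \<open>Intersects the domain on which \<open>g^i\<close> splits off with the domain of the
  given generator, so that the section has one coefficient divisible by \<open>g^i\<close>.\<close>

lemma twist_local:
  assumes \<sigma>: "\<sigma> \<in> carrier (msec (twist X L D i) U)" and U: "openin (topo X) U" "y \<in> U"
    and e: "generator X L U' e" "y \<in> U'"
  obtains W g f where "openin (topo X) W" "y \<in> W" "W \<subseteq> U" "W \<subseteq> U'" "local_equation X D W g"
    "f \<in> carrier (sheaf X W)"
    "mres L U W \<sigma> = (f \<otimes>\<^bsub>sheaf X W\<^esub> g [^]\<^bsub>sheaf X W\<^esub> i) \<odot>\<^bsub>msec L W\<^esub> mres L U' W e"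
proof -
  have \<sigma>c: "\<sigma> \<in> carrier (msec L U)" using \<sigma> by (simp add: twist_carrier)
  obtain V g \<tau> where V: "\<tau> \<in> carrier (msec L V)" "y \<in> V" "V \<subseteq> U" "local_equation X D V g"
    "mres L U V \<sigma> = (g [^]\<^bsub>sheaf X V\<^esub> i) \<odot>\<^bsub>msec L V\<^esub> \<tau>"
    using \<sigma> U(2) unfolding twist_carrier by blast
  note oV = local_equationD(1)[OF V(4)] and gV = local_equationD(2)[OF V(4)]
  let ?W = "V \<inter> U'"
  have W: "openin (topo X) ?W" "y \<in> ?W" using oV generatorD(1)[OF e(1)] V(2) e(2) by auto
  note eW = generator_res[OF e(1) W(1) Int_lower2] and gW = local_equation_res[OF V(4) W(1) Int_lower1]
  let ?g = "res X V ?W g" and ?e = "mres L U' ?W e"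
  interpret V: cring "sheaf X V" by (rule cring_sheaf[OF oV])
  interpret W: cring "sheaf X ?W" by (rule cring_sheaf[OF W(1)])
  have gWc: "?g \<in> carrier (sheaf X ?W)" by (rule local_equationD(2)[OF gW])
  obtain f where f: "f \<in> carrier (sheaf X ?W)" "mres L V ?W \<tau> = f \<odot>\<^bsub>msec L ?W\<^esub> ?e"
    using generator_obtain[OF eW mres_closed[OF oV W(1) Int_lower1 V(1)]] .
  have "mres L U ?W \<sigma> = mres L V ?W (mres L U V \<sigma>)"
    by (rule mres_mres[OF U(1) oV W(1) Int_lower1 V(3) \<sigma>c, symmetric])
  also have "\<dots> = ?g [^]\<^bsub>sheaf X ?W\<^esub> i \<odot>\<^bsub>msec L ?W\<^esub> (f \<odot>\<^bsub>msec L ?W\<^esub> ?e)"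
    unfolding V(5) f(2)[symmetric] res_power[OF oV W(1) Int_lower1 gV, symmetric]
    using gV by (intro mres_smult[OF oV W(1) Int_lower1 _ V(1)]) auto
  also have "\<dots> = (?g [^]\<^bsub>sheaf X ?W\<^esub> i \<otimes>\<^bsub>sheaf X ?W\<^esub> f) \<odot>\<^bsub>msec L ?W\<^esub> ?e"
    using gWc f(1) generatorD(2)[OF eW] by (intro smult_assoc[OF W(1), symmetric]) auto
  also have "?g [^]\<^bsub>sheaf X ?W\<^esub> i \<otimes>\<^bsub>sheaf X ?W\<^esub> f = f \<otimes>\<^bsub>sheaf X ?W\<^esub> ?g [^]\<^bsub>sheaf X ?W\<^esub> i"
    using gWc f(1) by (intro W.m_comm) auto
  finally have eq: "mres L U ?W \<sigma> = (f \<otimes>\<^bsub>sheaf X ?W\<^esub> ?g [^]\<^bsub>sheaf X ?W\<^esub> i) \<odot>\<^bsub>msec L ?W\<^esub> ?e" .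
  show ?thesis by (rule that[OF W _ Int_lower2 gW f(1) eq]) (use V(3) in blast)
qed

text \<open>Membership in \<open>L(-iD)\<close> is local and may use a different equation at each
  point. For the fixed \<open>g\<close> the local quotients by \<open>g^i\<close> are unique, as
  \<open>g\<close> is a nonzerodivisor, and therefore glue.\<close>

lemma power_generates_all:
  assumes g: "local_equation X D U g" and e: "generator X L U e"
    and \<sigma>: "\<sigma> \<in> carrier (msec (twist X L D i) U)"
  obtains m where "m \<in> carrier (sheaf X U)" "\<sigma> = (m \<otimes>\<^bsub>sheaf X U\<^esub> g [^]\<^bsub>sheaf X U\<^esub> (i::nat)) \<odot>\<^bsub>msec L U\<^esub> e"
proof -
  note U = generatorD[OF e]
  interpret U: cring "sheaf X U" by (rule cring_sheaf[OF U(1)])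
  note gc = local_equationD(2)[OF g]
  have \<sigma>c: "\<sigma> \<in> carrier (msec L U)" using \<sigma> by (simp add: twist_carrier)
  obtain h where h: "h \<in> carrier (sheaf X U)" "\<sigma> = h \<odot>\<^bsub>msec L U\<^esub> e"
    using generator_obtain[OF e \<sigma>c] .
  let ?P = "\<lambda>W m. m \<in> carrier (sheaf X W) \<and>
    res X U W h = m \<otimes>\<^bsub>sheaf X W\<^esub> res X U W g [^]\<^bsub>sheaf X W\<^esub> i"
  define C where "C = {W. openin (topo X) W \<and> W \<subseteq> U \<and> (\<exists>m. ?P W m)}"
  define s where "s W = (SOME m. ?P W m)" for W
  have s: "openin (topo X) W" "W \<subseteq> U" "?P W (s W)" if "W \<in> C" for W
  proof -
    show "openin (topo X) W" "W \<subseteq> U" using that by (auto simp: C_def)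
    have "\<exists>m. ?P W m" using that by (simp add: C_def)
    then show "?P W (s W)" unfolding s_def by (rule someI_ex)
  qed
  have un: "\<Union>C = U"
  proof
    show "\<Union>C \<subseteq> U" by (auto simp: C_def)
    show "U \<subseteq> \<Union>C"
    proof
      fix y assume y: "y \<in> U"
      obtain V g' k where oV: "openin (topo X) V" and V: "y \<in> V" "V \<subseteq> U" "local_equation X D V g'"
        and k: "k \<in> carrier (sheaf X V)"
        and eq: "mres L U V \<sigma> = (k \<otimes>\<^bsub>sheaf X V\<^esub> g' [^]\<^bsub>sheaf X V\<^esub> i) \<odot>\<^bsub>msec L V\<^esub> mres L U V e"
        by (rule twist_local[OF \<sigma> U(1) y e y]) (rule that)
      note g'c = local_equationD(2)[OF V(3)]
      interpret V: cring "sheaf X V" by (rule cring_sheaf[OF oV])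
      note eV = generator_res[OF e oV V(2)]
      \<comment> \<open>Equations of the same divisor are multiples of each other, so a factor
        \<open>g'^i\<close> can be replaced by \<open>g^i\<close>.\<close>
      obtain a where a: "a \<in> carrier (sheaf X V)" "g' = a \<otimes>\<^bsub>sheaf X V\<^esub> res X U V g"
        using local_equation_multiple[OF local_equation_res[OF g oV V(2)] V(3)] .
      have rg: "res X U V g \<in> carrier (sheaf X V)" by (rule res_closed[OF U(1) oV V(2) gc])
      have "res X U V h \<odot>\<^bsub>msec L V\<^esub> mres L U V e = mres L U V \<sigma>"
        unfolding h(2) by (rule mres_smult[OF U(1) oV V(2) h(1) U(2), symmetric])
      then have "res X U V h = k \<otimes>\<^bsub>sheaf X V\<^esub> g' [^]\<^bsub>sheaf X V\<^esub> i"
        using g'c k h(1) res_closed[OF U(1) oV V(2)] unfolding eq by (intro generator_cancel[OF eV]) auto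
      also have "\<dots> = (k \<otimes>\<^bsub>sheaf X V\<^esub> a [^]\<^bsub>sheaf X V\<^esub> i) \<otimes>\<^bsub>sheaf X V\<^esub> res X U V g [^]\<^bsub>sheaf X V\<^esub> i"
        unfolding a(2) V.nat_pow_distrib[OF a(1) rg] using k a(1) rg by (simp add: V.m_assoc)
      finally have "V \<in> C" unfolding C_def using oV V(2) k a(1) by blast
      then show "y \<in> \<Union>C" using V(1) by blast
    qed
  qed
  \<comment> \<open>Both local quotients become \<open>h\<close> after multiplication by
    \<open>g^i\<close>, which can be cancelled on the overlap.\<close>
  have "res X V (V \<inter> W) (s V) = res X W (V \<inter> W) (s W)" if V: "V \<in> C" and W: "W \<in> C" for V W
  proof -
    let ?W = "V \<inter> W"
    have o: "openin (topo X) ?W" "?W \<subseteq> U" using s V W by blast+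
    have rg: "res X U ?W g \<in> carrier (sheaf X ?W)" by (rule res_closed[OF U(1) o gc])
    have *: "res X U ?W h = res X V' ?W (s V') \<otimes>\<^bsub>sheaf X ?W\<^esub> res X U ?W g [^]\<^bsub>sheaf X ?W\<^esub> i"
      if V': "V' \<in> C" "?W \<subseteq> V'" for V'
    proof -
      note s' = s[OF V'(1)]
      interpret V': cring "sheaf X V'" by (rule cring_sheaf[OF s'(1)])
      have rg': "res X U V' g \<in> carrier (sheaf X V')" by (rule res_closed[OF U(1) s'(1,2) gc])
      have "res X U ?W h = res X V' ?W (res X U V' h)"
        by (rule res_res[OF U(1) s'(1) o(1) V'(2) s'(2) h(1), symmetric])
      also have "\<dots> = res X V' ?W (s V') \<otimes>\<^bsub>sheaf X ?W\<^esub> res X V' ?W (res X U V' g [^]\<^bsub>sheaf X V'\<^esub> i)"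
        using s'(3) rg' ring_hom_mult[OF res_hom[OF s'(1) o(1) V'(2)]] by simp
      also have "res X V' ?W (res X U V' g [^]\<^bsub>sheaf X V'\<^esub> i) = res X U ?W g [^]\<^bsub>sheaf X ?W\<^esub> i"
        unfolding res_power[OF s'(1) o(1) V'(2) rg'] res_res[OF U(1) s'(1) o(1) V'(2) s'(2) gc] ..
      finally show ?thesis .
    qed
    show ?thesis
    proof (rule local_equation_cancel_power[OF local_equation_res[OF g o]])
      show "res X V ?W (s V) \<in> carrier (sheaf X ?W)" "res X W ?W (s W) \<in> carrier (sheaf X ?W)"
        using s[OF V] s[OF W] o(1) by (auto intro: res_closed)
      show "res X V ?W (s V) \<otimes>\<^bsub>sheaf X ?W\<^esub> res X U ?W g [^]\<^bsub>sheaf X ?W\<^esub> i =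
          res X W ?W (s W) \<otimes>\<^bsub>sheaf X ?W\<^esub> res X U ?W g [^]\<^bsub>sheaf X ?W\<^esub> i"
        using *[OF V] *[OF W] by simp
    qed
  qed
  note agree = this
  have "\<And>V. V \<in> C \<Longrightarrow> openin (topo X) V \<and> s V \<in> carrier (sheaf X V)" using s by blast
  from function_glue[of C s, OF this agree] obtain m
    where m: "m \<in> carrier (sheaf X U)" "\<And>W. W \<in> C \<Longrightarrow> res X U W m = s W"
    unfolding un by blast
  have "h = m \<otimes>\<^bsub>sheaf X U\<^esub> g [^]\<^bsub>sheaf X U\<^esub> i"
  proof (rule function_eqI[of C, unfolded un])
    fix W assume W: "W \<in> C"
    note sW = s[OF W]
    show "openin (topo X) W" by (rule sW)
    show "res X U W h = res X U W (m \<otimes>\<^bsub>sheaf X U\<^esub> g [^]\<^bsub>sheaf X U\<^esub> i)"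
      using sW m(1) gc m(2)[OF W] ring_hom_mult[OF res_hom[OF U(1) sW(1,2)]]
        res_power[OF U(1) sW(1,2) gc] by simp
  qed (use h(1) m(1) gc in auto)
  then show ?thesis using that m(1) h(2) by blast
qed

text \<open>Cancellation of \<open>g^i\<close> gives injectivity and
  \<open>power_generates_all\<close> surjectivity. Vanishing of a section of \<open>L(-iD)\<close>
  on a subscheme can thus be tested on its coefficient with respect to \<open>g^i e\<close>.\<close>

lemma twist_generator:
  assumes g: "local_equation X D U g" and e: "generator X L U e"
  shows "generator X (twist X L D i) U (g [^]\<^bsub>sheaf X U\<^esub> i \<odot>\<^bsub>msec L U\<^esub> e)"
  unfolding generator_def twist_simps
proof (intro conjI allI impI)
  note U = generatorD[OF e]
  note gc = local_equationD(2)[OF g]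
  interpret U: cring "sheaf X U" by (rule cring_sheaf[OF U(1)])
  show "openin (topo X) U" by (rule U)
  have "\<one>\<^bsub>sheaf X U\<^esub> \<odot>\<^bsub>msec L U\<^esub> (g [^]\<^bsub>sheaf X U\<^esub> i \<odot>\<^bsub>msec L U\<^esub> e) = g [^]\<^bsub>sheaf X U\<^esub> i \<odot>\<^bsub>msec L U\<^esub> e"
    using gc U by (intro module.smult_one[OF module_L] smult_closed) auto
  then show "g [^]\<^bsub>sheaf X U\<^esub> i \<odot>\<^bsub>msec L U\<^esub> e \<in> carrier (msec (twist X L D i) U)"
    using power_generates[OF g e U.one_closed, of i] by simp
  fix V assume "openin (topo X) V \<and> V \<subseteq> U"
  then have V: "openin (topo X) V" "V \<subseteq> U" by auto
  interpret V: cring "sheaf X V" by (rule cring_sheaf[OF V(1)])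
  note gV = local_equation_res[OF g V] and eV = generator_res[OF e V]
  let ?g = "res X U V g" and ?e = "mres L U V e"
  have gVc: "?g \<in> carrier (sheaf X V)" and eVc: "?e \<in> carrier (msec L V)"
    using local_equationD(2)[OF gV] generatorD(2)[OF eV] by auto
  have eq: "mres L U V (g [^]\<^bsub>sheaf X U\<^esub> i \<odot>\<^bsub>msec L U\<^esub> e) = ?g [^]\<^bsub>sheaf X V\<^esub> i \<odot>\<^bsub>msec L V\<^esub> ?e"
    using mres_smult[OF U(1) V _ U(2)] gc by (simp add: res_power[OF U(1) V gc])
  have assoc: "f \<odot>\<^bsub>msec L V\<^esub> (?g [^]\<^bsub>sheaf X V\<^esub> i \<odot>\<^bsub>msec L V\<^esub> ?e) = (f \<otimes>\<^bsub>sheaf X V\<^esub> ?g [^]\<^bsub>sheaf X V\<^esub> i) \<odot>\<^bsub>msec L V\<^esub> ?e"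
    if "f \<in> carrier (sheaf X V)" for f
    using that gVc eVc by (intro smult_assoc[OF V(1), symmetric]) auto
  show "bij_betw (\<lambda>f. f \<odot>\<^bsub>msec L V\<^esub> mres L U V (g [^]\<^bsub>sheaf X U\<^esub> i \<odot>\<^bsub>msec L U\<^esub> e))
      (carrier (sheaf X V)) (carrier (msec (twist X L D i) V))"
    unfolding eq
  proof (rule bij_betw_imageI)
    show "inj_on (\<lambda>f. f \<odot>\<^bsub>msec L V\<^esub> (?g [^]\<^bsub>sheaf X V\<^esub> i \<odot>\<^bsub>msec L V\<^esub> ?e)) (carrier (sheaf X V))"
    proof (rule inj_onI)
      fix f h assume f: "f \<in> carrier (sheaf X V)" and h: "h \<in> carrier (sheaf X V)"
        and fh: "f \<odot>\<^bsub>msec L V\<^esub> (?g [^]\<^bsub>sheaf X V\<^esub> i \<odot>\<^bsub>msec L V\<^esub> ?e) =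
          h \<odot>\<^bsub>msec L V\<^esub> (?g [^]\<^bsub>sheaf X V\<^esub> i \<odot>\<^bsub>msec L V\<^esub> ?e)"
      have "f \<otimes>\<^bsub>sheaf X V\<^esub> ?g [^]\<^bsub>sheaf X V\<^esub> i = h \<otimes>\<^bsub>sheaf X V\<^esub> ?g [^]\<^bsub>sheaf X V\<^esub> i"
        using fh f h gVc unfolding assoc[OF f] assoc[OF h] by (intro generator_cancel[OF eV]) auto
      then show "f = h" by (rule local_equation_cancel_power[OF gV f h])
    qed
    show "(\<lambda>f. f \<odot>\<^bsub>msec L V\<^esub> (?g [^]\<^bsub>sheaf X V\<^esub> i \<odot>\<^bsub>msec L V\<^esub> ?e)) ` carrier (sheaf X V) =
        carrier (msec (twist X L D i) V)"
    proof (intro subset_antisym subsetI)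
      fix \<sigma> assume "\<sigma> \<in> carrier (msec (twist X L D i) V)"
      from power_generates_all[OF gV eV this] obtain m where "m \<in> carrier (sheaf X V)"
        "\<sigma> = (m \<otimes>\<^bsub>sheaf X V\<^esub> ?g [^]\<^bsub>sheaf X V\<^esub> i) \<odot>\<^bsub>msec L V\<^esub> ?e" .
      then show "\<sigma> \<in> (\<lambda>f. f \<odot>\<^bsub>msec L V\<^esub> (?g [^]\<^bsub>sheaf X V\<^esub> i \<odot>\<^bsub>msec L V\<^esub> ?e)) ` carrier (sheaf X V)"
        using assoc by auto
    qed (use power_generates[OF gV eV] in blast)
  qed
qed

end

text \<open>The staircase of \<open>x_1^i I^T\<close>: \<open>i\<close> full layers below a shifted
  copy of \<open>T\<close>.\<close>

definition raise :: "nat \<Rightarrow> (nat \<Rightarrow> nat) set \<Rightarrow> (nat \<Rightarrow> nat) set" where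
  "raise i T = {e. e 1 < i \<or> e(1 := e 1 - i) \<in> T}"

lemma raise_down_closed:
  assumes "down_closed T" shows "down_closed (raise i T)"
  unfolding down_closed_def
proof (intro ballI allI impI)
  fix e a assume e: "e \<in> raise i T" and le: "\<forall>l. a l \<le> e l"
  show "a \<in> raise i T"
  proof (cases "a 1 < i")
    case False
    then have "e(1 := e 1 - i) \<in> T" using e le[rule_format, of 1] by (auto simp: raise_def)
    moreover have "\<forall>l. (a(1 := a 1 - i)) l \<le> (e(1 := e 1 - i)) l" using le by (simp add: diff_le_mono)
    ultimately show ?thesis using assms unfolding down_closed_def raise_def by blast
  qed (simp add: raise_def)
qed

section \<open>Series of global sections at a formal point\<close>

locale formal_bundle = formal_point X d x \<phi> + line_bundle X L
  for X :: "('k::field, 'p, 'f) kspace" and d x \<phi> and L :: "('p, 'f, 'l) msheaf" +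
  fixes U0 :: "'p set" and e0 :: 'l
  assumes gen0: "generator X L U0 e0" and xU0: "x \<in> U0" and d: "1 \<le> d"
begin

interpretation R: cring "pser {1..d} :: 'k series ring"
  by (rule pser_cring) simp

definition coord :: "'l \<Rightarrow> 'f" where
  "coord \<sigma> = (THE f. f \<in> carrier (sheaf X U0) \<and> mres L (pts X) U0 \<sigma> = f \<odot>\<^bsub>msec L U0\<^esub> e0)"

text \<open>The series of a global section in the fixed trivialization; all local conditions at the
  point are expressed through this \<open>k\<close>-linear map.\<close>

definition \<theta> :: "'l \<Rightarrow> 'k series" where
  "\<theta> \<sigma> = ex U0 (coord \<sigma>)"

lemma U0: "openin (topo X) U0" "U0 \<subseteq> pts X" "e0 \<in> carrier (msec L U0)" and pts_open: "openin (topo X) (pts X)"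
  using generatorD[OF gen0] openin_subset by auto

lemma coord:
  assumes "\<sigma> \<in> carrier (msec L (pts X))"
  shows "coord \<sigma> \<in> carrier (sheaf X U0)" "mres L (pts X) U0 \<sigma> = coord \<sigma> \<odot>\<^bsub>msec L U0\<^esub> e0"
proof -
  have "mres L (pts X) U0 \<sigma> \<in> carrier (msec L U0)" by (rule mres_closed[OF pts_open U0(1,2) assms])
  then obtain f where f: "f \<in> carrier (sheaf X U0)" "mres L (pts X) U0 \<sigma> = f \<odot>\<^bsub>msec L U0\<^esub> e0"
    by (rule generator_obtain[OF gen0])
  have "coord \<sigma> = f"
    unfolding coord_def
  proof (rule the_equality)
    fix h assume "h \<in> carrier (sheaf X U0) \<and> mres L (pts X) U0 \<sigma> = h \<odot>\<^bsub>msec L U0\<^esub> e0"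
    then show "h = f" using f generator_cancel[OF gen0, of h f] by simp
  qed (use f in auto)
  then show "coord \<sigma> \<in> carrier (sheaf X U0)" "mres L (pts X) U0 \<sigma> = coord \<sigma> \<odot>\<^bsub>msec L U0\<^esub> e0"
    using f by auto
qed

lemma coord_eqI:
  assumes "\<sigma> \<in> carrier (msec L (pts X))" "f \<in> carrier (sheaf X U0)"
    "mres L (pts X) U0 \<sigma> = f \<odot>\<^bsub>msec L U0\<^esub> e0"
  shows "coord \<sigma> = f"
  using generator_cancel[OF gen0 coord(1)[OF assms(1)] assms(2)] coord(2)[OF assms(1)] assms(3) by simp

lemma \<theta>_closed: "\<sigma> \<in> carrier (msec L (pts X)) \<Longrightarrow> \<theta> \<sigma> \<in> carrier (pser {1..d})"
  unfolding \<theta>_def using ring_hom_closed[OF ex_hom[OF U0(1) xU0]] coord(1) by blast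

lemma \<theta>_add:
  assumes "\<sigma> \<in> carrier (msec L (pts X))" "\<tau> \<in> carrier (msec L (pts X))"
  shows "\<theta> (\<sigma> \<oplus>\<^bsub>msec L (pts X)\<^esub> \<tau>) = (\<lambda>a. \<theta> \<sigma> a + \<theta> \<tau> a)"
proof -
  interpret M: module "sheaf X (pts X)" "msec L (pts X)" by (rule module_L[OF pts_open])
  interpret N: module "sheaf X U0" "msec L U0" by (rule module_L[OF U0(1)])
  have "coord (\<sigma> \<oplus>\<^bsub>msec L (pts X)\<^esub> \<tau>) = coord \<sigma> \<oplus>\<^bsub>sheaf X U0\<^esub> coord \<tau>"
    using coord[OF assms(1)] coord[OF assms(2)] assms U0
    by (intro coord_eqI) (auto simp: mres_add[OF pts_open U0(1,2)] N.smult_l_distr)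
  then show ?thesis
    using ring_hom_add[OF ex_hom[OF U0(1) xU0]] coord(1) assms by (simp add: \<theta>_def)
qed

lemma kscale_closed:
  "\<sigma> \<in> carrier (msec L (pts X)) \<Longrightarrow> kscale X L c \<sigma> \<in> carrier (msec L (pts X))"
  unfolding kscale_def by (rule smult_closed[OF pts_open kstr_closed])

lemma \<theta>_kscale:
  assumes \<sigma>: "\<sigma> \<in> carrier (msec L (pts X))"
  shows "\<theta> (kscale X L c \<sigma>) = (\<lambda>a. c * \<theta> \<sigma> a)"
proof -
  interpret U0: cring "sheaf X U0" by (rule cring_sheaf[OF U0(1)])
  let ?c = "res X (pts X) U0 (kstr X c)"
  have c: "?c \<in> carrier (sheaf X U0)" by (rule res_closed[OF pts_open U0(1,2) kstr_closed])
  have "mres L (pts X) U0 (kscale X L c \<sigma>) = ?c \<odot>\<^bsub>msec L U0\<^esub> (coord \<sigma> \<odot>\<^bsub>msec L U0\<^esub> e0)"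
    unfolding kscale_def coord(2)[OF \<sigma>, symmetric]
    by (rule mres_smult[OF pts_open U0(1,2) kstr_closed \<sigma>])
  also have "\<dots> = (?c \<otimes>\<^bsub>sheaf X U0\<^esub> coord \<sigma>) \<odot>\<^bsub>msec L U0\<^esub> e0"
    using smult_assoc[OF U0(1) c coord(1)[OF \<sigma>] U0(3)] by simp
  finally have "coord (kscale X L c \<sigma>) = ?c \<otimes>\<^bsub>sheaf X U0\<^esub> coord \<sigma>"
    using c coord(1)[OF \<sigma>] by (intro coord_eqI kscale_closed[OF \<sigma>]) auto
  then have "\<theta> (kscale X L c \<sigma>) = conv (ex U0 ?c) (\<theta> \<sigma>)"
    using ring_hom_mult[OF ex_hom[OF U0(1) xU0] c coord(1)[OF \<sigma>]] by (simp add: \<theta>_def)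
  also have "ex U0 ?c = cst c" using ex_res[OF pts_open U0(1) xU0 U0(2) kstr_closed] ex_kstr by simp
  finally show ?thesis using conv_cst[OF _ \<theta>_closed[OF \<sigma>]] by simp
qed

lemma ex_closed: "openin (topo X) U \<Longrightarrow> x \<in> U \<Longrightarrow> f \<in> carrier (sheaf X U) \<Longrightarrow> ex U f \<in> carrier (pser {1..d})"
  using ring_hom_closed[OF ex_hom] .

text \<open>The multiplier is the series of the transition function between the generators. It is
  the same for every section, so it applies to all coefficients of a family at once.\<close>

lemma change_of_generator:
  assumes e: "generator X L U e" "x \<in> U" and e': "generator X L U' e'" "x \<in> U'"
  obtains u where "u \<in> carrier (pser {1..d})"
    "\<And>\<sigma> f f'. \<sigma> \<in> carrier (msec L (pts X)) \<Longrightarrow> f \<in> carrier (sheaf X U) \<Longrightarrow>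
      f' \<in> carrier (sheaf X U') \<Longrightarrow> mres L (pts X) U \<sigma> = f \<odot>\<^bsub>msec L U\<^esub> e \<Longrightarrow>
      mres L (pts X) U' \<sigma> = f' \<odot>\<^bsub>msec L U'\<^esub> e' \<Longrightarrow> ex U' f' = conv u (ex U f)"
proof -
  let ?W = "U \<inter> U'"
  note U = generatorD[OF e(1)] and U' = generatorD[OF e'(1)]
  have W: "openin (topo X) ?W" "x \<in> ?W" using U U' e e' by auto
  have sub: "U \<subseteq> pts X" "U' \<subseteq> pts X" "?W \<subseteq> pts X" using openin_subset U U' by blast+
  interpret W: cring "sheaf X ?W" by (rule cring_sheaf[OF W(1)])
  note eW = generator_res[OF e(1) W(1) Int_lower1] and eW' = generator_res[OF e'(1) W(1) Int_lower2]
  obtain u where u: "u \<in> carrier (sheaf X ?W)" "mres L U ?W e = u \<odot>\<^bsub>msec L ?W\<^esub> mres L U' ?W e'"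
    using generator_obtain[OF eW' generatorD(2)[OF eW]] .
  show ?thesis
  proof (rule that)
    show "ex ?W u \<in> carrier (pser {1..d})" by (rule ex_closed[OF W u(1)])
    fix \<sigma> f f' assume \<sigma>: "\<sigma> \<in> carrier (msec L (pts X))"
      and f: "f \<in> carrier (sheaf X U)" and f': "f' \<in> carrier (sheaf X U')"
      and eq: "mres L (pts X) U \<sigma> = f \<odot>\<^bsub>msec L U\<^esub> e"
      and eq': "mres L (pts X) U' \<sigma> = f' \<odot>\<^bsub>msec L U'\<^esub> e'"
    have fW: "res X U ?W f \<in> carrier (sheaf X ?W)" "res X U' ?W f' \<in> carrier (sheaf X ?W)"
      using f f' U U' W by (auto intro: res_closed)
    have "res X U' ?W f' \<odot>\<^bsub>msec L ?W\<^esub> mres L U' ?W e' = mres L U' ?W (mres L (pts X) U' \<sigma>)"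
      unfolding eq' by (rule mres_smult[OF U'(1) W(1) Int_lower2 f' U'(2), symmetric])
    also have "\<dots> = mres L U ?W (mres L (pts X) U \<sigma>)"
      unfolding mres_mres[OF pts_open U'(1) W(1) Int_lower2 sub(2) \<sigma>]
        mres_mres[OF pts_open U(1) W(1) Int_lower1 sub(1) \<sigma>] ..
    also have "\<dots> = res X U ?W f \<odot>\<^bsub>msec L ?W\<^esub> mres L U ?W e"
      unfolding eq by (rule mres_smult[OF U(1) W(1) Int_lower1 f U(2)])
    also have "\<dots> = (res X U ?W f \<otimes>\<^bsub>sheaf X ?W\<^esub> u) \<odot>\<^bsub>msec L ?W\<^esub> mres L U' ?W e'"
      unfolding u(2) by (rule smult_assoc[OF W(1) fW(1) u(1) generatorD(2)[OF eW'], symmetric])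
    finally have "res X U' ?W f' = res X U ?W f \<otimes>\<^bsub>sheaf X ?W\<^esub> u"
      using fW u(1) by (intro generator_cancel[OF eW']) auto
    then have "ex ?W (res X U' ?W f') = conv (ex ?W (res X U ?W f)) (ex ?W u)"
      using ring_hom_mult[OF ex_hom[OF W] fW(1) u(1)] by simp
    then show "ex U' f' = conv (ex ?W u) (ex U f)"
      using ex_res[OF U(1) W(1,2) Int_lower1 f] ex_res[OF U'(1) W(1,2) Int_lower2 f']
      by (simp add: conv_commute)
  qed
qed

lemma ex_power:
  assumes "openin (topo X) U" "x \<in> U" "g \<in> carrier (sheaf X U)"
  shows "ex U (g [^]\<^bsub>sheaf X U\<^esub> (i::nat)) = ex U g [^]\<^bsub>pser {1..d}\<^esub> i"
  by (rule ring_hom_ring.hom_nat_pow[OF ring_hom_ringI2[OF cring.axioms(1)[OF cring_sheaf[OF assms(1)]]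
        R.ring_axioms ex_hom[OF assms(1,2)]] assms(3)])

lemma local_equation_expansions:
  assumes g: "local_equation X D U g" "x \<in> U" and g': "local_equation X D U' g'" "x \<in> U'"
  obtains a where "a \<in> carrier (pser {1..d})" "ex U' g' = conv a (ex U g)"
proof -
  let ?W = "U \<inter> U'"
  note U = local_equationD[OF g(1)] and U' = local_equationD[OF g'(1)]
  have W: "openin (topo X) ?W" "x \<in> ?W" using U U' g g' by auto
  obtain a where a: "a \<in> carrier (sheaf X ?W)" "res X U' ?W g' = a \<otimes>\<^bsub>sheaf X ?W\<^esub> res X U ?W g"
    using local_equation_multiple[OF local_equation_res[OF g(1) W(1) Int_lower1]
        local_equation_res[OF g'(1) W(1) Int_lower2]] .
  have "ex ?W (res X U' ?W g') = conv (ex ?W a) (ex ?W (res X U ?W g))"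
    unfolding a(2) using ring_hom_mult[OF ex_hom[OF W] a(1) res_closed[OF U(1) W(1) Int_lower1 U(2)]] by simp
  then show ?thesis
    using that[OF ex_closed[OF W a(1)]] ex_res[OF U(1) W(1,2) Int_lower1 U(2)]
      ex_res[OF U'(1) W(1,2) Int_lower2 U'(2)] by simp
qed

context
  fixes D :: "'p set \<Rightarrow> 'f set"
  assumes compat: "compatible X d D x \<phi>"
begin

text \<open>Compatibility supplies one equation whose series generates \<open>(x_1)\<close>; every
  other equation is a multiple of it and conversely, and the expansions inherit the factors.\<close>

lemma local_equation_x1:
  assumes g: "local_equation X D U g" "x \<in> U"
  shows "\<exists>a\<in>carrier (pser {1..d}). ex U g = conv a (xvar 1)"
    "\<exists>a\<in>carrier (pser {1..d}). xvar 1 = conv a (ex U g)"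
proof -
  obtain V h where h: "x \<in> V" "local_equation X D V h"
    "cgenideal (pser {1..d}) (ex V h) = cgenideal (pser {1..d}) (xvar 1 :: 'k series)"
    using compat by (auto simp: compatible_def)
  note V = local_equationD[OF h(2)] and U = local_equationD[OF g(1)]
  have hV: "ex V h \<in> carrier (pser {1..d})" by (rule ex_closed[OF V(1) h(1) V(2)])
  have gU: "ex U g \<in> carrier (pser {1..d})" by (rule ex_closed[OF U(1) g(2) U(2)])
  have xc: "(xvar 1 :: 'k series) \<in> carrier (pser {1..d})" using d by (intro xvar_closed) simp
  have "ex V h \<in> cgenideal (pser {1..d}) (xvar 1)" using R.cgenideal_self[OF hV] h(3) by simp
  then obtain b where b: "b \<in> carrier (pser {1..d})" "ex V h = conv b (xvar 1)"
    by (auto simp: cgenideal_def)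
  have "xvar 1 \<in> cgenideal (pser {1..d}) (ex V h)" using R.cgenideal_self[OF xc] h(3) by simp
  then obtain b' where b': "b' \<in> carrier (pser {1..d})" "xvar 1 = conv b' (ex V h)"
    by (auto simp: cgenideal_def)
  obtain a where a: "a \<in> carrier (pser {1..d})" "ex U g = conv a (ex V h)"
    by (rule local_equation_expansions[OF h(2,1) g])
  obtain a' where a': "a' \<in> carrier (pser {1..d})" "ex V h = conv a' (ex U g)"
    by (rule local_equation_expansions[OF g h(2,1)])
  show "\<exists>a\<in>carrier (pser {1..d}). ex U g = conv a (xvar 1)"
    using a b xc by (intro bexI[of _ "conv a b"]) (auto simp: conv_assoc[of "{1..d}"] intro: conv_closed)
  show "\<exists>a\<in>carrier (pser {1..d}). xvar 1 = conv a (ex U g)"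
    using a' b' gU by (intro bexI[of _ "conv b' a'"]) (auto simp: conv_assoc[of "{1..d}"] intro: conv_closed)
qed

lemma \<theta>_vanish_system_div:
  assumes \<sigma>: "\<sigma> \<in> carrier (msec (twist X L D i) (pts X))" and e: "e 1 < i"
  shows "\<theta> \<sigma> e = 0"
proof -
  have \<sigma>c: "\<sigma> \<in> carrier (msec L (pts X))" using \<sigma> by (simp add: twist_carrier)
  obtain W g f where W: "openin (topo X) W" "x \<in> W" "W \<subseteq> pts X" "W \<subseteq> U0" and gW: "local_equation X D W g"
    and f: "f \<in> carrier (sheaf X W)"
    and eq: "mres L (pts X) W \<sigma> = (f \<otimes>\<^bsub>sheaf X W\<^esub> g [^]\<^bsub>sheaf X W\<^esub> i) \<odot>\<^bsub>msec L W\<^esub> mres L U0 W e0"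
    by (rule twist_local[OF \<sigma> pts_open x gen0 xU0]) (rule that)
  note eW = generator_res[OF gen0 W(1,4)] and gWc = local_equationD(2)[OF gW]
  interpret W: cring "sheaf X W" by (rule cring_sheaf[OF W(1)])
  have "res X U0 W (coord \<sigma>) \<odot>\<^bsub>msec L W\<^esub> mres L U0 W e0 = mres L U0 W (mres L (pts X) U0 \<sigma>)"
    unfolding coord(2)[OF \<sigma>c] by (rule mres_smult[OF U0(1) W(1,4) coord(1)[OF \<sigma>c] U0(3), symmetric])
  also have "\<dots> = (f \<otimes>\<^bsub>sheaf X W\<^esub> g [^]\<^bsub>sheaf X W\<^esub> i) \<odot>\<^bsub>msec L W\<^esub> mres L U0 W e0"
    unfolding mres_mres[OF pts_open U0(1) W(1,4) U0(2) \<sigma>c] by (rule eq)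
  finally have *: "res X U0 W (coord \<sigma>) = f \<otimes>\<^bsub>sheaf X W\<^esub> g [^]\<^bsub>sheaf X W\<^esub> i"
    using gWc f res_closed[OF U0(1) W(1,4) coord(1)[OF \<sigma>c]] by (intro generator_cancel[OF eW]) auto
  obtain a where a: "a \<in> carrier (pser {1..d})" "ex W g = conv a (xvar 1)"
    using local_equation_x1(1)[OF gW W(2)] by blast
  have xc: "(xvar 1 :: 'k series) \<in> carrier (pser {1..d})" using d by (intro xvar_closed) simp
  have fc: "ex W f \<in> carrier (pser {1..d})" by (rule ex_closed[OF W(1,2) f])
  have "\<theta> \<sigma> = ex W (res X U0 W (coord \<sigma>))"
    unfolding \<theta>_def by (rule ex_res[OF U0(1) W(1,2,4) coord(1)[OF \<sigma>c], symmetric])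
  also have "\<dots> = ex W f \<otimes>\<^bsub>pser {1..d}\<^esub> ex W g [^]\<^bsub>pser {1..d}\<^esub> i"
    unfolding * ex_power[OF W(1,2) gWc, symmetric]
    using gWc f by (intro ring_hom_mult[OF ex_hom[OF W(1,2)]]) auto
  also have "ex W g [^]\<^bsub>pser {1..d}\<^esub> i = a [^]\<^bsub>pser {1..d}\<^esub> i \<otimes>\<^bsub>pser {1..d}\<^esub> xvar 1 [^]\<^bsub>pser {1..d}\<^esub> i"
    unfolding a(2) using R.nat_pow_distrib[OF a(1) xc] by simp
  also have "ex W f \<otimes>\<^bsub>pser {1..d}\<^esub> (a [^]\<^bsub>pser {1..d}\<^esub> i \<otimes>\<^bsub>pser {1..d}\<^esub> xvar 1 [^]\<^bsub>pser {1..d}\<^esub> i) =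
      xvar 1 [^]\<^bsub>pser {1..d}\<^esub> i \<otimes>\<^bsub>pser {1..d}\<^esub> (a [^]\<^bsub>pser {1..d}\<^esub> i \<otimes>\<^bsub>pser {1..d}\<^esub> ex W f)"
    using a(1) xc fc by (simp del: pser_simps One_nat_def add: R.m_assoc R.m_comm R.m_lcomm)
  finally show ?thesis
    using pow_xvar_conv[of "{1..d}" "a [^]\<^bsub>pser {1..d}\<^esub> i \<otimes>\<^bsub>pser {1..d}\<^esub> ex W f" 1 i e] e d
      R.m_closed[OF R.nat_pow_closed[OF a(1)] fc] by simp
qed

text \<open>The series of \<open>f g^i\<close> is a multiple of \<open>\<theta> \<sigma>\<close>,
  and \<open>x_1\<close> is a multiple of the series of \<open>g\<close>. Hence \<open>x_1^i\<close>
  times the series of \<open>f\<close> vanishes on \<open>raise i T\<close>, and undoing the shift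
  by \<open>i\<close> gives vanishing on \<open>T\<close>.\<close>

lemma expansion_vanish:
  assumes T: "down_closed T" and g: "local_equation X D U g" "x \<in> U"
    and \<epsilon>: "generator X L U \<epsilon>" and f: "f \<in> carrier (sheaf X U)"
    and \<sigma>: "\<sigma> \<in> carrier (msec L (pts X))"
    and eq: "mres L (pts X) U \<sigma> = (f \<otimes>\<^bsub>sheaf X U\<^esub> g [^]\<^bsub>sheaf X U\<^esub> i) \<odot>\<^bsub>msec L U\<^esub> \<epsilon>"
    and van: "vanish (raise i T) (\<theta> \<sigma>)"
  shows "vanish T (ex U f)"
proof -
  note U = local_equationD[OF g(1)]
  interpret U: cring "sheaf X U" by (rule cring_sheaf[OF U(1)])
  have fc: "ex U f \<in> carrier (pser {1..d})" and gc: "ex U g \<in> carrier (pser {1..d})"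
    using ex_closed[OF U(1) g(2)] f U(2) by auto
  obtain u where u: "ex U (f \<otimes>\<^bsub>sheaf X U\<^esub> g [^]\<^bsub>sheaf X U\<^esub> i) = conv u (\<theta> \<sigma>)"
    using change_of_generator[OF gen0 xU0 \<epsilon> g(2)] \<sigma> coord[OF \<sigma>] eq f U(2)
    unfolding \<theta>_def by (metis U.m_closed U.nat_pow_closed)
  obtain a where a: "a \<in> carrier (pser {1..d})" "xvar 1 = conv a (ex U g)"
    using local_equation_x1(2)[OF g] by blast
  have "ex U f \<otimes>\<^bsub>pser {1..d}\<^esub> ex U g [^]\<^bsub>pser {1..d}\<^esub> i = conv u (\<theta> \<sigma>)"
    unfolding u[symmetric] ex_power[OF U(1) g(2) U(2), symmetric]
    using f U(2) by (intro ring_hom_mult[OF ex_hom[OF U(1) g(2)], symmetric]) auto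
  then have 1: "vanish (raise i T) (ex U f \<otimes>\<^bsub>pser {1..d}\<^esub> ex U g [^]\<^bsub>pser {1..d}\<^esub> i)"
    using vanish_conv[OF raise_down_closed[OF T] van] by simp
  have "xvar 1 [^]\<^bsub>pser {1..d}\<^esub> i = a [^]\<^bsub>pser {1..d}\<^esub> i \<otimes>\<^bsub>pser {1..d}\<^esub> ex U g [^]\<^bsub>pser {1..d}\<^esub> i"
    unfolding a(2) using R.nat_pow_distrib[OF a(1) gc] by simp
  then have "xvar 1 [^]\<^bsub>pser {1..d}\<^esub> i \<otimes>\<^bsub>pser {1..d}\<^esub> ex U f =
      a [^]\<^bsub>pser {1..d}\<^esub> i \<otimes>\<^bsub>pser {1..d}\<^esub> (ex U f \<otimes>\<^bsub>pser {1..d}\<^esub> ex U g [^]\<^bsub>pser {1..d}\<^esub> i)"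
    using a(1) gc fc by (simp del: pser_simps One_nat_def add: R.m_assoc R.m_comm R.m_lcomm)
  then have 2: "vanish (raise i T) (xvar 1 [^]\<^bsub>pser {1..d}\<^esub> i \<otimes>\<^bsub>pser {1..d}\<^esub> ex U f)"
    using vanish_conv[OF raise_down_closed[OF T] 1] by simp
  show ?thesis
    unfolding vanish_def
  proof
    fix e assume e: "e \<in> T"
    have "e(1 := e 1 + i) \<in> raise i T" using e by (simp add: raise_def)
    then have "(xvar 1 [^]\<^bsub>pser {1..d}\<^esub> i \<otimes>\<^bsub>pser {1..d}\<^esub> ex U f) (e(1 := e 1 + i)) = 0"
      using 2 by (simp add: vanish_def)
    then show "ex U f e = 0"
      using pow_xvar_conv[of "{1..d}" "ex U f" 1 i "e(1 := e 1 + i)"] fc d by simp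
  qed
qed

end

end

section \<open>Submodules of free modules over power series\<close>

text \<open>Induction on \<open>I\<close>: the values at \<open>j\<close> of the elements of \<open>S\<close> that vanish on \<open>I\<close> form an ideal,
  generated by any nonzero value of minimal order.\<close>

lemma free_of_finite_rank:
  fixes S :: "('i \<Rightarrow> 'k::field fps) set"
  assumes "finite I"
    and add: "\<And>f g. f \<in> S \<Longrightarrow> g \<in> S \<Longrightarrow> (\<lambda>i. f i + g i) \<in> S"
    and scale: "\<And>c f. f \<in> S \<Longrightarrow> (\<lambda>i. c * f i) \<in> S"
  shows "\<exists>(c::nat) B. (\<forall>k\<in>{1..c}. B k \<in> S) \<and>
    (\<forall>f\<in>S. \<exists>!a. a \<in> extensional {1..c} \<and> (\<forall>i\<in>I. f i = (\<Sum>k\<in>{1..c}. a k * B k i)))"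
  using assms(1)
proof (induction I rule: finite_induct)
  case empty
  show ?case by (intro exI[of _ 0]) auto
next
  case (insert j I)
  then obtain c B where B: "\<forall>k\<in>{1..c::nat}. B k \<in> S"
    and ex1: "\<forall>f\<in>S. \<exists>!a. a \<in> extensional {1..c} \<and> (\<forall>i\<in>I. f i = (\<Sum>k\<in>{1..c}. a k * B k i))"
    by blast
  have comb: "(\<lambda>i. f i - (\<Sum>k\<in>{1..m}. a k * B k i)) \<in> S" if f: "f \<in> S" "m \<le> c" for f a m
    using that(2)
  proof (induction m)
    case 0
    then show ?case using f by simp
  next
    case (Suc m)
    have "B (Suc m) \<in> S" using B Suc.prems by simp
    moreover have "(\<lambda>i. f i - (\<Sum>k\<in>{1..m}. a k * B k i)) \<in> S" using Suc by simp
    ultimately have "(\<lambda>i. (f i - (\<Sum>k\<in>{1..m}. a k * B k i)) + - a (Suc m) * B (Suc m) i) \<in> S"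
      by (intro add scale)
    then show ?case by (simp add: diff_diff_eq)
  qed
  define S' where "S' = {g \<in> S. \<forall>i\<in>I. g i = 0}"
  show ?case
  proof (cases "\<forall>g\<in>S'. g j = 0")
    case True
    have "\<exists>!a. a \<in> extensional {1..c} \<and> (\<forall>i\<in>insert j I. f i = (\<Sum>k\<in>{1..c}. a k * B k i))"
      if f: "f \<in> S" for f
    proof -
      obtain a where "a \<in> extensional {1..c} \<and> (\<forall>i\<in>I. f i = (\<Sum>k\<in>{1..c}. a k * B k i))"
        and "\<forall>a'. a' \<in> extensional {1..c} \<and> (\<forall>i\<in>I. f i = (\<Sum>k\<in>{1..c}. a' k * B k i)) \<longrightarrow> a' = a"
        by (rule ex1E[OF bspec[OF ex1 f]])
      then have a: "a \<in> extensional {1..c}" "\<forall>i\<in>I. f i = (\<Sum>k\<in>{1..c}. a k * B k i)"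
        and uniq: "\<And>a'. a' \<in> extensional {1..c} \<Longrightarrow> \<forall>i\<in>I. f i = (\<Sum>k\<in>{1..c}. a' k * B k i) \<Longrightarrow> a' = a"
        by blast+
      \<comment> \<open>The remainder vanishes on \<open>I\<close>, hence also at \<open>j\<close>
        in this case, so the old basis still represents \<open>f\<close>.\<close>
      have "(\<lambda>i. f i - (\<Sum>k\<in>{1..c}. a k * B k i)) \<in> S'"
        using comb[OF f order_refl] a(2) by (simp add: S'_def)
      then have "f j = (\<Sum>k\<in>{1..c}. a k * B k j)" using True by auto
      then have all: "\<forall>i\<in>insert j I. f i = (\<Sum>k\<in>{1..c}. a k * B k i)" using a(2) by blast
      show ?thesis
      proof (rule ex1I[of _ a])
        fix a' assume "a' \<in> extensional {1..c} \<and> (\<forall>i\<in>insert j I. f i = (\<Sum>k\<in>{1..c}. a' k * B k i))"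
        then show "a' = a" by (intro uniq) blast+
      qed (use a(1) all in blast)
    qed
    then have "\<forall>f\<in>S. \<exists>!a. a \<in> extensional {1..c} \<and>
        (\<forall>i\<in>insert j I. f i = (\<Sum>k\<in>{1..c}. a k * B k i))" by (rule ballI)
    with B show ?thesis by (intro exI[of _ c] exI[of _ B] conjI)
  next
    case False
    then have "\<exists>g. g \<in> S' \<and> g j \<noteq> 0" by blast
    then obtain g0 where g0: "g0 \<in> S'" "g0 j \<noteq> 0"
      and min: "\<And>g. g \<in> S' \<Longrightarrow> g j \<noteq> 0 \<Longrightarrow> subdegree (g0 j) \<le> subdegree (g j)"
      using exists_least_iff[of "\<lambda>n. \<exists>g. g \<in> S' \<and> g j \<noteq> 0 \<and> subdegree (g j) = n"] by (metis leI)
    define B' where "B' = B(Suc c := g0)"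
    have sum: "(\<Sum>k\<in>{1..Suc c}. a k * B' k i) = (\<Sum>k\<in>{1..c}. a k * B k i) + a (Suc c) * g0 i" for a i
      by (simp add: B'_def)
    have g0I: "g0 i = 0" if "i \<in> I" for i using g0(1) that by (simp add: S'_def)
    have "\<exists>!a. a \<in> extensional {1..Suc c} \<and> (\<forall>i\<in>insert j I. f i = (\<Sum>k\<in>{1..Suc c}. a k * B' k i))"
      if f: "f \<in> S" for f
    proof -
      obtain a where "a \<in> extensional {1..c} \<and> (\<forall>i\<in>I. f i = (\<Sum>k\<in>{1..c}. a k * B k i))"
        and "\<forall>a'. a' \<in> extensional {1..c} \<and> (\<forall>i\<in>I. f i = (\<Sum>k\<in>{1..c}. a' k * B k i)) \<longrightarrow> a' = a"
        by (rule ex1E[OF bspec[OF ex1 f]])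
      then have a: "a \<in> extensional {1..c}" "\<forall>i\<in>I. f i = (\<Sum>k\<in>{1..c}. a k * B k i)"
        and uniq: "\<And>a'. a' \<in> extensional {1..c} \<Longrightarrow> \<forall>i\<in>I. f i = (\<Sum>k\<in>{1..c}. a' k * B k i) \<Longrightarrow> a' = a"
        by blast+
      define h where "h = (\<lambda>i. f i - (\<Sum>k\<in>{1..c}. a k * B k i))"
      have h: "h \<in> S'" using comb[OF f order_refl] a(2) by (simp add: S'_def h_def)
      \<comment> \<open>In \<open>k[[T]]\<close> divisibility is comparison of orders, and
        \<open>g0 j\<close> has the least one.\<close>
      have "g0 j dvd h j"
        using min[OF h] g0(2) by (cases "h j = 0") (auto simp: fps_dvd_iff)
      then obtain b where b: "h j = b * g0 j" by (auto simp: dvd_def mult.commute)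
      show ?thesis
      proof (rule ex1I[of _ "a(Suc c := b)"])
        have "f i = (\<Sum>k\<in>{1..Suc c}. (a(Suc c := b)) k * B' k i)" if "i \<in> insert j I" for i
        proof -
          have "f i = (\<Sum>k\<in>{1..c}. a k * B k i) + b * g0 i"
          proof (cases "i = j")
            case True
            then show ?thesis using b by (simp add: h_def algebra_simps)
          next
            case False
            then show ?thesis using that a(2) g0I by auto
          qed
          then show ?thesis unfolding sum by simp
        qed
        then show "a(Suc c := b) \<in> extensional {1..Suc c} \<and>
            (\<forall>i\<in>insert j I. f i = (\<Sum>k\<in>{1..Suc c}. (a(Suc c := b)) k * B' k i))"
          using a(1) by (auto simp: extensional_def)
        fix a' assume a': "a' \<in> extensional {1..Suc c} \<and>
            (\<forall>i\<in>insert j I. f i = (\<Sum>k\<in>{1..Suc c}. a' k * B' k i))"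
        \<comment> \<open>As \<open>g0\<close> vanishes on \<open>I\<close>, the values on
          \<open>I\<close> determine the old coefficients; the value at \<open>j\<close> then
          determines the new one.\<close>
        have "restrict a' {1..c} = a"
        proof -
          have "\<forall>i\<in>I. f i = (\<Sum>k\<in>{1..c}. restrict a' {1..c} k * B k i)"
            using a' g0I unfolding sum by simp
          then show ?thesis by (rule uniq[OF restrict_extensional])
        qed
        then have eq: "a' k = a k" if "k \<in> {1..c}" for k using that by (metis restrict_apply')
        have "(\<Sum>k\<in>{1..c}. a k * B k j) + a' (Suc c) * g0 j = f j"
          using a' eq unfolding sum by simp
        then have "a' (Suc c) * g0 j = b * g0 j" using b by (simp add: h_def algebra_simps)
        then have "a' (Suc c) = b" using g0(2) by simp
        moreover have "a' k = a k" if "k \<noteq> Suc c" for k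
        proof (cases "k \<in> {1..c}")
          case False
          then show ?thesis using that a' a(1) by (auto simp: extensional_def)
        qed (rule eq)
        ultimately show "a' = a(Suc c := b)" by auto
      qed
    qed
    then have "\<forall>f\<in>S. \<exists>!a. a \<in> extensional {1..Suc c} \<and>
        (\<forall>i\<in>insert j I. f i = (\<Sum>k\<in>{1..Suc c}. a k * B' k i))" by (rule ballI)
    moreover have "\<forall>k\<in>{1..Suc c}. B' k \<in> S"
      using B g0(1) by (auto simp: B'_def S'_def)
    ultimately show ?thesis by (intro exI[of _ "Suc c"] exI[of _ B'] conjI)
  qed
qed

section \<open>Sections with coefficients in Laurent series\<close>

locale linear_sys = line_bundle X L for X :: "('k::field, 'p, 'f) kspace" and L :: "('p, 'f, 'l) msheaf" +
  fixes \<L> :: "'l set"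
  assumes linear: "linear_system X L \<L>"
begin

abbreviation "G \<equiv> msec L (pts X)"
abbreviation "ks \<equiv> kscale X L"

lemma open_pts: "openin (topo X) (pts X)" by simp

interpretation M: module "sheaf X (pts X)" "msec L (pts X)"
  by (rule module_L[OF open_pts])

lemma ks_closed [simp]: "\<sigma> \<in> carrier G \<Longrightarrow> ks c \<sigma> \<in> carrier G"
  unfolding kscale_def by (rule M.smult_closed[OF kstr_closed])

lemma ks_add_left: "\<sigma> \<in> carrier G \<Longrightarrow> ks (a + b) \<sigma> = ks a \<sigma> \<oplus>\<^bsub>G\<^esub> ks b \<sigma>"
  using ringed kstr_closed by (simp add: kscale_def ringed_kspace_def M.smult_l_distr)

lemma ks_add_right: "\<sigma> \<in> carrier G \<Longrightarrow> \<tau> \<in> carrier G \<Longrightarrow> ks a (\<sigma> \<oplus>\<^bsub>G\<^esub> \<tau>) = ks a \<sigma> \<oplus>\<^bsub>G\<^esub> ks a \<tau>"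
  using kstr_closed by (simp add: kscale_def M.smult_r_distr)

lemma ks_mult: "\<sigma> \<in> carrier G \<Longrightarrow> ks (a * b) \<sigma> = ks a (ks b \<sigma>)"
  using ringed kstr_closed by (simp add: kscale_def ringed_kspace_def M.smult_assoc1)

lemma ks_zero [simp]: "\<sigma> \<in> carrier G \<Longrightarrow> ks 0 \<sigma> = \<zero>\<^bsub>G\<^esub>"
  using ks_add_left[of \<sigma> 0 0] by (metis M.add.r_cancel_one' add_0 ks_closed)

lemma ks_zero_right [simp]: "ks a \<zero>\<^bsub>G\<^esub> = \<zero>\<^bsub>G\<^esub>"
  using kstr_closed by (simp add: kscale_def M.smult_r_null)

lemma ks_sum: "finite I \<Longrightarrow> \<sigma> \<in> carrier G \<Longrightarrow> finsum G (\<lambda>i. ks (a i) \<sigma>) I = ks (sum a I) \<sigma>"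
  by (induction I rule: finite_induct) (auto simp: ks_add_left Pi_def)

lemma \<L>_sub: "\<L> \<subseteq> carrier G" and \<L>_zero: "\<zero>\<^bsub>G\<^esub> \<in> \<L>"
  and \<L>_add: "\<sigma> \<in> \<L> \<Longrightarrow> \<tau> \<in> \<L> \<Longrightarrow> \<sigma> \<oplus>\<^bsub>G\<^esub> \<tau> \<in> \<L>" and \<L>_ks: "\<sigma> \<in> \<L> \<Longrightarrow> ks c \<sigma> \<in> \<L>"
  using linear by (auto simp: linear_system_def)

text \<open>Representations of a tensor are not unique; operations are computed on a representation,
  and the results are compared as functions of the exponent.\<close>

definition ten :: "nat \<Rightarrow> (nat \<Rightarrow> 'l) \<Rightarrow> (nat \<Rightarrow> 'k fls) \<Rightarrow> int \<Rightarrow> 'l" where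
  "ten m \<sigma> c = (\<lambda>n. finsum G (\<lambda>i. ks (fls_nth (c i) n) (\<sigma> i)) {..<m})"

lemma ten_Suc:
  assumes "\<forall>i<Suc m. \<sigma> i \<in> \<L>"
  shows "ten (Suc m) \<sigma> c n = ten m \<sigma> c n \<oplus>\<^bsub>G\<^esub> ks (fls_nth (c m) n) (\<sigma> m)"
proof -
  have "\<sigma> i \<in> carrier G" if "i < Suc m" for i using assms that \<L>_sub by blast
  then show ?thesis unfolding ten_def lessThan_Suc
    by (subst M.finsum_insert) (auto simp: Pi_def intro!: M.a_comm)
qed

lemma ten_0 [simp]: "ten 0 \<sigma> c n = \<zero>\<^bsub>G\<^esub>"
  by (simp add: ten_def)

lemma ten_in: "\<forall>i<m. \<sigma> i \<in> \<L> \<Longrightarrow> ten m \<sigma> c n \<in> \<L>"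
  by (induction m) (auto simp: ten_Suc \<L>_zero intro!: \<L>_add \<L>_ks)

lemma ten_carrier [simp]: "\<forall>i<m. \<sigma> i \<in> \<L> \<Longrightarrow> ten m \<sigma> c n \<in> carrier G"
  using ten_in \<L>_sub by blast

lemma tensor_laurent_ten: "tensor_laurent X L \<L> = {ten m \<sigma> c |m \<sigma> c. \<forall>i<m. \<sigma> i \<in> \<L>}"
  unfolding tensor_laurent_def ten_def ..

lemma tensor_power_ten:
  "tensor_power X L \<L> = {ten m \<sigma> c |m \<sigma> c. (\<forall>i<m. \<sigma> i \<in> \<L>) \<and> (\<forall>i. c i \<in> range fps_to_fls)}"
proof (intro subset_antisym subsetI)
  fix F assume "F \<in> tensor_power X L \<L>"
  then obtain m \<sigma> and c :: "nat \<Rightarrow> 'k fps" where "F = ten m \<sigma> (\<lambda>i. fps_to_fls (c i))" "\<forall>i<m. \<sigma> i \<in> \<L>"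
    by (auto simp: tensor_power_def ten_def)
  moreover have "\<forall>i. fps_to_fls (c i) \<in> range fps_to_fls" by simp
  ultimately show "F \<in> {ten m \<sigma> c |m \<sigma> c. (\<forall>i<m. \<sigma> i \<in> \<L>) \<and> (\<forall>i. c i \<in> range fps_to_fls)}" by blast
next
  fix F assume "F \<in> {ten m \<sigma> c |m \<sigma> c. (\<forall>i<m. \<sigma> i \<in> \<L>) \<and> (\<forall>i. c i \<in> range fps_to_fls)}"
  then obtain m \<sigma> c where F: "F = ten m \<sigma> c" "\<forall>i<m. \<sigma> i \<in> \<L>" "\<forall>i. c i \<in> range fps_to_fls" by blast
  then have "\<forall>i. \<exists>b. c i = fps_to_fls b" by auto
  then obtain b where "\<forall>i. c i = fps_to_fls (b i)" by metis
  then have "F = ten m \<sigma> (\<lambda>i. fps_to_fls (b i))" using F(1) by (simp add: ten_def)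
  then show "F \<in> tensor_power X L \<L>" using F(2) by (auto simp: tensor_power_def ten_def)
qed

lemma ten_append:
  assumes "\<forall>i<m+k. \<sigma> i \<in> \<L>"
  shows "ten (m + k) \<sigma> c n = ten m \<sigma> c n \<oplus>\<^bsub>G\<^esub> ten k (\<lambda>i. \<sigma> (m + i)) (\<lambda>i. c (m + i)) n"
  using assms
proof (induction k)
  case (Suc k)
  have c: "ten m \<sigma> c n \<in> carrier G" "ten k (\<lambda>i. \<sigma> (m + i)) (\<lambda>i. c (m + i)) n \<in> carrier G"
    "ks (fls_nth (c (m + k)) n) (\<sigma> (m + k)) \<in> carrier G"
    using Suc.prems \<L>_sub by (auto intro!: ten_carrier ks_closed)
  show ?case using Suc c by (simp add: ten_Suc M.a_assoc)
qed simp

lemma ten_cong: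
  assumes "\<And>i. i < m \<Longrightarrow> \<sigma> i = \<sigma>' i" "\<And>i. i < m \<Longrightarrow> c i = c' i" "\<forall>i<m. \<sigma>' i \<in> \<L>"
  shows "ten m \<sigma> c n = ten m \<sigma>' c' n"
  unfolding ten_def using assms \<L>_sub by (intro M.finsum_cong') auto

lemma ten_zero:
  assumes "\<forall>i<m. \<sigma> i \<in> \<L>" "\<And>i. i < m \<Longrightarrow> fls_nth (c i) n = 0"
  shows "ten m \<sigma> c n = \<zero>\<^bsub>G\<^esub>"
  using assms by (induction m) (use \<L>_sub in \<open>auto simp: ten_Suc\<close>)

lemma ten_add:
  assumes "\<forall>i<m. \<sigma> i \<in> \<L>"
  shows "ten m \<sigma> c n \<oplus>\<^bsub>G\<^esub> ten m \<sigma> c' n = ten m \<sigma> (\<lambda>i. c i + c' i) n"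
  using assms
proof (induction m)
  case (Suc m)
  then have "\<sigma> m \<in> carrier G" "\<forall>i<m. \<sigma> i \<in> \<L>" using \<L>_sub by auto
  then show ?case
    using Suc.prems by (simp add: ten_Suc ks_add_left Suc.IH[symmetric] M.add.m_ac)
qed simp

text \<open>Concatenates the two lists of sections and pads the coefficients with 0. The set
  \<open>Q\<close> of admissible coefficients lets the same proof serve Laurent and power
  series.\<close>

lemma common_representation:
  assumes F: "F = ten m \<sigma> c" "\<forall>i<m. \<sigma> i \<in> \<L>" "\<forall>i. c i \<in> Q"
    and H: "H = ten m' \<sigma>' c'" "\<forall>i<m'. \<sigma>' i \<in> \<L>" "\<forall>i. c' i \<in> Q" and Q: "0 \<in> Q"
  obtains l \<tau> a b where "F = ten l \<tau> a" "H = ten l \<tau> b" "\<forall>i<l. \<tau> i \<in> \<L>" "\<forall>i. a i \<in> Q" "\<forall>i. b i \<in> Q"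
proof
  let ?\<tau> = "\<lambda>i. if i < m then \<sigma> i else \<sigma>' (i - m)"
  let ?a = "\<lambda>i. if i < m then c i else 0" and ?b = "\<lambda>i. if i < m then 0 else c' (i - m)"
  show \<tau>: "\<forall>i<m + m'. ?\<tau> i \<in> \<L>" using F H by auto
  show "\<forall>i. ?a i \<in> Q" "\<forall>i. ?b i \<in> Q" using F H Q by auto
  show "F = ten (m + m') ?\<tau> ?a"
  proof
    fix n
    have "ten m ?\<tau> ?a n = F n" unfolding F(1) using F(2) by (intro ten_cong) auto
    moreover have "ten m' (\<lambda>i. ?\<tau> (m + i)) (\<lambda>i. ?a (m + i)) n = \<zero>\<^bsub>G\<^esub>"
      using H(2) by (intro ten_zero) auto
    ultimately show "F n = ten (m + m') ?\<tau> ?a n"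
      unfolding ten_append[OF \<tau>] using F by simp
  qed
  show "H = ten (m + m') ?\<tau> ?b"
  proof
    fix n
    have "ten m ?\<tau> ?b n = \<zero>\<^bsub>G\<^esub>" using F(2) by (intro ten_zero) auto
    moreover have "ten m' (\<lambda>i. ?\<tau> (m + i)) (\<lambda>i. ?b (m + i)) n = H n"
      unfolding H(1) using H(2) by (intro ten_cong) auto
    ultimately show "H n = ten (m + m') ?\<tau> ?b n"
      unfolding ten_append[OF \<tau>] using H by simp
  qed
qed

section \<open>Scaling by Laurent and power series\<close>

abbreviation "TL \<equiv> tensor_laurent X L \<L>"
abbreviation "TP \<equiv> tensor_power X L \<L>"
abbreviation "lsc \<equiv> lscale X L"

lemma TP_TL: "TP \<subseteq> TL"
  unfolding tensor_power_ten tensor_laurent_ten by blast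

lemma lsc_finite:
  assumes "finite I" "{i. fls_nth c i \<noteq> 0 \<and> F (n - i) \<noteq> \<zero>\<^bsub>G\<^esub>} \<subseteq> I" "\<And>i. F i \<in> carrier G"
  shows "lsc c F n = finsum G (\<lambda>i. ks (fls_nth c i) (F (n - i))) I"
  unfolding lscale_def
  by (rule M.add.finprod_mono_neutral_cong_left) (use assms in auto)

text \<open>\<open>lscale\<close> sums over a support, which is finite because both factors are
  bounded below; enlarging it to a fixed interval makes the sum additive in the tensor.\<close>

lemma lsc_ten:
  assumes \<sigma>: "\<forall>i<m. \<sigma> i \<in> \<L>"
  shows "lsc a (ten m \<sigma> c) = ten m \<sigma> (\<lambda>i. a * c i)"
proof
  fix n
  \<comment> \<open>A common lower bound for the orders of the coefficients; the inserted 0 keeps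
    the minimum defined for \<open>m = 0\<close>.\<close>
  define N where "N = Min (insert 0 ((\<lambda>i. fls_subdegree (c i)) ` {..<m}))"
  have N: "N \<le> fls_subdegree (c i)" if "i < m" for i unfolding N_def using that by (intro Min_le) auto
  let ?I = "{fls_subdegree a..n - N}"
  have sub: "{i. fls_nth a i \<noteq> 0 \<and> ten m \<sigma> c (n - i) \<noteq> \<zero>\<^bsub>G\<^esub>} \<subseteq> ?I"
  proof
    fix i assume i: "i \<in> {i. fls_nth a i \<noteq> 0 \<and> ten m \<sigma> c (n - i) \<noteq> \<zero>\<^bsub>G\<^esub>}"
    have "N \<le> n - i"
    proof (rule ccontr)
      assume "\<not> N \<le> n - i"
      then have "fls_nth (c l) (n - i) = 0" if "l < m" for l
        using N[OF that] by (intro fls_eq0_below_subdegree) simp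
      then show False using i ten_zero[OF \<sigma>] by blast
    qed
    moreover have "fls_subdegree a \<le> i" using i fls_subdegree_leI by blast
    ultimately show "i \<in> ?I" by simp
  qed
  have "finsum G (\<lambda>i. ks (fls_nth a i) (ten k \<sigma> c (n - i))) ?I = ten k \<sigma> (\<lambda>i. a * c i) n" if "k \<le> m" for k
    using that
  proof (induction k)
    case 0
    then show ?case by (simp add: M.finsum_zero)
  next
    case (Suc k)
    have \<sigma>k: "\<sigma> k \<in> carrier G" "\<forall>i<Suc k. \<sigma> i \<in> \<L>" "\<forall>i<k. \<sigma> i \<in> \<L>" using Suc.prems \<sigma> \<L>_sub by auto
    have "finsum G (\<lambda>i. ks (fls_nth a i) (ten (Suc k) \<sigma> c (n - i))) ?I =
        finsum G (\<lambda>i. ks (fls_nth a i) (ten k \<sigma> c (n - i)) \<oplus>\<^bsub>G\<^esub>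
          ks (fls_nth a i * fls_nth (c k) (n - i)) (\<sigma> k)) ?I"
      using \<sigma>k by (intro M.finsum_cong') (auto simp: ten_Suc ks_add_right ks_mult)
    also have "\<dots> = finsum G (\<lambda>i. ks (fls_nth a i) (ten k \<sigma> c (n - i))) ?I \<oplus>\<^bsub>G\<^esub>
        finsum G (\<lambda>i. ks (fls_nth a i * fls_nth (c k) (n - i)) (\<sigma> k)) ?I"
      using \<sigma>k by (intro M.finsum_addf) auto
    also have "finsum G (\<lambda>i. ks (fls_nth a i * fls_nth (c k) (n - i)) (\<sigma> k)) ?I =
        ks (\<Sum>i\<in>?I. fls_nth a i * fls_nth (c k) (n - i)) (\<sigma> k)"
      using \<sigma>k by (intro ks_sum) auto
    also have "(\<Sum>i\<in>?I. fls_nth a i * fls_nth (c k) (n - i)) = fls_nth (a * c k) n"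
      unfolding fls_times_nth(2)
      using N[of k] Suc.prems by (intro sum.mono_neutral_right) (auto intro: fls_eq0_below_subdegree)
    finally show ?case using Suc \<sigma>k by (simp add: ten_Suc)
  qed
  then show "lsc a (ten m \<sigma> c) n = ten m \<sigma> (\<lambda>i. a * c i) n"
    using lsc_finite[OF _ sub] \<sigma> by simp
qed

lemma TL_E:
  assumes "F \<in> TL" obtains m \<sigma> c where "F = ten m \<sigma> c" "\<forall>i<m. \<sigma> i \<in> \<L>"
  using assms unfolding tensor_laurent_ten by blast

lemma TL_E2:
  assumes "F \<in> TL" "H \<in> TL" obtains m \<sigma> a b where "F = ten m \<sigma> a" "H = ten m \<sigma> b" "\<forall>i<m. \<sigma> i \<in> \<L>"
proof -
  obtain m \<sigma> c where F: "F = ten m \<sigma> c" "\<forall>i<m. \<sigma> i \<in> \<L>" by (rule TL_E[OF assms(1)])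
  obtain m' \<sigma>' c' where H: "H = ten m' \<sigma>' c'" "\<forall>i<m'. \<sigma>' i \<in> \<L>" by (rule TL_E[OF assms(2)])
  show ?thesis using common_representation[OF F _ H, of UNIV] that by auto
qed

lemma TL_value: "F \<in> TL \<Longrightarrow> F n \<in> \<L>"
  by (elim TL_E) (simp add: ten_in)

lemma TL_carrier: "F \<in> TL \<Longrightarrow> F n \<in> carrier G"
  using TL_value \<L>_sub by blast

lemma TP_negative: "F \<in> TP \<Longrightarrow> n < 0 \<Longrightarrow> F n = \<zero>\<^bsub>G\<^esub>"
proof -
  assume "F \<in> TP" and n: "n < 0"
  then obtain m \<sigma> c where F: "F = ten m \<sigma> c" "\<forall>i<m. \<sigma> i \<in> \<L>" "\<forall>i. c i \<in> range fps_to_fls"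
    unfolding tensor_power_ten by blast
  have "fls_nth (c i) n = 0" for i using F(3)[rule_format, of i] n by auto
  then show ?thesis unfolding F(1) by (intro ten_zero[OF F(2)])
qed

lemma lsc_lsc: "F \<in> TL \<Longrightarrow> lsc a (lsc b F) = lsc (a * b) F"
  by (elim TL_E) (simp add: lsc_ten mult.assoc)

lemma lsc_one: "F \<in> TL \<Longrightarrow> lsc 1 F = F"
  by (elim TL_E) (simp add: lsc_ten)

lemma lsc_zero: "F \<in> TL \<Longrightarrow> lsc 0 F = (\<lambda>_. \<zero>\<^bsub>G\<^esub>)"
  by (elim TL_E) (auto simp: lsc_ten intro!: ten_zero)

lemma lsc_add:
  assumes "F \<in> TL" "H \<in> TL" shows "lsc a (\<lambda>n. F n \<oplus>\<^bsub>G\<^esub> H n) = (\<lambda>n. lsc a F n \<oplus>\<^bsub>G\<^esub> lsc a H n)"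
proof -
  obtain m \<sigma> b c where *: "F = ten m \<sigma> b" "H = ten m \<sigma> c" "\<forall>i<m. \<sigma> i \<in> \<L>" by (rule TL_E2[OF assms])
  show ?thesis by (simp add: * ten_add[OF *(3)] lsc_ten[OF *(3)] distrib_left)
qed

lemma lsc_minus:
  assumes "F \<in> TL" shows "lsc (- 1) F n = \<ominus>\<^bsub>G\<^esub> F n"
proof -
  obtain m \<sigma> c where *: "F = ten m \<sigma> c" "\<forall>i<m. \<sigma> i \<in> \<L>" by (rule TL_E[OF assms])
  have "lsc (- 1) F n \<oplus>\<^bsub>G\<^esub> F n = \<zero>\<^bsub>G\<^esub>"
    unfolding *(1) lsc_ten[OF *(2)] ten_add[OF *(2)] by (rule ten_zero[OF *(2)]) simp
  then show ?thesis using * by (metis M.minus_equality lsc_ten ten_carrier)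
qed

lemma TL_lsc: "F \<in> TL \<Longrightarrow> lsc a F \<in> TL"
  by (elim TL_E) (auto simp: lsc_ten tensor_laurent_ten)

lemma TP_add:
  assumes "F \<in> TP" "H \<in> TP" shows "(\<lambda>n. F n \<oplus>\<^bsub>G\<^esub> H n) \<in> TP"
proof -
  obtain m \<sigma> c where F: "F = ten m \<sigma> c" "\<forall>i<m. \<sigma> i \<in> \<L>" "\<forall>i. c i \<in> range fps_to_fls"
    using assms(1) unfolding tensor_power_ten by blast
  obtain m' \<sigma>' c' where H: "H = ten m' \<sigma>' c'" "\<forall>i<m'. \<sigma>' i \<in> \<L>" "\<forall>i. c' i \<in> range fps_to_fls"
    using assms(2) unfolding tensor_power_ten by blast
  obtain l \<tau> a b where *: "F = ten l \<tau> a" "H = ten l \<tau> b" "\<forall>i<l. \<tau> i \<in> \<L>"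
    "\<forall>i. a i \<in> range fps_to_fls" "\<forall>i. b i \<in> range fps_to_fls"
    using common_representation[OF F H] by (metis fps_zero_to_fls rangeI)
  have "\<forall>i. a i + b i \<in> range fps_to_fls"
  proof
    fix i
    obtain a' b' where "a i = fps_to_fls a'" "b i = fps_to_fls b'" using *(4,5) by blast
    then have "a i + b i = fps_to_fls (a' + b')" by simp
    then show "a i + b i \<in> range fps_to_fls" by blast
  qed
  then show ?thesis unfolding tensor_power_ten *(1,2) ten_add[OF *(3)] using *(3) by blast
qed


lemma TP_lsc:
  assumes "F \<in> TP" shows "lsc (fps_to_fls a) F \<in> TP"
proof -
  obtain m \<sigma> c where F: "F = ten m \<sigma> c" "\<forall>i<m. \<sigma> i \<in> \<L>" "\<forall>i. c i \<in> range fps_to_fls"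
    using assms unfolding tensor_power_ten by blast
  have "\<forall>i. fps_to_fls a * c i \<in> range fps_to_fls"
  proof
    fix i
    obtain b where "c i = fps_to_fls b" using F(3) by blast
    then have "fps_to_fls a * c i = fps_to_fls (a * b)" by (simp add: fls_times_fps_to_fls)
    then show "fps_to_fls a * c i \<in> range fps_to_fls" by blast
  qed
  then show ?thesis unfolding F(1) lsc_ten[OF F(2)] tensor_power_ten using F(2) by blast
qed

text \<open>Both series start in degree 0, so this is an ordinary finite Cauchy product.\<close>

lemma lsc_TP_nth:
  assumes F: "F \<in> TP"
  shows "lsc (fps_to_fls a) F (int n) = finsum G (\<lambda>i. ks (fps_nth a i) (F (int (n - i)))) {0..n}"
proof -
  note TL = subsetD[OF TP_TL F]
  have "{i. fls_nth (fps_to_fls a) i \<noteq> 0 \<and> F (int n - i) \<noteq> \<zero>\<^bsub>G\<^esub>} \<subseteq> int ` {0..n}"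
  proof
    fix i assume i: "i \<in> {i. fls_nth (fps_to_fls a) i \<noteq> 0 \<and> F (int n - i) \<noteq> \<zero>\<^bsub>G\<^esub>}"
    then have "0 \<le> i" by (auto split: if_splits)
    moreover have "i \<le> int n"
    proof (rule ccontr)
      assume "\<not> i \<le> int n"
      then show False using i TP_negative[OF F, of "int n - i"] by simp
    qed
    ultimately show "i \<in> int ` {0..n}" by (intro image_eqI[of _ _ "nat i"]) auto
  qed
  then have "lsc (fps_to_fls a) F (int n) =
      finsum G (\<lambda>i. ks (fls_nth (fps_to_fls a) i) (F (int n - i))) (int ` {0..n})"
    by (intro lsc_finite) (auto simp: TL_carrier[OF TL])
  also have "\<dots> = finsum G (\<lambda>i. ks (fls_nth (fps_to_fls a) (int i)) (F (int n - int i))) {0..n}"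
    by (rule M.finsum_reindex) (auto simp: TL_carrier[OF TL])
  also have "\<dots> = finsum G (\<lambda>i. ks (fps_nth a i) (F (int (n - i)))) {0..n}"
    by (intro M.finsum_cong') (auto simp: TL_carrier[OF TL] of_nat_diff)
  finally show ?thesis .
qed

section \<open>Combinations with power series coefficients\<close>

definition comb :: "nat \<Rightarrow> (nat \<Rightarrow> 'k fps) \<Rightarrow> (nat \<Rightarrow> int \<Rightarrow> 'l) \<Rightarrow> int \<Rightarrow> 'l" where
  "comb c a B = (\<lambda>n. finsum G (\<lambda>i. lsc (fps_to_fls (a i)) (B i) n) {1..c})"

lemma comb_0: "comb 0 a B = (\<lambda>_. \<zero>\<^bsub>G\<^esub>)"
  by (simp add: comb_def)

lemma comb_Suc:
  assumes "\<And>i. i \<in> {1..Suc c} \<Longrightarrow> B i \<in> TP"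
  shows "comb (Suc c) a B = (\<lambda>n. comb c a B n \<oplus>\<^bsub>G\<^esub> lsc (fps_to_fls (a (Suc c))) (B (Suc c)) n)"
proof
  fix n
  have cl: "lsc (fps_to_fls (a i)) (B i) n \<in> carrier G" if "i \<in> {1..Suc c}" for i
    using TL_carrier[OF subsetD[OF TP_TL TP_lsc[OF assms[OF that]]]] .
  have "{1..Suc c} = insert (Suc c) {1..c}" by auto
  then show "comb (Suc c) a B n = comb c a B n \<oplus>\<^bsub>G\<^esub> lsc (fps_to_fls (a (Suc c))) (B (Suc c)) n"
    unfolding comb_def using cl by (simp add: M.finsum_insert Pi_def M.a_comm)
qed

lemma TP_zero: "(\<lambda>_. \<zero>\<^bsub>G\<^esub>) \<in> TP"
proof -
  have "(\<lambda>_. \<zero>\<^bsub>G\<^esub>) = ten 0 (\<lambda>_. \<zero>\<^bsub>G\<^esub>) (\<lambda>_. fps_to_fls 0)" by (rule ext) simp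
  then show ?thesis unfolding tensor_power_ten by (intro CollectI exI conjI) auto
qed

lemma comb_TP: "(\<And>i. i \<in> {1..c} \<Longrightarrow> B i \<in> TP) \<Longrightarrow> comb c a B \<in> TP"
proof (induction c)
  case (Suc c)
  have "comb (Suc c) a B = (\<lambda>n. comb c a B n \<oplus>\<^bsub>G\<^esub> lsc (fps_to_fls (a (Suc c))) (B (Suc c)) n)"
    by (rule comb_Suc) (rule Suc.prems)
  then show ?case using Suc by (simp add: TP_add TP_lsc)
qed (simp add: comb_0 TP_zero)

lemma lsc_comb:
  "(\<And>i. i \<in> {1..c} \<Longrightarrow> B i \<in> TP) \<Longrightarrow> lsc (fps_to_fls b) (comb c a B) = comb c (\<lambda>i. b * a i) B"
proof (induction c)
  case 0
  have "lsc (fps_to_fls b) (\<lambda>_. \<zero>\<^bsub>G\<^esub>) = lsc (fps_to_fls b) (lsc 0 (\<lambda>_. \<zero>\<^bsub>G\<^esub>))"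
    using lsc_zero[OF subsetD[OF TP_TL TP_zero]] by simp
  also have "\<dots> = (\<lambda>_. \<zero>\<^bsub>G\<^esub>)"
    using lsc_lsc[OF subsetD[OF TP_TL TP_zero], of "fps_to_fls b" 0] lsc_zero[OF subsetD[OF TP_TL TP_zero]]
    by simp
  finally show ?case by (simp add: comb_0)
next
  case (Suc c)
  have B: "B (Suc c) \<in> TL" "\<And>i. i \<in> {1..c} \<Longrightarrow> B i \<in> TP" using Suc.prems TP_TL by auto
  have "comb c a B \<in> TL" "lsc (fps_to_fls (a (Suc c))) (B (Suc c)) \<in> TL"
    using comb_TP[OF B(2)] TP_TL TL_lsc[OF B(1)] by auto
  moreover have "comb (Suc c) a B = (\<lambda>n. comb c a B n \<oplus>\<^bsub>G\<^esub> lsc (fps_to_fls (a (Suc c))) (B (Suc c)) n)" for a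
    by (rule comb_Suc) (rule Suc.prems)
  ultimately show ?case
    using Suc.IH[OF B(2)] by (simp add: lsc_add lsc_lsc[OF B(1)] fls_times_fps_to_fls)
qed

lemma comb_cong: "(\<And>i. i \<in> {1..c} \<Longrightarrow> a i = b i) \<Longrightarrow> (\<And>i. i \<in> {1..c} \<Longrightarrow> B i \<in> TP) \<Longrightarrow>
    comb c a B = comb c b B"
  unfolding comb_def
  by (intro ext M.finsum_cong') (auto simp: TL_carrier[OF subsetD[OF TP_TL TP_lsc]])

lemma comb_zero:
  assumes "\<And>i. i \<in> {1..c} \<Longrightarrow> B i \<in> TP" shows "comb c (\<lambda>_. 0) B = (\<lambda>_. \<zero>\<^bsub>G\<^esub>)"
proof -
  have "comb c (\<lambda>_. 0) B = lsc (fps_to_fls 0) (comb c (\<lambda>_. 0) B)"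
    by (subst lsc_comb) (use assms in auto)
  also have "\<dots> = (\<lambda>_. \<zero>\<^bsub>G\<^esub>)"
    using lsc_zero[OF subsetD[OF TP_TL comb_TP]] assms by simp
  finally show ?thesis .
qed

text \<open>Expresses differences by addition and scaling, the operations with which linear forms
  are compatible.\<close>

lemma TP_diff:
  assumes "F \<in> TP" "H \<in> TP"
  shows "(\<lambda>n. F n \<ominus>\<^bsub>G\<^esub> H n) = (\<lambda>n. F n \<oplus>\<^bsub>G\<^esub> lsc (fps_to_fls (- 1)) H n)"
  using lsc_minus[OF subsetD[OF TP_TL assms(2)]] by (simp add: a_minus_def)

end

section \<open>Points of the Grassmannian and uniqueness of the limit\<close>

context linear_sys
begin

interpretation M: module "sheaf X (pts X)" "msec L (pts X)"
  by (rule module_L[OF open_pts])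

lemma grassmann_pointD:
  assumes "grassmann_point X L \<L> M"
  shows "M \<subseteq> TP" "F \<in> M \<Longrightarrow> lsc (fps_to_fls a) F \<in> M" "(\<lambda>_. \<zero>\<^bsub>G\<^esub>) \<in> M"
  using assms unfolding grassmann_point_def by blast+

lemma grassmann_point_basis:
  assumes "grassmann_point X L \<L> M"
  shows "\<exists>c B. (\<forall>i\<in>{1..c::nat}. B i \<in> TP) \<and>
      (\<forall>F\<in>TP. \<exists>!a. a \<in> extensional {1..c} \<and> (\<lambda>n. F n \<ominus>\<^bsub>G\<^esub> comb c a B n) \<in> M)"
  using assms unfolding grassmann_point_def comb_def by (elim conjE)

text \<open>The quotient by a point of the Grassmannian is free, hence torsion free.\<close>

lemma grassmann_point_saturated:
  assumes M: "grassmann_point X L \<L> M" and F: "F \<in> TP"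
    and b: "b \<noteq> 0" "lsc (fps_to_fls b) F \<in> M"
  shows "F \<in> M"
proof -
  obtain c B where basis: "(\<forall>i\<in>{1..c::nat}. B i \<in> TP) \<and>
      (\<forall>F\<in>TP. \<exists>!a. a \<in> extensional {1..c} \<and> (\<lambda>n. F n \<ominus>\<^bsub>G\<^esub> comb c a B n) \<in> M)"
    using grassmann_point_basis[OF M] by (elim exE) (rule that)
  have B: "B i \<in> TP" if "i \<in> {1..c}" for i by (rule bspec[OF conjunct1[OF basis] that])
  note ex1 = bspec[OF conjunct2[OF basis]]
  obtain a where a: "a \<in> extensional {1..c}" "(\<lambda>n. F n \<ominus>\<^bsub>G\<^esub> comb c a B n) \<in> M"
    using ex1_implies_ex[OF ex1[OF F]] by blast
  let ?bF = "lsc (fps_to_fls b) F"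
  have bF: "?bF \<in> TP" by (rule TP_lsc[OF F])
  obtain z where z: "\<And>a. a \<in> extensional {1..c} \<Longrightarrow> (\<lambda>n. ?bF n \<ominus>\<^bsub>G\<^esub> comb c a B n) \<in> M \<Longrightarrow> a = z"
    using ex1[OF bF] by blast
  have comb: "comb c a B \<in> TP" for a using B by (rule comb_TP)
  have "lsc (fps_to_fls b) (\<lambda>n. F n \<ominus>\<^bsub>G\<^esub> comb c a B n) \<in> M"
    by (rule grassmann_pointD(2)[OF M a(2)])
  also have "lsc (fps_to_fls b) (\<lambda>n. F n \<ominus>\<^bsub>G\<^esub> comb c a B n) =
      (\<lambda>n. ?bF n \<ominus>\<^bsub>G\<^esub> lsc (fps_to_fls b) (comb c a B) n)"
  proof -
    have TL: "F \<in> TL" "comb c a B \<in> TL" using F comb TP_TL by auto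
    then show ?thesis
      unfolding TP_diff[OF F comb] TP_diff[OF bF TP_lsc[OF comb]]
      by (simp add: lsc_add TL_lsc lsc_lsc mult.commute)
  qed
  also have "lsc (fps_to_fls b) (comb c a B) = comb c (\<lambda>i. b * a i) B" using B by (rule lsc_comb)
  also have "\<dots> = comb c (restrict (\<lambda>i. b * a i) {1..c}) B"
    using B by (intro comb_cong) auto
  \<comment> \<open>The coordinates of \<open>bF\<close> are \<open>b\<close> times those of
    \<open>F\<close>, but also 0 because \<open>bF\<close> lies in \<open>M\<close>. Uniqueness and
    \<open>b \<noteq> 0\<close> make the coordinates of \<open>F\<close> vanish. The restrictions to
    \<open>{1..c}\<close> put the tuples among the extensional ones, where uniqueness holds.\<close>
  finally have 1: "restrict (\<lambda>i. b * a i) {1..c} = z" by (intro z) auto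
  have c0: "comb c (restrict (\<lambda>_. 0) {1..c}) B = (\<lambda>_. \<zero>\<^bsub>G\<^esub>)"
  proof -
    have "comb c (restrict (\<lambda>_. 0) {1..c}) B = comb c (\<lambda>_. 0) B" using B by (intro comb_cong) auto
    also have "\<dots> = (\<lambda>_. \<zero>\<^bsub>G\<^esub>)" using B by (rule comb_zero)
    finally show ?thesis .
  qed
  have minus0: "\<sigma> \<ominus>\<^bsub>G\<^esub> \<zero>\<^bsub>G\<^esub> = \<sigma>" if "\<sigma> \<in> carrier G" for \<sigma> using that by (simp add: a_minus_def)
  have "(\<lambda>n. ?bF n \<ominus>\<^bsub>G\<^esub> comb c (restrict (\<lambda>_. 0) {1..c}) B n) = ?bF"
    unfolding c0 using minus0 TL_carrier[OF subsetD[OF TP_TL bF]] by simp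
  then have 2: "restrict (\<lambda>_. 0) {1..c} = z" using b(2) by (intro z) auto
  have "a i = 0" if "i \<in> {1..c}" for i
    using fun_cong[OF trans[OF 1 2[symmetric]], of i] that b(1) by simp
  then have "comb c a B = comb c (restrict (\<lambda>_. 0) {1..c}) B" using B by (intro comb_cong) auto
  then have "(\<lambda>n. F n \<ominus>\<^bsub>G\<^esub> comb c a B n) = F"
    unfolding c0 using minus0 TL_carrier[OF subsetD[OF TP_TL F]] by simp
  then show ?thesis using a(2) by simp
qed

lemma fls_clear_denominator:
  fixes c :: "'a::field fls"
  obtains N b where "fps_to_fls (fps_X ^ N) * c = fps_to_fls b"
proof -
  define N where "N = nat (- fls_subdegree c)"
  have "fls_subdegree (fls_shift (- int N) c) \<ge> 0"
    by (cases "c = 0") (auto simp: N_def)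
  then have "fps_to_fls (fps_X ^ N) * c = fps_to_fls (fls_regpart (fls_shift (- int N) c))"
    by (simp add: fps_to_fls_power fls_X_power_times_conv_shift)
  then show ?thesis by (rule that)
qed

definition kernel :: "'i set \<Rightarrow> ('i \<Rightarrow> (int \<Rightarrow> 'l) \<Rightarrow> 'k fps) \<Rightarrow> (int \<Rightarrow> 'l) set" where
  "kernel I lam = {F \<in> TP. \<forall>i\<in>I. lam i F = 0}"

context
  fixes I :: "'i set" and lam :: "'i \<Rightarrow> (int \<Rightarrow> 'l) \<Rightarrow> 'k fps"
  assumes finI: "finite I"
    and lam_add: "\<And>i F H. i \<in> I \<Longrightarrow> F \<in> TP \<Longrightarrow> H \<in> TP \<Longrightarrow> lam i (\<lambda>n. F n \<oplus>\<^bsub>G\<^esub> H n) = lam i F + lam i H"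
    and lam_scale: "\<And>i a F. i \<in> I \<Longrightarrow> F \<in> TP \<Longrightarrow> lam i (lsc (fps_to_fls a) F) = a * lam i F"
begin

lemma lam_zero: "i \<in> I \<Longrightarrow> lam i (\<lambda>_. \<zero>\<^bsub>G\<^esub>) = 0"
  using lam_scale[OF _ TP_zero, of i 0] lsc_zero[OF subsetD[OF TP_TL TP_zero]] by simp

lemma lam_comb:
  assumes i: "i \<in> I"
  shows "(\<And>k. k \<in> {1..c} \<Longrightarrow> B k \<in> TP) \<Longrightarrow> lam i (comb c a B) = (\<Sum>k\<in>{1..c}. a k * lam i (B k))"
proof (induction c)
  case 0
  then show ?case using lam_zero[OF i] by (simp add: comb_0)
next
  case (Suc c)
  have B: "B (Suc c) \<in> TP" "\<And>k. k \<in> {1..c} \<Longrightarrow> B k \<in> TP" using Suc.prems by auto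
  have "comb (Suc c) a B = (\<lambda>n. comb c a B n \<oplus>\<^bsub>G\<^esub> lsc (fps_to_fls (a (Suc c))) (B (Suc c)) n)"
    by (rule comb_Suc) (rule Suc.prems)
  then show ?case
    using Suc.IH[OF B(2)] lam_add[OF i comb_TP[OF B(2)] TP_lsc[OF B(1)]] lam_scale[OF i B(1)] by simp
qed

text \<open>The quotient by the kernel is isomorphic to the module of value tuples of the forms, a
  submodule of a finite free module, so \<open>free_of_finite_rank\<close> provides a basis, which
  is lifted to sections.\<close>

lemma kernel_grassmann: "grassmann_point X L \<L> (kernel I lam)"
  unfolding grassmann_point_def
proof (intro conjI)
  show "kernel I lam \<subseteq> TP" by (auto simp: kernel_def)
  show "(\<lambda>_. \<zero>\<^bsub>G\<^esub>) \<in> kernel I lam" by (simp add: kernel_def TP_zero lam_zero)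
  show "\<forall>F\<in>kernel I lam. \<forall>H\<in>kernel I lam. (\<lambda>n. F n \<oplus>\<^bsub>G\<^esub> H n) \<in> kernel I lam"
    by (auto simp: kernel_def TP_add lam_add)
  show "\<forall>a. \<forall>F\<in>kernel I lam. lsc (fps_to_fls a) F \<in> kernel I lam"
    by (auto simp: kernel_def TP_lsc lam_scale)
  let ?S = "(\<lambda>F i. if i \<in> I then lam i F else 0) ` TP"
  have add: "(\<lambda>i. f i + g i) \<in> ?S" if "f \<in> ?S" "g \<in> ?S" for f g
  proof -
    obtain F where F: "F \<in> TP" "f = (\<lambda>i. if i \<in> I then lam i F else 0)"
      using \<open>f \<in> ?S\<close> by blast
    obtain H where H: "H \<in> TP" "g = (\<lambda>i. if i \<in> I then lam i H else 0)"
      using \<open>g \<in> ?S\<close> by blast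
    note FH = F H
    then have "(\<lambda>i. f i + g i) = (\<lambda>i. if i \<in> I then lam i (\<lambda>n. F n \<oplus>\<^bsub>G\<^esub> H n) else 0)"
      by (auto simp: lam_add)
    then show ?thesis using TP_add[OF FH(1,3)] by blast
  qed
  have scale: "(\<lambda>i. c * f i) \<in> ?S" if "f \<in> ?S" for c f
  proof -
    obtain F where F: "F \<in> TP" "f = (\<lambda>i. if i \<in> I then lam i F else 0)" using \<open>f \<in> ?S\<close> by blast
    then have "(\<lambda>i. c * f i) = (\<lambda>i. if i \<in> I then lam i (lsc (fps_to_fls c) F) else 0)"
      by (auto simp: lam_scale)
    then show ?thesis using TP_lsc[OF F(1)] by blast
  qed
  have "\<exists>(c::nat) C. (\<forall>k\<in>{1..c}. C k \<in> ?S) \<and>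
    (\<forall>f\<in>?S. \<exists>!a. a \<in> extensional {1..c} \<and> (\<forall>i\<in>I. f i = (\<Sum>k\<in>{1..c}. a k * C k i)))"
  proof (rule free_of_finite_rank[OF finI])
    show "(\<lambda>i. f i + g i) \<in> ?S" if "f \<in> ?S" "g \<in> ?S" for f g using that by (rule add)
    show "(\<lambda>i. c * f i) \<in> ?S" if "f \<in> ?S" for c f using that by (rule scale)
  qed
  then obtain c C where C: "\<forall>k\<in>{1..c::nat}. C k \<in> ?S"
    and ex1: "\<forall>f\<in>?S. \<exists>!a. a \<in> extensional {1..c} \<and> (\<forall>i\<in>I. f i = (\<Sum>k\<in>{1..c}. a k * C k i))"
    by (elim exE conjE) (rule that)
  have "\<forall>k\<in>{1..c}. \<exists>F. F \<in> TP \<and> C k = (\<lambda>i. if i \<in> I then lam i F else 0)" using C by blast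
  then obtain B where B: "\<And>k. k \<in> {1..c} \<Longrightarrow> B k \<in> TP"
    "\<And>k. k \<in> {1..c} \<Longrightarrow> C k = (\<lambda>i. if i \<in> I then lam i (B k) else 0)" by metis
  show "\<exists>c B. (\<forall>i\<in>{1..c::nat}. B i \<in> TP) \<and> (\<forall>F\<in>TP. \<exists>!a. a \<in> extensional {1..c} \<and>
      (\<lambda>n. F n \<ominus>\<^bsub>G\<^esub> finsum G (\<lambda>i. lsc (fps_to_fls (a i)) (B i) n) {1..c}) \<in> kernel I lam)"
  proof (intro exI[of _ c] exI[of _ B] conjI ballI)
    show "B i \<in> TP" if "i \<in> {1..c}" for i by (rule B(1)[OF that])
    fix F assume F: "F \<in> TP"
    have comb: "comb c a B \<in> TP" for a by (rule comb_TP[OF B(1)])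
    \<comment> \<open>Coordinates of \<open>F\<close> modulo the kernel are the coordinates of its
      value tuple, which transfers existence and uniqueness.\<close>
    have "(\<lambda>n. F n \<ominus>\<^bsub>G\<^esub> comb c a B n) \<in> kernel I lam \<longleftrightarrow>
        (\<forall>i\<in>I. (if i \<in> I then lam i F else 0) = (\<Sum>k\<in>{1..c}. a k * C k i))" for a
    proof -
      have "lam i (\<lambda>n. F n \<ominus>\<^bsub>G\<^esub> comb c a B n) = lam i F - (\<Sum>k\<in>{1..c}. a k * C k i)" if i: "i \<in> I" for i
      proof -
        have "lam i (\<lambda>n. F n \<ominus>\<^bsub>G\<^esub> comb c a B n) = lam i F + - 1 * lam i (comb c a B)"
          unfolding TP_diff[OF F comb] lam_add[OF i F TP_lsc[OF comb]] lam_scale[OF i comb] ..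
        also have "lam i (comb c a B) = (\<Sum>k\<in>{1..c}. a k * lam i (B k))" by (rule lam_comb[OF i B(1)])
        also have "\<dots> = (\<Sum>k\<in>{1..c}. a k * C k i)" using i by (intro sum.cong refl) (simp add: B(2))
        finally show ?thesis by simp
      qed
      moreover have "(\<lambda>n. F n \<ominus>\<^bsub>G\<^esub> comb c a B n) \<in> TP"
        unfolding TP_diff[OF F comb] by (rule TP_add[OF F TP_lsc[OF comb]])
      ultimately show ?thesis by (auto simp: kernel_def)
    qed
    then show "\<exists>!a. a \<in> extensional {1..c} \<and>
        (\<lambda>n. F n \<ominus>\<^bsub>G\<^esub> finsum G (\<lambda>i. lsc (fps_to_fls (a i)) (B i) n) {1..c}) \<in> kernel I lam"
      using bspec[OF ex1, of "\<lambda>i. if i \<in> I then lam i F else 0"] F unfolding comb_def by simp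
  qed
qed

text \<open>A power of \<open>t\<close> turns the scalar \<open>c\<close> into a power series, for
  which the forms are linear; as \<open>k[[t]]\<close> is a domain, the power can be removed from
  the resulting zero.\<close>

lemma kernel_saturated:
  assumes F: "F \<in> TP" and H: "H \<in> kernel I lam" and eq: "F = lsc c H"
  shows "F \<in> kernel I lam"
proof -
  have HTP: "H \<in> TP" using H by (simp add: kernel_def)
  obtain N b where b: "fps_to_fls (fps_X ^ N) * c = fps_to_fls b"
    by (rule fls_clear_denominator)
  have "lsc (fps_to_fls (fps_X ^ N)) F = lsc (fps_to_fls b) H"
    unfolding eq using lsc_lsc[OF subsetD[OF TP_TL HTP]] b by simp
  then have "fps_X ^ N * lam i F = 0" if "i \<in> I" for i
    using lam_scale[OF that F, of "fps_X ^ N"] lam_scale[OF that HTP, of b] H that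
    by (simp add: kernel_def)
  then show ?thesis using F by (simp add: kernel_def)
qed

text \<open>A saturated submodule is recovered from its \<open>k((t))\<close>-span as the part lying
  in the sections over \<open>k[[t]]\<close>. Points of the Grassmannian with equal spans therefore
  coincide, and the kernel is the extension that defines the limit.\<close>

theorem limit_of_kernel:
  "limit_system X L \<L> {lsc c F |c F. F \<in> kernel I lam} = (\<lambda>F. F 0) ` kernel I lam"
proof -
  let ?W = "{lsc c F |c F. F \<in> kernel I lam}"
  have "(THE M. grassmann_point X L \<L> M \<and> ?W = {lsc c F |c F. F \<in> M}) = kernel I lam"
  proof (rule the_equality)
    show "grassmann_point X L \<L> (kernel I lam) \<and> ?W = ?W" using kernel_grassmann by simp
    fix M assume M: "grassmann_point X L \<L> M \<and> ?W = {lsc c F |c F. F \<in> M}"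
    then have g: "grassmann_point X L \<L> M" by simp
    show "M = kernel I lam"
    proof (intro subset_antisym subsetI)
      fix F assume F: "F \<in> M"
      then have TP: "F \<in> TP" using grassmann_pointD(1)[OF g] by blast
      have "F = lsc 1 F" using lsc_one[OF subsetD[OF TP_TL TP]] by simp
      then have "F \<in> ?W" using F M by blast
      then obtain c H where "H \<in> kernel I lam" "F = lsc c H" by blast
      then show "F \<in> kernel I lam" by (rule kernel_saturated[OF TP])
    next
      fix F assume F: "F \<in> kernel I lam"
      then have TP: "F \<in> TP" by (simp add: kernel_def)
      have "F = lsc 1 F" using lsc_one[OF subsetD[OF TP_TL TP]] by simp
      then have "F \<in> {lsc c F |c F. F \<in> M}" using F M by blast
      then obtain c H where H: "H \<in> M" "F = lsc c H" by blast
      have HTP: "H \<in> TP" using H(1) grassmann_pointD(1)[OF g] by blast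
      obtain N b where b: "fps_to_fls (fps_X ^ N) * c = fps_to_fls b"
        by (rule fls_clear_denominator)
      have "lsc (fps_to_fls (fps_X ^ N)) F = lsc (fps_to_fls b) H"
        unfolding H(2) using lsc_lsc[OF subsetD[OF TP_TL HTP]] b by simp
      also have "\<dots> \<in> M" by (rule grassmann_pointD(2)[OF g H(1)])
      finally show "F \<in> M" by (rule grassmann_point_saturated[OF g TP, rotated]) simp
    qed
  qed
  then show ?thesis by (simp add: limit_system_def)
qed

end

end

section \<open>The vanishing conditions on a family of sections\<close>

text \<open>Variable 0 plays the role of \<open>t\<close>, so the series of all coefficients are
  collected into one. Only exponents \<open>>= 0\<close> enter, which are all that sections over
  \<open>k[[t]]\<close> have.\<close>

definition ser :: "('l \<Rightarrow> 'k::field series) \<Rightarrow> (int \<Rightarrow> 'l) \<Rightarrow> 'k series" where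
  "ser th F = (\<lambda>b. th (F (int (b 0))) (b(0 := 0)))"

text \<open>The coefficient of \<open>(X - T\<^sup>v)\<close> to the power \<open>e_1\<close> in the expansion of the slice at \<open>e\<close>.\<close>

definition condition :: "nat \<Rightarrow> ('l \<Rightarrow> 'k::field series) \<Rightarrow> (nat \<Rightarrow> nat) \<Rightarrow> (int \<Rightarrow> 'l) \<Rightarrow> 'k fps" where
  "condition v th e F = at_root v ((quot v ^^ e 1) (slc e (ser th F)))"

text \<open>As \<open>u\<close> does not involve variable 0, only exponents with
  \<open>a 0 = 0\<close> contribute, and multiplication by \<open>u\<close> acts on each coefficient
  of \<open>t^m\<close> separately.\<close>

lemma conv_parameter:
  assumes u: "u \<in> carrier (pser {1..d})" and A: "\<And>n. A n \<in> carrier (pser {1..d})"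
  shows "(\<lambda>b. conv u (A (b 0)) (b(0 := 0))) = conv u (\<lambda>b. A (b 0) (b(0 := 0)))"
proof
  fix b :: "nat \<Rightarrow> nat"
  have A': "(\<lambda>b. A (b 0) (b(0 := 0))) \<in> carrier (pser {0..d})"
    using A unfolding carrier_pser by (metis expo_parameter)
  show "conv u (A (b 0)) (b(0 := 0)) = conv u (\<lambda>b. A (b 0) (b(0 := 0))) b"
  proof (cases "b \<in> expo {0..d}")
    case False
    then have "b(0 := 0) \<notin> expo {1..d}" by (simp only: expo_parameter not_False_eq_True)
    then have "conv u (A (b 0)) (b(0 := 0)) = 0"
      by (rule pser_zero_outside[OF conv_closed[OF u A]])
    moreover have "conv u (\<lambda>b. A (b 0) (b(0 := 0))) b = 0"
      using conv_closed[OF pser_mono[OF _ u] A'] False by (auto simp: pser_zero_outside)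
    ultimately show ?thesis by simp
  next
    case True
    have "conv u (\<lambda>b. A (b 0) (b(0 := 0))) b =
        (\<Sum>a\<in>{a. \<forall>i. a i \<le> b i}. u a * A (b 0 - a 0) ((\<lambda>i. b i - a i)(0 := 0)))"
      by (simp add: conv_def)
    also have "\<dots> = (\<Sum>a\<in>{a. \<forall>i. a i \<le> (b(0 := 0)) i}. u a * A (b 0) (\<lambda>i. (b(0 := 0)) i - a i))"
    proof (rule sum.mono_neutral_cong_right)
      show "finite {a. \<forall>i. a i \<le> b i}" by (rule finite_below[OF _ True]) simp
      show "{a. \<forall>i. a i \<le> (b(0 := 0)) i} \<subseteq> {a. \<forall>i. a i \<le> b i}"
      proof (clarify)
        fix a i assume "\<forall>i. a i \<le> (b(0 := 0)) i"
        then have "a i \<le> (b(0 := 0)) i" by blast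
        then show "a i \<le> b i" by (cases "i = 0") simp_all
      qed
      show "\<forall>a\<in>{a. \<forall>i. a i \<le> b i} - {a. \<forall>i. a i \<le> (b(0 := 0)) i}.
          u a * A (b 0 - a 0) ((\<lambda>i. b i - a i)(0 := 0)) = 0"
      proof
        fix a assume a: "a \<in> {a. \<forall>i. a i \<le> b i} - {a. \<forall>i. a i \<le> (b(0 := 0)) i}"
        then obtain i where i: "\<not> a i \<le> (b(0 := 0)) i" by blast
        have "a i \<le> b i" using a by blast
        then have "i = 0" using i by (cases "i = 0") simp_all
        then have "a \<notin> expo {1..d}" using i by (auto simp: expo_def)
        then show "u a * A (b 0 - a 0) ((\<lambda>i. b i - a i)(0 := 0)) = 0"
          using u by (simp add: pser_zero_outside)
      qed
      fix a assume "a \<in> {a. \<forall>i. a i \<le> (b(0 := 0)) i}"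
      then have "a 0 \<le> (b(0 := 0)) 0" by blast
      then have "a 0 = 0" by simp
      moreover from this have "(\<lambda>i. b i - a i)(0 := 0) = (\<lambda>i. (b(0 := 0)) i - a i)" by auto
      ultimately show "u a * A (b 0 - a 0) ((\<lambda>i. b i - a i)(0 := 0)) = u a * A (b 0) (\<lambda>i. (b(0 := 0)) i - a i)"
        by simp
    qed
    finally show ?thesis by (simp add: conv_def)
  qed
qed

locale formal_linear = formal_bundle X d x \<phi> L U0 e0 + linear_sys X L \<L>
  for X :: "('k::field, 'p, 'f) kspace" and d x \<phi> and L :: "('p, 'f, 'l) msheaf" and U0 e0 \<L>
begin

interpretation M: module "sheaf X (pts X)" "msec L (pts X)"
  by (rule module_L[OF open_pts])

lemma ser_closed:
  assumes "\<And>n. F n \<in> carrier G"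
  shows "ser \<theta> F \<in> carrier (pser {0..d})"
  using \<theta>_closed[OF assms] unfolding carrier_pser ser_def by (metis expo_parameter)

lemma slc_ser: "slc e (ser \<theta> F) $ a $ m = \<theta> (F (int m)) (e(0 := 0, 1 := a))"
proof -
  have "(e(0 := m, 1 := a))(0 := 0) = e(0 := 0, 1 := a)" by auto
  then show ?thesis by (simp add: ser_def)
qed

lemma \<theta>_zero: "\<theta> \<zero>\<^bsub>G\<^esub> = (\<lambda>_. 0)"
  using \<theta>_kscale[of "\<zero>\<^bsub>G\<^esub>" 0] by simp

lemma \<theta>_finsum:
  "finite A \<Longrightarrow> (\<And>i. i \<in> A \<Longrightarrow> g i \<in> carrier G) \<Longrightarrow> \<theta> (finsum G g A) e = (\<Sum>i\<in>A. \<theta> (g i) e)"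
proof (induction A rule: finite_induct)
  case empty
  then show ?case by (simp add: \<theta>_zero)
next
  case (insert i A)
  have "finsum G g (insert i A) = g i \<oplus>\<^bsub>G\<^esub> finsum G g A"
    using insert by (intro M.finsum_insert) auto
  moreover have "finsum G g A \<in> carrier G" using insert by (intro M.finsum_closed) auto
  ultimately show ?case using insert by (simp add: \<theta>_add)
qed

lemma condition_add:
  assumes "F \<in> TP" "H \<in> TP"
  shows "condition v \<theta> e (\<lambda>n. F n \<oplus>\<^bsub>G\<^esub> H n) = condition v \<theta> e F + condition v \<theta> e H"
proof -
  have "F n \<in> carrier G" "H n \<in> carrier G" for n using assms TP_TL TL_carrier by blast+
  then have "slc e (ser \<theta> (\<lambda>n. F n \<oplus>\<^bsub>G\<^esub> H n)) = slc e (ser \<theta> F) + slc e (ser \<theta> H)"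
    by (intro fps_ext) (simp add: ser_def \<theta>_add)
  then show ?thesis by (simp add: condition_def quot_pow_add at_root_add)
qed

lemma condition_scale:
  assumes v: "0 < v" and F: "F \<in> TP"
  shows "condition v \<theta> e (lsc (fps_to_fls c) F) = c * condition v \<theta> e F"
proof -
  have F': "F n \<in> carrier G" for n using F TP_TL TL_carrier by blast
  have "slc e (ser \<theta> (lsc (fps_to_fls c) F)) = fps_const c * slc e (ser \<theta> F)"
  proof (rule fps_ext, rule fps_ext)
    fix a m
    have "slc e (ser \<theta> (lsc (fps_to_fls c) F)) $ a $ m =
        (\<Sum>i=0..m. \<theta> (ks (c $ i) (F (int (m - i)))) (e(0 := 0, 1 := a)))"
      unfolding slc_ser lsc_TP_nth[OF F] using F' by (intro \<theta>_finsum) auto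
    also have "\<dots> = (\<Sum>i=0..m. c $ i * slc e (ser \<theta> F) $ a $ (m - i))"
      unfolding slc_ser by (simp add: \<theta>_kscale F')
    also have "\<dots> = (fps_const c * slc e (ser \<theta> F)) $ a $ m"
      unfolding fps_mult_left_const_nth fps_mult_nth[of c] ..
    finally show "slc e (ser \<theta> (lsc (fps_to_fls c) F)) $ a $ m = (fps_const c * slc e (ser \<theta> F)) $ a $ m" .
  qed
  then show ?thesis by (simp add: condition_def quot_pow_scale[OF v] at_root_scale[OF v])
qed

context
  fixes v :: nat and E :: "(nat \<Rightarrow> nat) set"
  assumes v: "0 < v" and st: "staircase d E" and fin: "finite E"
begin

text \<open>Over each column there is one remainder for every level below the height, that is, one
  equation for each point of \<open>E\<close>.\<close>

lemma in_family_condition: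
  "in_family d v E (ser \<theta> F) \<longleftrightarrow> (\<forall>e\<in>E. condition v \<theta> e F = 0)"
proof -
  note height = height_iff[OF staircase_down_closed[OF st] fin]
  have slc: "slc (e(1 := a)) (ser \<theta> F) = slc e (ser \<theta> F)" for e a by (rule slc_cong) auto
  have "in_family d v E (ser \<theta> F) \<longleftrightarrow>
      (\<forall>e\<in>expo {1..d}. \<forall>a. e(1 := a) \<in> E \<longrightarrow> condition v \<theta> (e(1 := a)) F = 0)"
    unfolding in_family_def lin_power_dvd_iff[OF v] condition_def height slc fun_upd_same ..
  also have "\<dots> \<longleftrightarrow> (\<forall>e\<in>E. condition v \<theta> e F = 0)"
  proof (intro iffI ballI allI impI)
    fix e assume *: "\<forall>e\<in>expo {1..d}. \<forall>a. e(1 := a) \<in> E \<longrightarrow> condition v \<theta> (e(1 := a)) F = 0" and e: "e \<in> E"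
    have "e \<in> expo {1..d}" using st e by (auto simp: staircase_def)
    then show "condition v \<theta> e F = 0" using *[rule_format, of e "e 1"] e by simp
  qed blast
  finally show ?thesis .
qed

text \<open>The definition permits any neighborhood and generator. Passing to the fixed
  trivialization multiplies by a series free of \<open>t\<close>, under which the family ideal is
  stable.\<close>

lemma vanishes_on_family_iff:
  assumes F: "\<And>n. F n \<in> carrier G"
  shows "vanishes_on_family X L d x \<phi> v E F \<longleftrightarrow> (\<forall>e\<in>E. condition v \<theta> e F = 0)"
  unfolding in_family_condition[symmetric]
proof
  assume fam: "in_family d v E (ser \<theta> F)"
  show "vanishes_on_family X L d x \<phi> v E F"
    unfolding vanishes_on_family_def
  proof (intro exI conjI allI)
    show "x \<in> U0" "generator X L U0 e0" by (rule xU0, rule gen0)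
    show "coord (F (int n)) \<in> carrier (sheaf X U0)"
      "mres L (pts X) U0 (F (int n)) = coord (F (int n)) \<odot>\<^bsub>msec L U0\<^esub> e0" for n
      by (rule coord[OF F])+
    show "(\<lambda>b. ex U0 (coord (F (int (b 0)))) (b(0 := 0))) \<in> family_ideal d v E"
      unfolding family_ideal_iff[OF d v st fin]
      using fam ser_closed[OF F] by (simp add: ser_def \<theta>_def)
  qed
next
  assume "vanishes_on_family X L d x \<phi> v E F"
  then obtain U e f where U: "x \<in> U" "generator X L U e"
    and f: "\<And>n::nat. f n \<in> carrier (sheaf X U)"
    and eq: "\<And>n::nat. mres L (pts X) U (F (int n)) = f n \<odot>\<^bsub>msec L U\<^esub> e"
    and fam: "(\<lambda>b. ex U (f (b 0)) (b(0 := 0))) \<in> family_ideal d v E"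
    unfolding vanishes_on_family_def by blast
  obtain u where u: "u \<in> carrier (pser {1..d})"
    and change: "\<And>\<sigma> f f'. \<sigma> \<in> carrier (msec L (pts X)) \<Longrightarrow> f \<in> carrier (sheaf X U) \<Longrightarrow>
      f' \<in> carrier (sheaf X U0) \<Longrightarrow> mres L (pts X) U \<sigma> = f \<odot>\<^bsub>msec L U\<^esub> e \<Longrightarrow>
      mres L (pts X) U0 \<sigma> = f' \<odot>\<^bsub>msec L U0\<^esub> e0 \<Longrightarrow> ex U0 f' = conv u (ex U f)"
    by (rule change_of_generator[OF U(2,1) gen0 xU0]) blast
  have "\<theta> (F (int n)) = conv u (ex U (f n))" for n
    unfolding \<theta>_def by (rule change[OF F f coord(1)[OF F] eq coord(2)[OF F]])
  then have "ser \<theta> F = conv u (\<lambda>b. ex U (f (b 0)) (b(0 := 0)))"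
    unfolding ser_def using conv_parameter[OF u, of "\<lambda>n. ex U (f n)"]
      ex_closed[OF generatorD(1)[OF U(2)] U(1) f] by simp
  moreover have "u \<in> carrier (pser {0..d})" by (rule pser_mono[OF _ u]) auto
  ultimately show "in_family d v E (ser \<theta> F)"
    using fam unfolding family_ideal_iff[OF d v st fin] by (simp add: in_family_conv[OF d v st fin])
qed

lemma condition_dvd:
  assumes "\<And>e. e \<in> E \<Longrightarrow> condition v \<theta> e F = 0" "e \<in> expo {1..d}"
  shows "lin v ^ height E e dvd slc e (ser \<theta> F)"
  using assms in_family_condition[of F] by (simp add: in_family_def)

end

end

lemma fps_X_power_dvdI: "(\<And>m. m < N \<Longrightarrow> f $ m = 0) \<Longrightarrow> fps_X ^ N dvd (f :: 'a::field fps)"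
proof -
  assume "\<And>m. m < N \<Longrightarrow> f $ m = 0"
  then have "f = fps_X ^ N * fps_shift N f" by (intro fps_ext) (simp add: fps_X_power_mult_nth)
  then show ?thesis by (metis dvd_triv_left)
qed

lemma fps_X_power_dvdD: "fps_X ^ N dvd (f :: 'a::field fps) \<Longrightarrow> m < N \<Longrightarrow> f $ m = 0"
  by (auto simp: dvd_def fps_X_power_mult_nth)

section \<open>The limit\<close>

text \<open>A section of \<open>L(-iD)\<close> is \<open>g\<^sup>i \<epsilon> f\<close> near a point, with \<open>g\<close> an equation of \<open>D\<close> and \<open>\<epsilon>\<close> a
  generator of \<open>L\<close>; at \<open>p_j\<close> the series of \<open>f\<close> is, up to a unit, the quotient by \<open>x_1\<^sup>i\<close> of the series
  of the section.\<close>

lemma system_div_subI: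
  fixes X :: "('k::field, 'p, 'f) kspace"
  assumes fl: "\<And>j. j \<in> {1..s} \<Longrightarrow> formal_linear X d (p j) (\<phi> j) L (U j) (e j) \<L>"
    and lb: "line_bundle X L"
    and compat: "\<And>j. j \<in> {1..s} \<Longrightarrow> compatible X d D (p j) (\<phi> j)"
    and T: "\<And>j. j \<in> {1..s} \<Longrightarrow> staircase d (T j) \<and> finite (T j)"
    and \<sigma>: "\<sigma> \<in> system_div X L \<L> D i"
    and van: "\<And>j. j \<in> {1..s} \<Longrightarrow> vanish (raise i (T j)) (formal_bundle.\<theta> X d (\<phi> j) L (U j) (e j) \<sigma>)"
  shows "\<sigma> \<in> system_div_sub X L \<L> D i (monomial_subscheme X d s p \<phi> T)"
proof -
  interpret line_bundle X L by (rule lb)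
  have tw: "\<sigma> \<in> carrier (msec (twist X L D i) (pts X))" using \<sigma> by (simp add: system_div_def)
  then have \<sigma>c: "\<sigma> \<in> carrier (msec L (pts X))" by (simp add: twist_carrier)
  have o: "openin (topo X) (pts X)" by simp
  have "\<exists>W e'. \<exists>f\<in>monomial_subscheme X d s p \<phi> T W. x \<in> W \<and> generator X (twist X L D i) W e' \<and>
      mres L (pts X) W \<sigma> = f \<odot>\<^bsub>msec L W\<^esub> e'" if x: "x \<in> pts X" for x
  proof -
    obtain U' e' where U': "x \<in> U'" "generator X L U' e'"
      using invertible x unfolding invertible_sheaf_def by blast
    obtain W g f where W: "openin (topo X) W" "x \<in> W" "W \<subseteq> pts X" "W \<subseteq> U'" and gW: "local_equation X D W g"
      and f: "f \<in> carrier (sheaf X W)"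
      and eq: "mres L (pts X) W \<sigma> = (f \<otimes>\<^bsub>sheaf X W\<^esub> g [^]\<^bsub>sheaf X W\<^esub> i) \<odot>\<^bsub>msec L W\<^esub> mres L U' W e'"
      by (rule twist_local[OF tw o x U'(2,1)]) (rule that)
    note eW = generator_res[OF U'(2) W(1,4)]
    interpret W: cring "sheaf X W" by (rule cring_sheaf[OF W(1)])
    have eq': "mres L (pts X) W \<sigma> = f \<odot>\<^bsub>msec L W\<^esub> (g [^]\<^bsub>sheaf X W\<^esub> i \<odot>\<^bsub>msec L W\<^esub> mres L U' W e')"
      unfolding eq by (rule smult_assoc[OF W(1) f W.nat_pow_closed[OF local_equationD(2)[OF gW]] generatorD(2)[OF eW]])
    have "expansion d (\<phi> j) W f \<in> mono_ideal d (T j)" if j: "j \<in> {1..s}" and pj: "p j \<in> W" for j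
    proof -
      interpret J: formal_linear X d "p j" "\<phi> j" L "U j" "e j" \<L> by (rule fl[OF j])
      have "vanish (T j) (expansion d (\<phi> j) W f)"
        using T[OF j] by (intro J.expansion_vanish[OF compat[OF j] _ gW pj eW f \<sigma>c eq van[OF j]])
          (auto intro: staircase_down_closed)
      then show ?thesis
        using T[OF j] J.ex_closed[OF W(1) pj f] by (simp add: mono_ideal_eq)
    qed
    then have "f \<in> monomial_subscheme X d s p \<phi> T W"
      using f by (simp add: monomial_subscheme_def)
    then show ?thesis using W(2) twist_generator[OF gW eW] eq' by blast
  qed
  then show ?thesis
    using \<sigma> tw unfolding system_div_sub_def vanishes_on_def by simp
qed

theorem theorem1:
  fixes X :: "('k::field, 'p, 'f) kspace"
    and L :: "('p, 'f, 'l) msheaf"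
    and \<L> :: "'l set"
    and D :: "'p set \<Rightarrow> 'f set"
    and d s r :: nat
    and p :: "nat \<Rightarrow> 'p"
    and \<phi> :: "nat \<Rightarrow> ('k, 'p, 'f) formal_map"
    and v :: "nat \<Rightarrow> nat"
    and E :: "nat \<Rightarrow> (nat \<Rightarrow> nat) set"
    and n :: "nat \<Rightarrow> nat"
  assumes "1 \<le> d"
    and "scheme X" and "quasi_projective X" and "generically_smooth X" and "has_dimension X d"
    and "invertible_sheaf X L"
    and "linear_system X L \<L>"
    and "effective_divisor X D"
    and "\<forall>j\<in>{1..s}. p j \<in> pts X \<and> smooth_point X (p j)" and "inj_on p {1..s}"
    and "\<forall>j\<in>{1..s}. formal_neighborhood X d (p j) (\<phi> j) \<and> compatible X d D (p j) (\<phi> j)"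
    and "\<forall>j\<in>{1..s}. 0 < v j"
    and "\<forall>j\<in>{1..s}. staircase d (E j) \<and> finite (E j)"
    and "1 \<le> r"
    and "\<forall>k\<in>{1..r-1}. n (k + 1) < n k"
    and "\<forall>k\<in>{1..r-1}. \<forall>j\<in>{1..s}. v j \<le> n k - n (k + 1)"
    and "\<forall>i\<in>{1..r}.
      system_div_sub X L \<L> D (i - 1)
        (monomial_subscheme X d s p \<phi> (\<lambda>j. slice d (E j) (n i div v j))) =
      system_div X L \<L> D i"
  shows "limit_system X L \<L> (moving_system X L \<L> d s p \<phi> v E) \<subseteq>
    system_div_sub X L \<L> D r
      (monomial_subscheme X d s p \<phi> (suppress_seq d E (\<lambda>i j. n i div v j) r))"
proof -
  note d = assms(1) and staircases = assms(13)
  interpret linear_sys X L \<L>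
    by unfold_locales (use assms in auto)
  have "\<exists>U e. p j \<in> U \<and> generator X L U e" if "j \<in> {1..s}" for j
    using invertible assms(9) that unfolding invertible_sheaf_def by blast
  then obtain U \<epsilon> where gen: "\<And>j. j \<in> {1..s} \<Longrightarrow> p j \<in> U j" "\<And>j. j \<in> {1..s} \<Longrightarrow> generator X L (U j) (\<epsilon> j)"
    by metis
  have fl: "formal_linear X d (p j) (\<phi> j) L (U j) (\<epsilon> j) \<L>" if "j \<in> {1..s}" for j
    by unfold_locales (use assms gen that in auto)
  define th where "th j = formal_bundle.\<theta> X d (\<phi> j) L (U j) (\<epsilon> j)" for j
  have compat: "compatible X d D (p j) (\<phi> j)" and v: "0 < v j"
    and st: "staircase d (E j)" and fin: "finite (E j)" if "j \<in> {1..s}" for j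
    using assms that by auto
  \<comment> \<open>One linear form for each point of each staircase, hence finitely many.\<close>
  define I where "I = (SIGMA j:{1..s}. E j)"
  define lam where "lam = (\<lambda>(j, e). condition (v j) (th j) e)"
  have finI: "finite I" unfolding I_def using fin by auto
  have lam_add: "lam i (\<lambda>n. F n \<oplus>\<^bsub>G\<^esub> H n) = lam i F + lam i H"
    if "i \<in> I" "F \<in> TP" "H \<in> TP" for i F H
    using that formal_linear.condition_add[OF fl] by (auto simp: lam_def I_def th_def)
  have lam_scale: "lam i (lsc (fps_to_fls a) F) = a * lam i F" if "i \<in> I" "F \<in> TP" for i a F
    using that formal_linear.condition_scale[OF fl v] by (auto simp: lam_def I_def th_def)
  have grassmann: "grassmann_point X L \<L> (kernel I lam)"
    by (rule kernel_grassmann[OF finI]) (rule lam_add lam_scale; assumption)+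
  have limit: "limit_system X L \<L> {lsc c F |c F. F \<in> kernel I lam} = (\<lambda>F. F 0) ` kernel I lam"
    by (rule limit_of_kernel[OF finI]) (rule lam_add lam_scale; assumption)+
  have family: "(\<forall>j\<in>{1..s}. vanishes_on_family X L d (p j) (\<phi> j) (v j) (E j) F) \<longleftrightarrow> F \<in> kernel I lam"
    if F: "F \<in> TP" for F
  proof -
    have Fm: "F m \<in> carrier G" for m by (rule TL_carrier[OF subsetD[OF TP_TL F]])
    have "vanishes_on_family X L d (p j) (\<phi> j) (v j) (E j) F \<longleftrightarrow>
        (\<forall>e\<in>E j. condition (v j) (th j) e F = 0)" if j: "j \<in> {1..s}" for j
      unfolding th_def
      by (rule formal_linear.vanishes_on_family_iff[OF fl[OF j] v[OF j] st[OF j] fin[OF j] Fm])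
    then show ?thesis using F by (auto simp: kernel_def I_def lam_def)
  qed
  have X_power: "fls_X ^ N = fps_to_fls (fps_X ^ N)" for N by (simp add: fps_to_fls_power)
  have moving: "moving_system X L \<L> d s p \<phi> v E = {lsc c F |c F. F \<in> kernel I lam}"
  proof (intro subset_antisym subsetI)
    fix F assume "F \<in> moving_system X L \<L> d s p \<phi> v E"
    then obtain N where F: "F \<in> TL" "lsc (fls_X ^ N) F \<in> TP"
      "\<forall>j\<in>{1..s}. vanishes_on_family X L d (p j) (\<phi> j) (v j) (E j) (lsc (fls_X ^ N) F)"
      unfolding moving_system_def by blast
    \<comment> \<open>Multiplying by \<open>t^N\<close> is invertible over \<open>k((t))\<close>, so
      a section of the moving system lies in the span of the kernel.\<close>
    have "lsc (inverse (fls_X ^ N)) (lsc (fls_X ^ N) F) = lsc (inverse (fls_X ^ N) * fls_X ^ N) F"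
      by (rule lsc_lsc[OF F(1)])
    also have "inverse (fls_X ^ N) * fls_X ^ N = (1 :: 'k fls)" by (rule left_inverse) simp
    finally have "F = lsc (inverse (fls_X ^ N)) (lsc (fls_X ^ N) F)" using lsc_one[OF F(1)] by simp
    then show "F \<in> {lsc c F |c F. F \<in> kernel I lam}" using family[OF F(2)] F(3) by blast
  next
    fix F assume "F \<in> {lsc c F |c F. F \<in> kernel I lam}"
    then obtain c H where H: "H \<in> kernel I lam" "F = lsc c H" by blast
    have HTP: "H \<in> TP" using H(1) by (simp add: kernel_def)
    obtain N b where b: "fps_to_fls (fps_X ^ N) * c = fps_to_fls b" by (rule fls_clear_denominator)
    have *: "lsc (fls_X ^ N) F = lsc (fps_to_fls b) H"
      unfolding X_power H(2) using lsc_lsc[OF subsetD[OF TP_TL HTP]] b by simp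
    have "lsc (fps_to_fls b) H \<in> kernel I lam"
      using H(1) by (rule grassmann_pointD(2)[OF grassmann])
    then have "lsc (fls_X ^ N) F \<in> TP \<and>
        (\<forall>j\<in>{1..s}. vanishes_on_family X L d (p j) (\<phi> j) (v j) (E j) (lsc (fls_X ^ N) F))"
      unfolding * using family[OF TP_lsc[OF HTP]] TP_lsc[OF HTP] by blast
    moreover have "F \<in> TL" unfolding H(2) by (rule TL_lsc[OF subsetD[OF TP_TL HTP]])
    ultimately show "F \<in> moving_system X L \<L> d s p \<phi> v E" unfolding moving_system_def by blast
  qed
  have dec: "n (Suc k) < n k" if "1 \<le> k" "k < r" for k
    using assms(15) that by auto
  have orders: "step_orders n (v j) r" if j: "j \<in> {1..s}" for j
  proof
    show "0 < v j" by (rule v[OF j])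
    fix k assume k: "1 \<le> k" "k < r"
    then have "v j \<le> n k - n (k + 1)" using assms(16) j by auto
    then show "n (Suc k) + v j \<le> n k" using dec[OF k] by simp
  qed
  show ?thesis
    unfolding moving limit
  proof (rule image_subsetI)
    fix F assume F: "F \<in> kernel I lam"
    have TP: "F \<in> TP" using F by (simp add: kernel_def)
    have FL: "F m \<in> \<L>" for m by (rule TL_value[OF subsetD[OF TP_TL TP]])
    have dvd: "lin (v j) ^ height (E j) e dvd slc e (ser (th j) F)"
      if j: "j \<in> {1..s}" and e: "e \<in> expo {1..d}" for j e
    proof -
      have "condition (v j) (th j) e F = 0" if "e \<in> E j" for e
        using F j that by (auto simp: kernel_def I_def lam_def)
      then show ?thesis
        unfolding th_def using e by (intro formal_linear.condition_dvd[OF fl[OF j] v[OF j] st[OF j] fin[OF j]])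
    qed
    have coeff: "slc e (ser (th j) F) $ a $ m = th j (F (int m)) (e(0 := 0, 1 := a))"
      if "j \<in> {1..s}" for j e a m
      unfolding th_def by (rule formal_linear.slc_ser[OF fl[OF that]])
    have low: "th j \<sigma> e = 0" if "j \<in> {1..s}" "\<sigma> \<in> system_div X L \<L> D i" "e 1 < i" for j \<sigma> e i
    proof -
      have "\<sigma> \<in> carrier (msec (twist X L D i) (pts X))" using that(2) by (simp add: system_div_def)
      then show ?thesis
        unfolding th_def using that(3)
        by (rule formal_bundle.\<theta>_vanish_system_div[OF formal_linear.axioms(1)[OF fl[OF that(1)]] compat[OF that(1)]])
    qed
    \<comment> \<open>For a section of \<open>L(-iD)\<close> the exponents with first coordinate
      below \<open>i\<close> are settled by \<open>low\<close>, so only those from \<open>i\<close>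
      on have to be checked.\<close>
    have sub: "\<sigma> \<in> system_div_sub X L \<L> D i (monomial_subscheme X d s p \<phi> T)"
      if T: "\<And>j. j \<in> {1..s} \<Longrightarrow> staircase d (T j) \<and> finite (T j)" and \<sigma>: "\<sigma> \<in> system_div X L \<L> D i"
        and van: "\<And>j e. j \<in> {1..s} \<Longrightarrow> e \<in> expo {1..d} \<Longrightarrow> i \<le> e 1 \<Longrightarrow> e(1 := e 1 - i) \<in> T j \<Longrightarrow> th j \<sigma> e = 0"
      for T i \<sigma>
    proof (rule system_div_subI[OF fl line_bundle_axioms compat T \<sigma>])
      fix j assume j: "j \<in> {1..s}"
      have "th j \<sigma> e = 0" if e: "e \<in> raise i (T j)" for e
      proof (cases "e 1 < i")
        case False
        then have eT: "e(1 := e 1 - i) \<in> T j" using e by (simp add: raise_def)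
        then have "e(1 := e 1 - i) \<in> expo {1..d}" using T[OF j] by (auto simp: staircase_def)
        then have "(e(1 := e 1 - i))(1 := e 1) \<in> expo {1..d}" using d by (intro expo_upd[of "e(1 := e 1 - i)"]) auto
        then show ?thesis using van[OF j _ _ eT] False by simp
      qed (rule low[OF j \<sigma>])
      then show "vanish (raise i (T j)) (formal_bundle.\<theta> X d (\<phi> j) L (U j) (\<epsilon> j) \<sigma>)"
        by (simp add: vanish_def th_def)
    qed
    \<comment> \<open>Even for \<open>i = 0\<close> the definition of \<open>twist\<close> asks for
      an equation of \<open>D\<close> around every point; this is where \<open>D\<close> being an
      effective divisor enters.\<close>
    have base: "F m \<in> system_div X L \<L> D 0" for m
    proof -
      have Fm: "F m \<in> carrier (msec L (pts X))" using FL \<L>_sub by blast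
      have "\<exists>V g. \<exists>\<tau>\<in>carrier (msec L V). x \<in> V \<and> V \<subseteq> pts X \<and> local_equation X D V g \<and>
          mres L (pts X) V (F m) = (g [^]\<^bsub>sheaf X V\<^esub> (0::nat)) \<odot>\<^bsub>msec L V\<^esub> \<tau>" if x: "x \<in> pts X" for x
      proof -
        obtain V g where V: "x \<in> V" "local_equation X D V g"
          using assms(8) x unfolding effective_divisor_def by blast
        note oV = local_equationD(1)[OF V(2)]
        have sub: "V \<subseteq> pts X" by (rule openin_subset[OF oV])
        have \<tau>: "mres L (pts X) V (F m) \<in> carrier (msec L V)" by (rule mres_closed[OF open_pts oV sub Fm])
        have "mres L (pts X) V (F m) = (g [^]\<^bsub>sheaf X V\<^esub> (0::nat)) \<odot>\<^bsub>msec L V\<^esub> mres L (pts X) V (F m)"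
          using module.smult_one[OF module_L[OF oV] \<tau>] by simp
        then show ?thesis using V sub \<tau> by blast
      qed
      then show ?thesis using Fm FL by (simp add: system_div_def twist_carrier)
    qed
    \<comment> \<open>Membership in \<open>L(-(i+1)D)\<close> kills the coefficient of
      \<open>x_1^i\<close>; for all \<open>m <= n (Suc i)\<close> together this is an order in
      \<open>T\<close>.\<close>
    have orders_F: "fps_X ^ Suc (n (Suc i)) dvd slc e (ser (th j) F) $ i"
      if j: "j \<in> {1..s}" and div: "\<And>m. m \<le> n (Suc i) \<Longrightarrow> F (int m) \<in> system_div X L \<L> D (Suc i)" for i j e
    proof (rule fps_X_power_dvdI)
      fix m assume "m < Suc (n (Suc i))"
      then show "slc e (ser (th j) F) $ i $ m = 0"
        unfolding coeff[OF j] by (intro low[OF j div]) simp_all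
    qed
    have div: "F (int m) \<in> system_div X L \<L> D (Suc i)" if "i < r" "m \<le> n (Suc i)" for i m
      using that
    proof (induction i arbitrary: m rule: less_induct)
      case (less i)
      have "F (int m) \<in> system_div X L \<L> D i"
      proof (cases i)
        case (Suc i')
        \<comment> \<open>The coefficients needed now are among those treated in the previous
          step.\<close>
        then have "n (Suc i) < n i" using less.prems by (intro dec) auto
        then show ?thesis using less.IH[of i' m] less.prems Suc by simp
      qed (simp add: base)
      then have "F (int m) \<in> system_div_sub X L \<L> D i
          (monomial_subscheme X d s p \<phi> (\<lambda>j. slice d (E j) (n (Suc i) div v j)))"
      proof (rule sub[rotated])
        fix j assume j: "j \<in> {1..s}"
        show "staircase d (slice d (E j) (n (Suc i) div v j)) \<and> finite (slice d (E j) (n (Suc i) div v j))"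
          using slice_facts[OF d st[OF j] fin[OF j]] by blast
        fix e assume e: "e \<in> expo {1..d}" "i \<le> e 1" "e(1 := e 1 - i) \<in> slice d (E j) (n (Suc i) div v j)"
        \<comment> \<open>Slices lie in the hyperplane where coordinate 1 is 0, so after the shift
          by \<open>i\<close> only the coefficient of \<open>x_1^i\<close> matters; that the slice
          contains the point says \<open>h > [n_{i+1}/v_j]\<close>.\<close>
        then have e1: "e 1 = i" and "e(1 := n (Suc i) div v j) \<in> E j" by (auto simp: slice_def)
        then have h: "n (Suc i) div v j < height (E j) e"
          using height_iff[OF staircase_down_closed[OF st[OF j]] fin[OF j]] by blast
        interpret S: step_orders n "v j" r by (rule orders[OF j])
        have "fps_X ^ Suc (n (Suc i)) dvd slc e (ser (th j) F) $ i"
          using less.IH less.prems by (intro S.next_order[OF dvd[OF j e(1)] _ _ h] orders_F[OF j]) auto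
        then have "th j (F (int m)) (e(0 := 0, 1 := i)) = 0"
          using fps_X_power_dvdD[of _ _ m] less.prems(2) coeff[OF j] by (metis le_imp_less_Suc)
        moreover have "e(0 := 0, 1 := i) = e" using e(1) e1 by (auto simp: expo_def)
        ultimately show "th j (F (int m)) e = 0" by simp
      qed
      also have "\<dots> = system_div X L \<L> D (Suc i)"
        using assms(17)[rule_format, of "Suc i"] less.prems(1) by simp
      finally show ?case .
    qed
    show "F 0 \<in> system_div_sub X L \<L> D r
      (monomial_subscheme X d s p \<phi> (suppress_seq d E (\<lambda>i j. n i div v j) r))"
    proof (rule sub)
      show "F 0 \<in> system_div X L \<L> D r" using div[of "r - 1" 0] assms(14) by simp
      fix j assume j: "j \<in> {1..s}"
      let ?S = "suppress_seq d E (\<lambda>i j. n i div v j) r j"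
      show S: "staircase d ?S \<and> finite ?S" by (rule suppress_seq_facts[where E = E and j = j, OF d st[OF j] fin[OF j]])
      interpret S: step_orders n "v j" r by (rule orders[OF j])
      \<comment> \<open>A decrease of \<open>n\<close> by at least \<open>v_j\<close> lowers the
        integer part of \<open>n/v_j\<close> by at least 1, as the description of the suppressed
        heights requires.\<close>
      have tdec: "n (Suc k) div v j < n k div v j" if "1 \<le> k" "k < r" for k
      proof -
        have "(n (Suc k) + v j) div v j \<le> n k div v j" by (rule div_le_mono[OF S.step[OF that]])
        then show ?thesis using v[OF j] by simp
      qed
      fix e assume e: "e \<in> expo {1..d}" "r \<le> e 1" "e(1 := e 1 - r) \<in> ?S"
      obtain a where a: "a \<le> r" "\<And>i. i < a \<Longrightarrow> height (E j) e \<le> n (Suc i) div v j"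
        "height ?S e + r = height (E j) e + a"
        using suppress_seq_height[of d E j e r "\<lambda>i j. n i div v j", OF d st[OF j] fin[OF j] e(1) tdec] by blast
      have "e 1 - r < height ?S e"
        using e(3) height_iff[OF staircase_down_closed, of d ?S] S by blast
      \<comment> \<open>By the choice of \<open>a\<close>, a point of the raised staircase satisfies
        \<open>e 1 < h + a\<close> with \<open>h\<close> the height of \<open>E j\<close> over
        \<open>e\<close>, which is exactly the range covered by \<open>special_order\<close> after
        \<open>a\<close> steps.\<close>
      then have "slc e (ser (th j) F) $ (e 1) $ 0 = 0"
        using a e(2) by (intro S.special_order[OF dvd[OF j e(1)] a(1) orders_F[OF j] a(2)] div) auto
      moreover have "e(0 := 0, 1 := e 1) = e" using e(1) by (auto simp: expo_def)
      ultimately show "th j (F 0) e = 0" unfolding coeff[OF j] by simp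
    qed
  qed
qed

end
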